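(* For all $\alpha\in(0,1)$ the fractional birth and death process $N_\alpha(t)$ admits a representation of the form $$N_\alpha(t)=\sum_{n\ge 0}X_n\,\mathbf{1}_{\{\mathcal{S}_{n,\alpha}\le t<\mathcal{S}_{n+1,\alpha}\}},$$ where $(X_n,\mathcal{S}_{n,\alpha})_{n\ge 0}$ is a Markov renewal process. The transition probabilities are, for $i\ge 1$, $$P[X_{k+1}=i+1\mid X_k=i]=\frac{\lambda_i}{\lambda_i+\mu_i},\qquad P[X_{k+1}=i-1\mid X_k=i]=\frac{\mu_i}{\lambda_i+\mu_i},$$ and the inter-arrival times $\mathcal{T}_{k,\alpha}=\mathcal{S}_{k+1,\alpha}-\mathcal{S}_{k,\alpha}$, conditioned to $\{X_l\}_{1\le l\le k}$, are independent and follow a Mittag-Leffler distribution with parameter $\lambda_i+\mu_i$ (where $i$ is the state $X_k$), i.e. $$G_{i,j}(t)=1-E_{\alpha,1}\big(-(\lambda_i+\mu_i)t^\alpha\big).$$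
   Context: Rates: $\lambda_i>0$ (birth) and $\mu_i>0$ (death) for $i\ge1$, with the convention $\lambda_0=\mu_0=0$. $N_\alpha(t)$, $t\ge0$, denotes the fractional birth and death process of order $\alpha$ killed at zero: a process with states in $\{0,1,2,\dots\}$ whose transition probabilities $p_{i,j,\alpha}(t)=P[N_\alpha(t)=j\mid N_\alpha(0)=i]$ are governed by the time-fractional system of backward equations $$\mathbb{D}^{\alpha}p_{i,j,\alpha}(t)=\mu_i\,p_{i-1,j,\alpha}(t)-(\lambda_i+\mu_i)\,p_{i,j,\alpha}(t)+\lambda_i\,p_{i+1,j,\alpha}(t),\qquad j\ge1,$$ with $p_{0,j,\alpha}(t)=0$ for $j\ge1$ and $p_{i,j,\alpha}(0)=\delta_{i,j}$, where $\mathbb{D}^\alpha f(t)=\frac{1}{\Gamma(1-\alpha)}\int_0^t\frac{f'(s)}{(t-s)^\alpha}\,ds$ for $\alpha\in(0,1)$. Mittag-Leffler function: $E_{\alpha,1}(z)=\sum_{k\ge 0}\frac{z^k}{\Gamma(\alpha k+1)}$. Markov renewal process with state space $\{0,1,2,\dots\}$: a Markov chain $(X_n)_{n\ge0}$ on $\{0,1,2,\dots\}$ together with random times $\mathcal{S}_0=0$, $\mathcal{S}_n<\mathcal{S}_{n+1}$ for all $n\ge0$, such that for all $j$, $n\ge0$ and $t\ge0$, $$P[X_{n+1}=j,\ \mathcal{S}_{n+1}-\mathcal{S}_n\le t\mid (X_l,\mathcal{S}_l),\,1\le l\le n]=P[X_{n+1}=j,\ \mathcal{S}_{n+1}-\mathcal{S}_n\le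 t\mid X_n].$$ The differences $\mathcal{S}_{n+1}-\mathcal{S}_n$ are called the inter-arrival times. With $p_{i,j}=P[X_{n+1}=j\mid X_n=i]$ and $Q_{i,j}(t)=P[X_{n+1}=j,\ \mathcal{S}_{n+1}-\mathcal{S}_n\le t\mid X_n=i]$, one sets $G_{i,j}(t)=Q_{i,j}(t)/p_{i,j}$, i.e. $G_{i,j}(t)$ is the probability that the inter-arrival time is at most $t$ given that the chain goes from $i$ to $j$ at that step.
   Formalization: The process is taken to be the one given by the minimal nonnegative solution of the backward system (for explosive rates others exist and the claim fails), and the Mittag-Leffler law is stated only for states i ≥ 1, since at the absorbing state 0 it would force infinite inter-arrival times. *)

theory Defs
  imports "HOL-Probability.Probability"
begin

section \<open>The time-fractional backward equations\<close>

definition mittag_leffler :: "real \<Rightarrow> real \<Rightarrow> real" where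
  "mittag_leffler \<alpha> z = (\<Sum>k. z ^ k / Gamma (\<alpha> * real k + 1))"

definition caputo_deriv :: "real \<Rightarrow> (real \<Rightarrow> real) \<Rightarrow> real \<Rightarrow> real" where
  "caputo_deriv \<alpha> f t =
     1 / Gamma (1 - \<alpha>) * (LINT s:{0<..<t}|lborel. deriv f s / (t - s) powr \<alpha>)"

text \<open>
  Conditions under which the totalised operators in \<^const>\<open>caputo_deriv\<close> have their intended
  meaning. Continuity at \<open>0\<close> is needed because the integral only sees the derivative on \<open>(0, t)\<close>, so
  that it would not notice a jump away from the initial value.
\<close>

definition caputo_differentiable :: "real \<Rightarrow> (real \<Rightarrow> real) \<Rightarrow> bool" where
  "caputo_differentiable \<alpha> f \<longleftrightarrow>
     continuous_on {0..} f \<and>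
     (\<forall>t>0. f differentiable (at t)) \<and>
     (\<forall>t>0. set_integrable lborel {0<..<t} (\<lambda>s. deriv f s / (t - s) powr \<alpha>))"

text \<open>
  The functions \<open>p i j t\<close> with \<open>j \<ge> 1\<close> solve the backward system. The equation is required for
  \<open>t > 0\<close> only: at \<open>t = 0\<close> the integral is over the empty set. For \<open>i = 0\<close> the truncated index
  \<open>i - 1\<close> is harmless, since the rates are used with \<open>lam 0 = mu 0 = 0\<close>.
\<close>

definition solves_backward ::
    "real \<Rightarrow> (nat \<Rightarrow> real) \<Rightarrow> (nat \<Rightarrow> real) \<Rightarrow> (nat \<Rightarrow> nat \<Rightarrow> real \<Rightarrow> real) \<Rightarrow> bool" where
  "solves_backward \<alpha> lam mu p \<longleftrightarrow>
     (\<forall>i j. p i j 0 = (if i = j then 1 else 0)) \<and>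
     (\<forall>j\<ge>1. \<forall>t\<ge>0. p 0 j t = 0) \<and>
     (\<forall>i. \<forall>j\<ge>1. caputo_differentiable \<alpha> (p i j)) \<and>
     (\<forall>i. \<forall>j\<ge>1. \<forall>t>0.
        caputo_deriv \<alpha> (p i j) t =
          mu i * p (i - 1) j t - (lam i + mu i) * p i j t + lam i * p (i + 1) j t)"

text \<open>
  As for classical birth and death processes, for explosive rates the backward system has several
  nonnegative solutions; the process killed at zero is the one belonging to the minimal solution.
\<close>

definition minimal_backward_solution ::
    "real \<Rightarrow> (nat \<Rightarrow> real) \<Rightarrow> (nat \<Rightarrow> real) \<Rightarrow> (nat \<Rightarrow> nat \<Rightarrow> real \<Rightarrow> real) \<Rightarrow> bool" where
  "minimal_backward_solution \<alpha> lam mu p \<longleftrightarrow>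
     solves_backward \<alpha> lam mu p \<and>
     (\<forall>i j. \<forall>t\<ge>0. 0 \<le> p i j t) \<and>
     (\<forall>q. solves_backward \<alpha> lam mu q \<and> (\<forall>i j. \<forall>t\<ge>0. 0 \<le> q i j t) \<longrightarrow>
        (\<forall>i. \<forall>j\<ge>1. \<forall>t\<ge>0. p i j t \<le> q i j t))"

text \<open>
  A single process \<open>N\<close> determines \<open>P[N(t) = j | N(0) = i]\<close> only for the states \<open>i\<close> charged by its
  initial law, whereas the system couples all states \<open>i\<close>; hence the quantified family \<open>p\<close>.
  The system does not involve \<open>j = 0\<close>; the probability of being in state \<open>0\<close> (killed, or exploded) is
  the remaining mass.
\<close>

definition fractional_bd_process ::
    "real \<Rightarrow> (nat \<Rightarrow> real) \<Rightarrow> (nat \<Rightarrow> real) \<Rightarrow> 'a measure \<Rightarrow> (real \<Rightarrow> 'a \<Rightarrow> nat) \<Rightarrow> bool" where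
  "fractional_bd_process \<alpha> lam mu M N \<longleftrightarrow>
     prob_space M \<and>
     (\<forall>t\<ge>0. N t \<in> measurable M (count_space UNIV)) \<and>
     (\<exists>p. minimal_backward_solution \<alpha> lam mu p \<and>
        (\<forall>i. \<P>(\<omega> in M. N 0 \<omega> = i) > 0 \<longrightarrow>
           (\<forall>j. \<forall>t\<ge>0. \<P>(\<omega> in M. N t \<omega> = j \<bar> N 0 \<omega> = i) = p i j t)))"


section \<open>Markov renewal processes\<close>

text \<open>The \<open>\<sigma>\<close>-algebra generated by \<open>(X\<^sub>l, S\<^sub>l)\<close>, \<open>0 \<le> l \<le> n\<close>.\<close>

definition history ::
    "'a measure \<Rightarrow> (nat \<Rightarrow> 'a \<Rightarrow> nat) \<Rightarrow> (nat \<Rightarrow> 'a \<Rightarrow> real) \<Rightarrow> nat \<Rightarrow> 'a measure" where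
  "history M X S n =
     vimage_algebra (space M) (\<lambda>\<omega>. \<lambda>l\<in>{..n}. (X l \<omega>, S l \<omega>))
       (\<Pi>\<^sub>M l\<in>{..n}. count_space UNIV \<Otimes>\<^sub>M borel)"

definition jump_prob ::
    "'a measure \<Rightarrow> (nat \<Rightarrow> 'a \<Rightarrow> nat) \<Rightarrow> nat \<Rightarrow> nat \<Rightarrow> nat \<Rightarrow> real" where
  "jump_prob M X n i j = \<P>(\<omega> in M. X (Suc n) \<omega> = j \<bar> X n \<omega> = i)"

definition renewal_kernel ::
    "'a measure \<Rightarrow> (nat \<Rightarrow> 'a \<Rightarrow> nat) \<Rightarrow> (nat \<Rightarrow> 'a \<Rightarrow> real) \<Rightarrow> nat \<Rightarrow> nat \<Rightarrow> nat \<Rightarrow> real \<Rightarrow> real" where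
  "renewal_kernel M X S n i j t =
     \<P>(\<omega> in M. X (Suc n) \<omega> = j \<and> S (Suc n) \<omega> - S n \<omega> \<le> t \<bar> X n \<omega> = i)"

definition interarrival_cdf ::
    "'a measure \<Rightarrow> (nat \<Rightarrow> 'a \<Rightarrow> nat) \<Rightarrow> (nat \<Rightarrow> 'a \<Rightarrow> real) \<Rightarrow> nat \<Rightarrow> nat \<Rightarrow> nat \<Rightarrow> real \<Rightarrow> real" where
  "interarrival_cdf M X S n i j t = renewal_kernel M X S n i j t / jump_prob M X n i j"

text \<open>
  The last conjunct is time homogeneity, which makes \<open>Q\<^bsub>i,j\<^esub>(t)\<close> (and hence \<open>p\<^bsub>i,j\<^esub>\<close> and
  \<open>G\<^bsub>i,j\<^esub>(t)\<close>) independent of the step \<open>n\<close>.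
\<close>

definition markov_renewal_process ::
    "'a measure \<Rightarrow> (nat \<Rightarrow> 'a \<Rightarrow> nat) \<Rightarrow> (nat \<Rightarrow> 'a \<Rightarrow> real) \<Rightarrow> bool" where
  "markov_renewal_process M X S \<longleftrightarrow>
     prob_space M \<and>
     (\<forall>n. X n \<in> measurable M (count_space UNIV)) \<and>
     (\<forall>n. S n \<in> borel_measurable M) \<and>
     (\<forall>\<omega>\<in>space M. S 0 \<omega> = 0 \<and> (\<forall>n. S n \<omega> < S (Suc n) \<omega>)) \<and>
     (\<forall>n j. \<forall>t\<ge>0. AE \<omega> in M.
        real_cond_exp M (history M X S n)
          (indicator {\<omega>\<in>space M. X (Suc n) \<omega> = j \<and> S (Suc n) \<omega> - S n \<omega> \<le> t}) \<omega> =
        real_cond_exp M (vimage_algebra (space M) (X n) (count_space UNIV))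
          (indicator {\<omega>\<in>space M. X (Suc n) \<omega> = j \<and> S (Suc n) \<omega> - S n \<omega> \<le> t}) \<omega>) \<and>
     (\<forall>m n i j. \<forall>t\<ge>0. \<P>(\<omega> in M. X m \<omega> = i) > 0 \<and> \<P>(\<omega> in M. X n \<omega> = i) > 0 \<longrightarrow>
        renewal_kernel M X S m i j t = renewal_kernel M X S n i j t)"

text \<open>
  For each \<open>\<omega>\<close> at most one summand is nonzero; beyond \<open>sup\<^sub>n S\<^sub>n\<close> the sum is \<open>0\<close>.
\<close>

definition renewal_path ::
    "(nat \<Rightarrow> 'a \<Rightarrow> nat) \<Rightarrow> (nat \<Rightarrow> 'a \<Rightarrow> real) \<Rightarrow> real \<Rightarrow> 'a \<Rightarrow> nat" where
  "renewal_path X S t \<omega> = (\<Sum>n. X n \<omega> * indicator {S n \<omega>..<S (Suc n) \<omega>} t)"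

text \<open>
  Given \<open>X\<^sub>0 = x\<^sub>0, \<dots>, X\<^sub>n = x\<^sub>n\<close>, the inter-arrival times of the steps \<open>0, \<dots>, n\<close> are independent and
  the one of step \<open>k\<close> has distribution function \<open>F x\<^sub>k\<close>. No law is prescribed for the steps that
  start in the absorbing state \<open>0\<close>.
\<close>

definition cond_independent_interarrivals ::
    "'a measure \<Rightarrow> (nat \<Rightarrow> 'a \<Rightarrow> nat) \<Rightarrow> (nat \<Rightarrow> 'a \<Rightarrow> real) \<Rightarrow> (nat \<Rightarrow> real \<Rightarrow> real) \<Rightarrow> bool" where
  "cond_independent_interarrivals M X S F \<longleftrightarrow>
     (\<forall>n x. \<P>(\<omega> in M. \<forall>l\<le>n. X l \<omega> = x l) > 0 \<longrightarrow>
        prob_space.indep_vars (uniform_measure M {\<omega>\<in>space M. \<forall>l\<le>n. X l \<omega> = x l})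
          (\<lambda>_. borel) (\<lambda>k \<omega>. S (Suc k) \<omega> - S k \<omega>) {..n} \<and>
        (\<forall>k\<le>n. \<forall>t\<ge>0. x k \<ge> 1 \<longrightarrow>
           \<P>(\<omega> in M. S (Suc k) \<omega> - S k \<omega> \<le> t \<bar> \<forall>l\<le>n. X l \<omega> = x l) = F (x k) t))"

end

theory Submission
  imports Defs
begin

text \<open>
  Let \<open>\<kappa> t = t powr (\<alpha> - 1) / Gamma \<alpha>\<close> and let \<open>\<psi>\<^sub>r\<close> be its resolvent, \<open>\<psi>\<^sub>r + r \<kappa> * \<psi>\<^sub>r = \<kappa>\<close>; then
  \<open>r \<psi>\<^sub>r\<close> is the Mittag-Leffler density with survival function \<open>E\<^sub>r t = E\<^sub>\<alpha> (- r t\<^sup>\<alpha>)\<close>. Fractional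
  integration turns the backward system into
  \<open>p\<^sub>i\<^sub>j = \<delta>\<^sub>i\<^sub>j E\<^sub>r + \<psi>\<^sub>r * (lam\<^sub>i p\<^sub>i\<^sub>+\<^sub>1\<^sub>,\<^sub>j + mu\<^sub>i p\<^sub>i\<^sub>-\<^sub>1\<^sub>,\<^sub>j)\<close> with \<open>r = lam\<^sub>i + mu\<^sub>i\<close>. Iterating this equation from
  \<open>0\<close> yields the minimal solution as a sum over the number \<open>m\<close> of jumps, whose \<open>m\<close>-th term is the
  probability that the renewal process is in \<open>j\<close> after exactly \<open>m\<close> jumps.

  Write \<open>p = \<beta> * K\<close>, where \<open>\<beta> t = t powr - \<alpha> / Gamma (1 - \<alpha>)\<close> and \<open>K\<close> is the same sum with the last
  factor \<open>E\<^sub>r\<close> replaced by \<open>\<psi>\<^sub>r\<close>. Then \<open>K \<le> \<kappa>\<close>, \<open>K\<close> is continuous on \<open>t > 0\<close>, and \<open>p' i j\<close> is the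
  generator applied to \<open>K\<close>; this gives the regularity that the Caputo derivative needs, for explosive
  rates as well. All functions involved are nonnegative, so convolutions are taken in \<^typ>\<open>ennreal\<close>,
  where they form a commutative semiring without integrability conditions.
\<close>

text \<open>Working with nonnegative functions presupposes that the resolvent kernel is nonnegative,
  which its alternating series does not show; positivity comes from a comparison in the Volterra
  equation at a hypothetical first zero. A competing solution has a derivative of unknown sign, so
  the positive and negative parts of that derivative stay on opposite sides of each equation until
  they cancel.

  The Picard iteration conditions on the first jump, whereas a process built step by step grows at
  its last jump. Both describe the same sum over paths, and associativity of convolution passes from
  one to the other. The bound by \<kappa> holds because \<kappa> itself solves the equation of the
  iteration with a source at least as large, so it does not see how fast the rates grow.

  State 0 collects absorption and explosion. Hence solutions are compared only for target states
  \<open>j \<ge> 1\<close>, and the probability of 0 is recovered as the remaining mass.\<close>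

lemma ennreal_enn2real_of_le:
  assumes "x \<le> ennreal y"
  shows "x = ennreal (enn2real x)"
  using assms by (cases x) (auto simp: top_unique)

text \<open>The law \<open>geometric_pmf (1 / 2)\<close> gives k the mass
  \<open>(1 / 2) ^ Suc k\<close>, the weight of a binary digit, so the positions of the ones in the
  binary expansion of p form a set of measure p. One discrete law can thus decide the jump direction
  in every state.\<close>

lemma ex_subset_geometric_pmf:
  assumes p: "0 \<le> p" "p < 1"
  shows "\<exists>A. measure (measure_pmf (geometric_pmf (1 / 2))) A = p"
proof -
  \<comment> \<open>The integer \<open>f n\<close> is formed by the first n binary digits of p, so
    \<open>f n / 2 ^ n\<close> is the truncation of p, and \<open>f (Suc k)\<close> is odd exactly
    when the digit of weight \<open>(1 / 2) ^ Suc k\<close> is 1.\<close>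
  define f where "f n = \<lfloor>2 ^ n * p\<rfloor>" for n :: nat
  define A where "A = {k. odd (f (Suc k))}"
  have f_Suc: "f (Suc n) = 2 * f n + of_bool (odd (f (Suc n)))" for n
  proof -
    have "2 * f n \<le> f (Suc n)" "f (Suc n) \<le> 2 * f n + 1"
      unfolding f_def by (simp_all add: mult.assoc) linarith+
    then have "f (Suc n) = 2 * f n \<or> f (Suc n) = 2 * f n + 1" by linarith
    then show ?thesis by auto
  qed
  have sum: "(\<Sum>k<n. of_bool (k \<in> A) * (1 / 2) ^ Suc k) = real_of_int (f n) / 2 ^ n" for n
  proof (induction n)
    case 0
    \<comment> \<open>Here \<open>p < 1\<close> enters: the integer part of p is 0, so the digits
      after the point carry all of p.\<close>
    then show ?case using p by (simp add: f_def floor_eq_iff)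
  next
    case (Suc n)
    have "real_of_int (f (Suc n)) = 2 * real_of_int (f n) + of_bool (n \<in> A)"
      by (subst f_Suc) (simp add: A_def)
    then show ?case using Suc by (simp add: field_simps power_divide)
  qed
  have "(\<lambda>n. real_of_int (f n) / 2 ^ n) \<longlonglongrightarrow> p"
  proof (rule tendsto_sandwich)
    have "(\<lambda>n. p - (1 / 2) ^ n) \<longlonglongrightarrow> p - 0"
      by (intro tendsto_intros LIMSEQ_power_zero) auto
    then show "(\<lambda>n. p - (1 / 2) ^ n) \<longlonglongrightarrow> p" by simp
    show "(\<lambda>n. p) \<longlonglongrightarrow> p" by (rule tendsto_const)
    show "\<forall>\<^sub>F n in sequentially. p - (1 / 2) ^ n \<le> real_of_int (f n) / 2 ^ n"
    proof (intro always_eventually allI)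
      fix n
      have "2 ^ n * p - 1 \<le> real_of_int (f n)" unfolding f_def by linarith
      then have "(2 ^ n * p - 1) / 2 ^ n \<le> real_of_int (f n) / 2 ^ n"
        by (rule divide_right_mono) simp
      then show "p - (1 / 2) ^ n \<le> real_of_int (f n) / 2 ^ n"
        by (simp add: diff_divide_distrib power_divide)
    qed
    show "\<forall>\<^sub>F n in sequentially. real_of_int (f n) / 2 ^ n \<le> p"
    proof (intro always_eventually allI)
      fix n
      have "real_of_int (f n) \<le> 2 ^ n * p" unfolding f_def by linarith
      then show "real_of_int (f n) / 2 ^ n \<le> p" by (simp add: field_simps)
    qed
  qed
  then have sums: "(\<lambda>k. of_bool (k \<in> A) * (1 / 2) ^ Suc k) sums p"
    unfolding sums_def sum .
  have "emeasure (measure_pmf (geometric_pmf (1 / 2))) A =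
      (\<integral>\<^sup>+k. indicator A k \<partial>measure_pmf (geometric_pmf (1 / 2)))"
    by simp
  also have "\<dots> = (\<integral>\<^sup>+k. ennreal (of_bool (k \<in> A) * (1 / 2) ^ Suc k) \<partial>count_space UNIV)"
    unfolding nn_integral_measure_pmf by (intro nn_integral_cong) (auto simp: indicator_def mult.commute)
  also have "\<dots> = ennreal p"
    unfolding nn_integral_count_space_nat using sums_unique[OF sums] sums_summable[OF sums]
    by (subst suminf_ennreal2) auto
  finally show ?thesis using p by (auto simp: measure_def intro!: exI[of _ A])
qed

lemma nn_integral_of_bool:
  assumes [measurable]: "Measurable.pred M P"
  shows "(\<integral>\<^sup>+\<omega>. of_bool (P \<omega>) \<partial>M) = emeasure M {\<omega> \<in> space M. P \<omega>}"
proof -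
  have "(\<integral>\<^sup>+\<omega>. of_bool (P \<omega>) \<partial>M) = (\<integral>\<^sup>+\<omega>. indicator {\<omega> \<in> space M. P \<omega>} \<omega> \<partial>M)"
    by (intro nn_integral_cong) auto
  then show ?thesis by simp
qed

lemma subalgebra_vimage_algebra:
  assumes "f \<in> measurable M N"
  shows "subalgebra M (vimage_algebra (space M) f N)"
  using assms measurable_space[OF assms]
  by (auto simp: subalgebra_def sets_vimage_algebra2 intro: measurable_sets)

text \<open>Countable additivity over the values of \<open>N t\<close>. The backward system says
  nothing about the target state 0, so its probability has to be obtained from the others.\<close>

lemma cond_prob_0_eq:
  fixes N :: "real \<Rightarrow> 'b \<Rightarrow> nat"
  assumes "prob_space M" and meas: "\<And>t. 0 \<le> t \<Longrightarrow> N t \<in> measurable M (count_space UNIV)"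
    and pos: "0 < \<P>(\<omega> in M. N 0 \<omega> = i)" and t: "0 \<le> t"
  shows "\<P>(\<omega> in M. N t \<omega> = 0 \<bar> N 0 \<omega> = i) = 1 - (\<Sum>j. \<P>(\<omega> in M. N t \<omega> = Suc j \<bar> N 0 \<omega> = i))"
proof -
  interpret prob_space M by fact
  have [measurable]: "N t \<in> measurable M (count_space UNIV)" "N 0 \<in> measurable M (count_space UNIV)"
    using meas t by auto
  define A where "A j = {\<omega> \<in> space M. N t \<omega> = j \<and> N 0 \<omega> = i}" for j
  have "A j \<in> sets M" for j unfolding A_def by measurable
  then have "(\<lambda>j. measure M (A j)) sums measure M (\<Union>j. A j)"
    by (intro finite_measure_UNION) (auto simp: disjoint_family_on_def A_def)
  also have "(\<Union>j. A j) = {\<omega> \<in> space M. N 0 \<omega> = i}" by (auto simp: A_def)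
  finally have "(\<lambda>j. measure M (A j) / \<P>(\<omega> in M. N 0 \<omega> = i)) sums 1"
    using sums_divide[of _ "\<P>(\<omega> in M. N 0 \<omega> = i)" "\<P>(\<omega> in M. N 0 \<omega> = i)"] pos by simp
  then have "(\<lambda>j. \<P>(\<omega> in M. N t \<omega> = j \<bar> N 0 \<omega> = i)) sums 1"
    by (simp add: cond_prob_def A_def)
  then have "(\<lambda>j. \<P>(\<omega> in M. N t \<omega> = Suc j \<bar> N 0 \<omega> = i)) sums (1 - \<P>(\<omega> in M. N t \<omega> = 0 \<bar> N 0 \<omega> = i))"
    by (subst sums_Suc_iff) simp
  then show ?thesis by (simp add: sums_unique[symmetric])
qed

section \<open>Convolution of nonnegative functions\<close>

text \<open>The integral runs over the whole line. The functions of interest vanish on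
  \<open>t \<le> 0\<close>, which turns it into the usual convolution over \<open>[0, t]\<close>
  without a moving boundary in the formulas.\<close>

definition conv :: "(real \<Rightarrow> ennreal) \<Rightarrow> (real \<Rightarrow> ennreal) \<Rightarrow> real \<Rightarrow> ennreal" where
  "conv f g t = (\<integral>\<^sup>+s. f (t - s) * g s \<partial>lborel)"

lemma measurable_conv [measurable]:
  assumes [measurable]: "f \<in> borel_measurable borel" "g \<in> borel_measurable borel"
  shows "conv f g \<in> borel_measurable borel"
  unfolding conv_def by measurable

lemma conv_commute:
  assumes [measurable]: "f \<in> borel_measurable borel" "g \<in> borel_measurable borel"
  shows "conv f g = conv g f"
proof
  fix t
  have "conv f g t = ennreal \<bar>-1\<bar> * (\<integral>\<^sup>+s. f (t - (t + -1 * s)) * g (t + -1 * s) \<partial>lborel)"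
    unfolding conv_def by (rule nn_integral_real_affine) auto
  then show "conv f g t = conv g f t"
    by (simp add: conv_def mult.commute)
qed

text \<open>A translation by s in the inner integral separates the arguments; the exchange of the
  integrals is Tonelli's theorem.\<close>

lemma conv_assoc:
  assumes [measurable]: "f \<in> borel_measurable borel" "g \<in> borel_measurable borel"
    "h \<in> borel_measurable borel"
  shows "conv (conv f g) h = conv f (conv g h)"
proof
  fix t
  have "conv (conv f g) h t = (\<integral>\<^sup>+s. (\<integral>\<^sup>+u. f (t - s - u) * g u * h s \<partial>lborel) \<partial>lborel)"
    unfolding conv_def by (subst nn_integral_multc) auto
  also have "\<dots> = (\<integral>\<^sup>+s. (\<integral>\<^sup>+u. f (t - u) * g (u - s) * h s \<partial>lborel) \<partial>lborel)"
  proof (rule nn_integral_cong)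
    fix s :: real
    show "(\<integral>\<^sup>+u. f (t - s - u) * g u * h s \<partial>lborel) = (\<integral>\<^sup>+u. f (t - u) * g (u - s) * h s \<partial>lborel)"
      by (subst nn_integral_real_affine[where c=1 and t="-s"]) (auto simp: algebra_simps)
  qed
  also have "\<dots> = (\<integral>\<^sup>+u. (\<integral>\<^sup>+s. f (t - u) * g (u - s) * h s \<partial>lborel) \<partial>lborel)"
    by (rule lborel_pair.Fubini') measurable
  also have "\<dots> = conv f (conv g h) t"
    unfolding conv_def by (subst nn_integral_cmult[symmetric]) (auto simp: mult.assoc)
  finally show "conv (conv f g) h t = conv f (conv g h) t" .
qed

lemma conv_add_right:
  assumes [measurable]: "f \<in> borel_measurable borel" "g \<in> borel_measurable borel"
    "h \<in> borel_measurable borel"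
  shows "conv f (\<lambda>s. g s + h s) t = conv f g t + conv f h t"
  unfolding conv_def by (subst nn_integral_add[symmetric]) (auto simp: algebra_simps)

lemma conv_cmult_right:
  assumes [measurable]: "f \<in> borel_measurable borel" "g \<in> borel_measurable borel"
  shows "conv f (\<lambda>s. c * g s) t = c * conv f g t"
  unfolding conv_def by (subst nn_integral_cmult[symmetric]) (auto simp: algebra_simps)

lemma conv_add_left:
  assumes [measurable]: "f \<in> borel_measurable borel" "g \<in> borel_measurable borel"
    "h \<in> borel_measurable borel"
  shows "conv (\<lambda>s. g s + h s) f t = conv g f t + conv h f t"
  unfolding conv_def by (subst nn_integral_add[symmetric]) (auto simp: algebra_simps)

lemma conv_cmult_left:
  assumes [measurable]: "f \<in> borel_measurable borel" "g \<in> borel_measurable borel"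
  shows "conv (\<lambda>s. c * g s) f t = c * conv g f t"
  unfolding conv_def by (subst nn_integral_cmult[symmetric]) (auto simp: algebra_simps)

lemma conv_zero_right [simp]: "conv f (\<lambda>_. 0) = (\<lambda>_. 0)"
  by (simp add: conv_def fun_eq_iff)

lemma conv_mono: "(\<And>s. f s \<le> f' s) \<Longrightarrow> (\<And>s. g s \<le> g' s) \<Longrightarrow> conv f g t \<le> conv f' g' t"
  unfolding conv_def by (intro nn_integral_mono mult_mono) auto

lemma conv_nonpos:
  assumes "\<And>s. s \<le> 0 \<Longrightarrow> f s = 0" "\<And>s. s \<le> 0 \<Longrightarrow> g s = 0" "t \<le> 0"
  shows "conv f g t = 0"
proof -
  have "f (t - s) * g s = 0" for s
    using assms(1)[of "t - s"] assms(2)[of s] assms(3) by (cases "s \<le> 0") auto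
  then show ?thesis unfolding conv_def by (simp only: nn_integral_const) simp
qed

lemma conv_suminf_right:
  assumes [measurable]: "f \<in> borel_measurable borel" "\<And>n. g n \<in> borel_measurable borel"
  shows "conv f (\<lambda>s. \<Sum>n. g n s) t = (\<Sum>n. conv f (g n) t)"
  unfolding conv_def by (subst nn_integral_suminf[symmetric]) auto

section \<open>Kernels of Riemann-Liouville integration\<close>

text \<open>Convolution with this kernel is the Riemann-Liouville integral of order a. Orders
  \<alpha> and \<open>1 - \<alpha>\<close> give \<kappa> and \<beta> of the overview. Order 1 is the
  Heaviside function with value 0 at 0, so \<open>conv (ek 1)\<close> is integration from 0 to t for
  functions vanishing on the negative axis.\<close>

definition frac_kernel :: "real \<Rightarrow> real \<Rightarrow> real" where
  "frac_kernel a t = (if 0 < t then t powr (a - 1) / Gamma a else 0)"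

lemma measurable_frac_kernel [measurable]: "frac_kernel a \<in> borel_measurable borel"
  unfolding frac_kernel_def by measurable

lemma frac_kernel_nonneg [simp]: "0 < a \<Longrightarrow> 0 \<le> frac_kernel a t"
  by (auto simp: frac_kernel_def intro!: divide_nonneg_pos Gamma_real_pos)

lemma frac_kernel_pos: "0 < a \<Longrightarrow> 0 < t \<Longrightarrow> 0 < frac_kernel a t"
  by (auto simp: frac_kernel_def intro!: divide_pos_pos Gamma_real_pos)

lemma frac_kernel_nonpos [simp]: "t \<le> 0 \<Longrightarrow> frac_kernel a t = 0"
  by (simp add: frac_kernel_def)

lemma frac_kernel_1: "0 < t \<Longrightarrow> frac_kernel 1 t = 1"
  by (simp add: frac_kernel_def)

abbreviation ek :: "real \<Rightarrow> real \<Rightarrow> ennreal" where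
  "ek a \<equiv> \<lambda>t. ennreal (frac_kernel a t)"

text \<open>The semigroup law of fractional integration: the substitution \<open>s = t * u\<close>
  produces Euler's integral for \<open>Beta b a\<close>, whose Gamma factors cancel against those of
  the kernels.\<close>

lemma conv_frac_kernel:
  assumes a: "0 < a" and b: "0 < b"
  shows "conv (ek a) (ek b) t = ek (a + b) t"
proof (cases "0 < t")
  case False
  then show ?thesis by (subst conv_nonpos) auto
next
  case t: True
  have [simp]: "0 < Gamma a" "0 < Gamma b" "0 < Gamma (a + b)"
    using a b by (auto intro!: Gamma_real_pos)
  have "conv (ek a) (ek b) t =
      ennreal \<bar>t\<bar> * (\<integral>\<^sup>+u. ek a (t - (0 + t * u)) * ek b (0 + t * u) \<partial>lborel)"
    unfolding conv_def by (rule nn_integral_real_affine) (use t in auto)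
  also have "(\<integral>\<^sup>+u. ek a (t - (0 + t * u)) * ek b (0 + t * u) \<partial>lborel) =
     (\<integral>\<^sup>+u. ennreal (t powr (a + b - 2) / (Gamma a * Gamma b)) *
        ennreal (indicator {0<..<1} u * (u powr (b - 1) * (1 - u) powr (a - 1))) \<partial>lborel)"
  proof (rule nn_integral_cong)
    fix u :: real
    consider "u \<le> 0" | "1 \<le> u" | "0 < u" "u < 1" by linarith
    then show "ek a (t - (0 + t * u)) * ek b (0 + t * u) =
      ennreal (t powr (a + b - 2) / (Gamma a * Gamma b)) *
        ennreal (indicator {0<..<1} u * (u powr (b - 1) * (1 - u) powr (a - 1)))"
    proof cases
      case 1
      then show ?thesis using t by (simp add: mult_nonneg_nonpos)
    next
      case 2
      then show ?thesis using t by simp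
    next
      case 3
      have eq: "t - (0 + t * u) = t * (1 - u)" by (simp add: algebra_simps)
      have "frac_kernel a (t - (0 + t * u)) * frac_kernel b (0 + t * u) =
          (t powr (a - 1) * t powr (b - 1)) / (Gamma a * Gamma b) *
          (u powr (b - 1) * (1 - u) powr (a - 1))"
        unfolding eq frac_kernel_def using t 3 by (simp add: powr_mult)
      also have "t powr (a - 1) * t powr (b - 1) = t powr (a + b - 2)"
        by (simp add: powr_add[symmetric] algebra_simps)
      finally show ?thesis using a b 3
        by (simp add: ennreal_mult'[symmetric])
    qed
  qed
  also have "\<dots> = ennreal (t powr (a + b - 2) / (Gamma a * Gamma b)) *
     (\<integral>\<^sup>+u. ennreal (indicator {0<..<1} u * (u powr (b - 1) * (1 - u) powr (a - 1))) \<partial>lborel)"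
    by (rule nn_integral_cmult) auto
  also have "(\<integral>\<^sup>+u. ennreal (indicator {0<..<1} u * (u powr (b - 1) * (1 - u) powr (a - 1))) \<partial>lborel)
     = ennreal (Beta b a)"
    by (rule nn_integral_has_integral_lebesgue)
      (use has_integral_Beta_real[OF b a] in \<open>auto simp: has_integral_Icc_iff_Ioo\<close>)
  also have "ennreal \<bar>t\<bar> * (ennreal (t powr (a + b - 2) / (Gamma a * Gamma b)) * ennreal (Beta b a))
     = ennreal (t * (t powr (a + b - 2) / (Gamma a * Gamma b) * Beta b a))"
  proof -
    have *: "0 \<le> t powr (a + b - 2) / (Gamma a * Gamma b)" by (simp add: less_imp_le)
    have "\<bar>t\<bar> = t" using t by simp
    then show ?thesis using t by (simp only: ennreal_mult'[OF less_imp_le[OF t]] ennreal_mult'[OF *])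
  qed
  also have "t * (t powr (a + b - 2) / (Gamma a * Gamma b) * Beta b a) = frac_kernel (a + b) t"
  proof -
    have *: "t * t powr (a + b - 2) = t powr (a + b - 1)"
      using t powr_add[of t 1 "a + b - 2"] by simp
    have "t * (T / (A * B) * (B * A / C)) = t * T / C" if "0 < A" "0 < B" for T A B C :: real
      using that by simp
    from this[of "Gamma a" "Gamma b" "t powr (a + b - 2)" "Gamma (a + b)"] show ?thesis using t
      by (simp add: frac_kernel_def Beta_def add.commute[of b a] * del: times_divide_eq_right)
  qed
  finally show ?thesis .
qed

text \<open>Only the part of the Gamma integral over \<open>[L, \<infinity>)\<close> is kept; there
  \<open>x powr (y - 1)\<close> is at least \<open>L powr (y - 1)\<close> because
  \<open>y \<ge> 1\<close>. Since L is free, Gamma outgrows every geometric sequence.\<close>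

lemma Gamma_ge_powr:
  assumes "1 \<le> y" "0 < L"
  shows "exp (- L) * L powr (y - 1) \<le> (Gamma y :: real)"
proof -
  have "((\<lambda>x. exp (- 1 * x) * L powr (y - 1)) has_integral exp (- 1 * L) / 1 * L powr (y - 1)) {L..}"
    by (intro has_integral_mult_left has_integral_exp_minus_to_infinity) auto
  then have "((\<lambda>x. if x \<in> {L..} then exp (- 1 * x) * L powr (y - 1) else 0)
      has_integral exp (- 1 * L) / 1 * L powr (y - 1)) {0..}"
    using assms by (subst has_integral_restrict) auto
  moreover have "((\<lambda>t. t powr (y - 1) / exp t) has_integral Gamma y) {0..}"
    using Gamma_integral_real[of y] assms by simp
  ultimately have "exp (- 1 * L) / 1 * L powr (y - 1) \<le> Gamma y"
  proof (rule has_integral_le)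
    fix x :: real
    show "(if x \<in> {L..} then exp (- 1 * x) * L powr (y - 1) else 0) \<le> x powr (y - 1) / exp x"
      using assms by (auto simp: exp_minus divide_inverse mult.commute intro!: mult_mono powr_mono2)
  qed
  then show ?thesis by simp
qed

section \<open>Mittag-Leffler kernels\<close>

locale fractional_order =
  fixes \<alpha> :: real
  assumes order: "0 < \<alpha>" "\<alpha> < 1"
begin

lemma summable_ml:
  assumes b: "0 < b"
  shows "summable (\<lambda>n. (1 / Gamma (\<alpha> * real n + b)) * x ^ n)"
proof (rule summable_comparison_test')
  \<comment> \<open>With \<open>L powr \<alpha> = 2 * \<bar>x\<bar> + 1\<close> the terms are
    dominated by powers of \<open>\<bar>x\<bar> / (2 * \<bar>x\<bar> + 1)\<close>, which is at most
    1/2; the summand 1 keeps L positive for \<open>x = 0\<close>.\<close>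
  define L where "L = (2 * \<bar>x\<bar> + 1) powr (1 / \<alpha>)"
  have L: "0 < L" "L powr \<alpha> = 2 * \<bar>x\<bar> + 1"
    using order by (simp_all add: L_def powr_powr)
  show "summable (\<lambda>n. exp L * L powr (1 - b) * (1 / 2) ^ n)"
    by (intro summable_mult summable_geometric) auto
  \<comment> \<open>From this index on the argument of Gamma is at least 1, as the lower bound
    requires.\<close>
  fix n :: nat assume n: "nat \<lceil>1 / \<alpha>\<rceil> \<le> n"
  then have "1 / \<alpha> \<le> real n" by linarith
  then have "1 \<le> \<alpha> * real n" using order by (simp add: field_simps)
  then have y: "1 \<le> \<alpha> * real n + b" using b by linarith
  have G: "exp (- L) * L powr (\<alpha> * real n + b - 1) \<le> Gamma (\<alpha> * real n + b)"
    by (rule Gamma_ge_powr[OF y L(1)])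
  have pos: "0 < exp (- L) * L powr (\<alpha> * real n + b - 1)" using L by simp
  have "norm ((1 / Gamma (\<alpha> * real n + b)) * x ^ n) = \<bar>x\<bar> ^ n / Gamma (\<alpha> * real n + b)"
    using less_le_trans[OF pos G] by (simp add: abs_mult power_abs)
  also have "\<dots> \<le> \<bar>x\<bar> ^ n / (exp (- L) * L powr (\<alpha> * real n + b - 1))"
    by (intro divide_left_mono G mult_pos_pos pos less_le_trans[OF pos G]) auto
  also have "L powr (\<alpha> * real n + b - 1) = (2 * \<bar>x\<bar> + 1) ^ n / L powr (1 - b)"
  proof -
    have "L powr (\<alpha> * real n + b - 1) = L powr (\<alpha> * real n - (1 - b))"
      by (rule arg_cong[where f = "\<lambda>x. L powr x"]) simp
    also have "\<dots> = (L powr \<alpha>) powr real n / L powr (1 - b)"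
      by (simp only: powr_diff powr_powr)
    also have "\<dots> = (2 * \<bar>x\<bar> + 1) ^ n / L powr (1 - b)"
      unfolding L(2) by (subst powr_realpow) auto
    finally show ?thesis .
  qed
  also have "\<bar>x\<bar> ^ n / (exp (- L) * ((2 * \<bar>x\<bar> + 1) ^ n / L powr (1 - b))) =
      exp L * L powr (1 - b) * (\<bar>x\<bar> / (2 * \<bar>x\<bar> + 1)) ^ n"
    by (simp add: exp_minus power_divide divide_simps)
  also have "\<dots> \<le> exp L * L powr (1 - b) * (1 / 2) ^ n"
    by (intro mult_left_mono power_mono) (auto simp: field_simps)
  finally show "norm ((1 / Gamma (\<alpha> * real n + b)) * x ^ n)
      \<le> exp L * L powr (1 - b) * (1 / 2) ^ n" .
qed

text \<open>This is \<open>t powr (b - 1)\<close> times the two-parameter Mittag-Leffler function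
  with parameters \<alpha>, b at \<open>- r * t powr \<alpha>\<close>. The value
  \<open>b = \<alpha>\<close> gives the resolvent kernel, \<open>b = 1\<close> the survival
  function, and r times the kernel for \<open>b = \<alpha> + 1\<close> is the distribution
  function.\<close>

definition ml_kernel :: "real \<Rightarrow> real \<Rightarrow> real \<Rightarrow> real" where
  "ml_kernel b r t =
     (if 0 < t then t powr (b - 1) * (\<Sum>n. 1 / Gamma (\<alpha> * real n + b) * (- r * t powr \<alpha>) ^ n) else 0)"

lemma ml_kernel_nonpos [simp]: "t \<le> 0 \<Longrightarrow> ml_kernel b r t = 0"
  by (simp add: ml_kernel_def)

lemma ml_kernel_1: "0 < t \<Longrightarrow> ml_kernel 1 r t = mittag_leffler \<alpha> (- r * t powr \<alpha>)"
  by (simp add: ml_kernel_def mittag_leffler_def field_simps)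

lemma order_add_pos [simp]: "0 < b \<Longrightarrow> 0 < \<alpha> * real n + b"
  using order by (intro add_nonneg_pos) auto

lemma frac_kernel_power:
  assumes "0 < t"
  shows "t powr (b - 1) * (1 / Gamma (\<alpha> * real n + b) * (x * t powr \<alpha>) ^ n) =
    x ^ n * frac_kernel (\<alpha> * real n + b) t"
proof -
  have "t powr (b - 1) * (t powr \<alpha>) ^ n = t powr (\<alpha> * real n + b - 1)"
    using assms by (simp add: powr_realpow[symmetric] powr_powr powr_add[symmetric] algebra_simps)
  then show ?thesis using assms
    by (simp add: frac_kernel_def power_mult_distrib mult_ac)
qed

lemma summable_frac_kernel:
  assumes b: "0 < b"
  shows "summable (\<lambda>n. x ^ n * frac_kernel (\<alpha> * real n + b) t)"
proof (cases "0 < t")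
  case True
  then show ?thesis
    using summable_mult[OF summable_ml[OF b], of "t powr (b - 1)" "x * t powr \<alpha>"]
    by (simp only: frac_kernel_power)
qed auto

lemma ml_kernel_eq:
  assumes b: "0 < b"
  shows "ml_kernel b r t = (\<Sum>n. (- r) ^ n * frac_kernel (\<alpha> * real n + b) t)"
proof (cases "0 < t")
  case True
  then show ?thesis
    using suminf_mult[OF summable_ml[OF b], of "t powr (b - 1)" "- r * t powr \<alpha>"]
    by (simp only: frac_kernel_power ml_kernel_def if_True)
qed auto

lemma measurable_ml_kernel [measurable]:
  assumes [simp]: "0 < b" shows "ml_kernel b r \<in> borel_measurable borel"
proof -
  have "ml_kernel b r = (\<lambda>t. \<Sum>n. (- r) ^ n * frac_kernel (\<alpha> * real n + b) t)"
    using ml_kernel_eq by auto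
  then show ?thesis by simp
qed

text \<open>Splitting off the term \<open>n = 0\<close> leaves \<open>- r\<close> times the series
  with b shifted by \<alpha>. For \<open>b = \<alpha>\<close> this becomes the resolvent equation,
  and for \<open>b = 1\<close> it says that survival and distribution function add up to 1.\<close>

lemma ml_kernel_resolvent:
  assumes b: "0 < b"
  shows "ml_kernel b r t + r * ml_kernel (b + \<alpha>) r t = frac_kernel b t"
proof -
  have "ml_kernel b r t = frac_kernel b t +
      (\<Sum>n. (- r) ^ Suc n * frac_kernel (\<alpha> * real (Suc n) + b) t)"
    using suminf_split_head[OF summable_frac_kernel[OF b, of "-r" t]]
    by (simp add: ml_kernel_eq[OF b])
  also have "(\<Sum>n. (- r) ^ Suc n * frac_kernel (\<alpha> * real (Suc n) + b) t) =
      (\<Sum>n. - r * ((- r) ^ n * frac_kernel (\<alpha> * real n + (b + \<alpha>)) t))"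
    by (simp add: algebra_simps)
  also have "\<dots> = - r * ml_kernel (b + \<alpha>) r t"
    using b order by (subst suminf_mult[OF summable_frac_kernel]) (auto simp: ml_kernel_eq)
  finally show ?thesis by simp
qed

lemma isCont_ml_kernel:
  assumes b: "0 < b" and t: "0 < t"
  shows "isCont (ml_kernel b r) t"
proof -
  define g where "g x = (\<Sum>n. 1 / Gamma (\<alpha> * real n + b) * x ^ n)" for x
  have g: "isCont g x" for x
    unfolding g_def by (rule isCont_powser_converges_everywhere) (rule summable_ml[OF b])
  have "isCont (\<lambda>t. t powr (b - 1) * g (- r * t powr \<alpha>)) t"
    using t by (intro continuous_intros isCont_o2[OF _ g]) auto
  moreover have "\<forall>\<^sub>F s in nhds t. s powr (b - 1) * g (- r * s powr \<alpha>) = ml_kernel b r s"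
    using eventually_nhds_in_open[of "{0<..}" t] t
    by (auto simp: ml_kernel_def g_def elim!: eventually_mono)
  ultimately show ?thesis by (simp add: isCont_cong)
qed

text \<open>The series alternates, so it cannot be integrated term by term in
  \<open>ennreal\<close>. Adding the series with coefficients \<open>r ^ n\<close> makes all
  coefficients nonnegative; both nonnegative series are integrated termwise and the finite added one
  is cancelled. Nonnegativity is assumed only on \<open>(0, t)\<close> because the lemma serves in
  the proof that the kernel for \<open>b = \<alpha>\<close> is nonnegative.\<close>

lemma conv_ml_kernel:
  assumes b: "0 < b" and c: "0 < c" and r: "0 \<le> r"
    and nonneg: "\<And>s. 0 < s \<Longrightarrow> s < t \<Longrightarrow> 0 \<le> ml_kernel b r s"
  shows "0 \<le> ml_kernel (b + c) r t"
    and "conv (ek c) (\<lambda>s. ennreal (ml_kernel b r s)) t = ennreal (ml_kernel (b + c) r t)"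
proof -
  define S where "S d b s = (\<Sum>n. d n * frac_kernel (\<alpha> * real n + b) s)" for d b s
  define S' where "S' d b s = (\<Sum>n. ennreal (d n) * ek (\<alpha> * real n + b) s)" for d b s
  define d2 where "d2 n = r ^ n + (- r) ^ n" for n :: nat
  have d2: "0 \<le> d2 n" for n
    using r by (cases "even n") (auto simp: d2_def uminus_power_if)
  have bc: "0 < b + c" using b c by simp
  have sum2: "summable (\<lambda>n. d2 n * frac_kernel (\<alpha> * real n + b') s)" if "0 < b'" for b' s
    unfolding d2_def distrib_right by (intro summable_add summable_frac_kernel that)
  have S': "S' d b' s = ennreal (S d b' s)" "0 \<le> S d b' s"
    if "0 < b'" "\<And>n. 0 \<le> d n" "summable (\<lambda>n. d n * frac_kernel (\<alpha> * real n + b') s)" for d b' s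
    unfolding S_def S'_def using that
    by (auto simp: ennreal_mult'[symmetric] intro!: suminf_ennreal2 suminf_nonneg)
  have S2: "S d2 b' s = S (\<lambda>n. r ^ n) b' s + ml_kernel b' r s" if "0 < b'" for b' s
    unfolding S_def d2_def distrib_right ml_kernel_eq[OF that]
    by (intro suminf_add[symmetric] summable_frac_kernel that)
  have Sr: "S' (\<lambda>n. r ^ n) b' s = ennreal (S (\<lambda>n. r ^ n) b' s)" "0 \<le> S (\<lambda>n. r ^ n) b' s"
    if "0 < b'" for b' s
    using S'[OF that _ summable_frac_kernel[OF that]] r by auto
  have Sd: "S' d2 b' s = ennreal (S d2 b' s)" "0 \<le> S d2 b' s" if "0 < b'" for b' s
    by (rule S'[OF that d2 sum2[OF that]])+
  have meas [measurable]: "S' d b' \<in> borel_measurable borel" for d b'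
    unfolding S'_def by measurable
  have conv_S': "conv (ek c) (S' d b) t = S' d (b + c) t" for d
  proof -
    have "conv (ek c) (S' d b) t =
        (\<Sum>n. conv (ek c) (\<lambda>s. ennreal (d n) * ek (\<alpha> * real n + b) s) t)"
      unfolding S'_def by (rule conv_suminf_right) auto
    also have "conv (ek c) (\<lambda>s. ennreal (d n) * ek (\<alpha> * real n + b) s) t =
        ennreal (d n) * ek (\<alpha> * real n + (b + c)) t" for n
      using conv_frac_kernel[OF c order_add_pos[OF b], of n t]
      by (subst conv_cmult_right) (auto simp: add_ac)
    then have "(\<Sum>n. conv (ek c) (\<lambda>s. ennreal (d n) * ek (\<alpha> * real n + b) s) t) =
        S' d (b + c) t"
      unfolding S'_def by simp
    finally show ?thesis .
  qed
  have "conv (ek c) (\<lambda>s. ennreal (ml_kernel b r s)) t + S' (\<lambda>n. r ^ n) (b + c) t =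
      conv (ek c) (\<lambda>s. ennreal (ml_kernel b r s) + S' (\<lambda>n. r ^ n) b s) t"
    using b by (subst conv_add_right) (auto simp: conv_S')
  also have "\<dots> = conv (ek c) (S' d2 b) t"
    unfolding conv_def
  proof (rule nn_integral_cong)
    fix s
    show "ek c (t - s) * (ennreal (ml_kernel b r s) + S' (\<lambda>n. r ^ n) b s) = ek c (t - s) * S' d2 b s"
    proof (cases "s < t")
      case True
      then have "0 \<le> ml_kernel b r s" using nonneg[of s] by (cases "0 < s") auto
      then have "ennreal (ml_kernel b r s) + S' (\<lambda>n. r ^ n) b s = S' d2 b s"
        using b by (simp add: Sr Sd S2 add.commute)
      then show ?thesis by simp
    qed auto
  qed
  also have "\<dots> = S' d2 (b + c) t" by (rule conv_S')
  finally have *: "conv (ek c) (\<lambda>s. ennreal (ml_kernel b r s)) t + ennreal (S (\<lambda>n. r ^ n) (b + c) t) =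
      ennreal (S d2 (b + c) t)"
    using bc by (simp add: Sr Sd)
  \<comment> \<open>The convolution is bounded by a finite sum, hence finite itself, and the
    subtraction can take place in the reals.\<close>
  obtain y where y: "conv (ek c) (\<lambda>s. ennreal (ml_kernel b r s)) t = ennreal y" "0 \<le> y"
    using * by (cases "conv (ek c) (\<lambda>s. ennreal (ml_kernel b r s)) t") auto
  have "ennreal (y + S (\<lambda>n. r ^ n) (b + c) t) = ennreal (S d2 (b + c) t)"
    using * y Sr(2)[OF bc] by simp
  then have "y + S (\<lambda>n. r ^ n) (b + c) t = S d2 (b + c) t"
    using y Sr(2)[OF bc] Sd(2)[OF bc] by (subst (asm) ennreal_inj) auto
  then have "y = ml_kernel (b + c) r t" by (simp add: S2[OF bc])
  then show "0 \<le> ml_kernel (b + c) r t"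
    "conv (ek c) (\<lambda>s. ennreal (ml_kernel b r s)) t = ennreal (ml_kernel (b + c) r t)"
    using y by auto
qed

section \<open>Positivity of the resolvent kernel\<close>

text \<open>The power series is continuous with value \<open>1 / Gamma b\<close> at 0, so near 0 the
  kernel has the sign of its leading term.\<close>

lemma ml_kernel_pos_near_0:
  assumes b: "0 < b"
  obtains d where "0 < d" "\<And>s. 0 < s \<Longrightarrow> s < d \<Longrightarrow> 0 < ml_kernel b r s"
proof -
  define g where "g x = (\<Sum>n. 1 / Gamma (\<alpha> * real n + b) * x ^ n)" for x
  have g: "isCont g x" for x
    unfolding g_def by (rule isCont_powser_converges_everywhere) (rule summable_ml[OF b])
  have g0: "0 < g 0"
    unfolding g_def powser_zero using b by (simp add: Gamma_real_pos)
  have "((\<lambda>s. - r * s powr \<alpha>) \<longlongrightarrow> - r * 0 powr \<alpha>) (at_right 0)"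
    using order by (intro tendsto_intros tendsto_powr') (auto simp: eventually_at_right_less intro: eventually_mono[OF eventually_at_right_less])
  then have "((\<lambda>s. - r * s powr \<alpha>) \<longlongrightarrow> 0) (at_right 0)" by simp
  then have "((\<lambda>s. g (- r * s powr \<alpha>)) \<longlongrightarrow> g 0) (at_right 0)"
    by (rule isCont_tendsto_compose[OF g])
  then have "\<forall>\<^sub>F s in at_right 0. 0 < g (- r * s powr \<alpha>)"
    using g0 by (rule order_tendstoD)
  then obtain d where d: "0 < d" "\<And>s. 0 < s \<Longrightarrow> s < d \<Longrightarrow> 0 < g (- r * s powr \<alpha>)"
    unfolding eventually_at_right_field by auto
  show ?thesis
  proof (rule that[OF d(1)])
    fix s :: real assume "0 < s" "s < d"
    then show "0 < ml_kernel b r s" using d(2)[of s]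
      by (simp add: ml_kernel_def g_def)
  qed
qed

text \<open>
  At a first zero \<open>t0\<close> of the resolvent kernel \<open>\<psi>\<close>, take \<open>t < t0\<close> close to \<open>t0\<close> with
  \<open>\<psi> \<le> \<psi> t\<close> on \<open>[t, t0]\<close>. The ratio \<open>\<kappa> (t - s) / \<kappa> t\<close> decreases in \<open>t\<close> (log-convexity of the
  power kernel \<open>\<kappa>\<close>), so comparing \<open>\<psi> + r \<kappa> * \<psi> = \<kappa>\<close> at \<open>t\<close> and at \<open>t0\<close> leaves only the
  contribution of \<open>[t, t0]\<close>, which is too small.
\<close>

lemma ml_kernel_nonneg:
  assumes r: "0 \<le> r"
  shows "0 \<le> ml_kernel \<alpha> r t"
proof (rule ccontr)
  assume "\<not> 0 \<le> ml_kernel \<alpha> r t"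
  then have neg: "ml_kernel \<alpha> r t < 0" "0 < t" by (auto intro: ccontr)
  obtain d where d: "0 < d" "\<And>s. 0 < s \<Longrightarrow> s < d \<Longrightarrow> 0 < ml_kernel \<alpha> r s"
    using ml_kernel_pos_near_0[OF order(1)] by metis
  \<comment> \<open>Cutting at d, below which the kernel is positive, makes this set closed despite
    the singularity at 0 and keeps its infimum away from 0.\<close>
  define Z where "Z = {d..} \<inter> ml_kernel \<alpha> r -` {..0}"
  define t0 where "t0 = Inf Z"
  have "closed Z" unfolding Z_def using d
    by (intro continuous_closed_preimage continuous_at_imp_continuous_on ballI isCont_ml_kernel order)
      auto
  moreover have "t \<in> Z" using neg d(2)[of t] by (auto simp: Z_def intro: ccontr)
  moreover have bdd: "bdd_below Z" by (auto simp: Z_def)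
  ultimately have "t0 \<in> Z" unfolding t0_def by (intro closed_contains_Inf) auto
  then have t0: "ml_kernel \<alpha> r t0 \<le> 0" "0 < t0" using d by (auto simp: Z_def)
  have pos: "0 < ml_kernel \<alpha> r s" if "0 < s" "s < t0" for s
  proof (rule ccontr)
    assume "\<not> 0 < ml_kernel \<alpha> r s"
    then have "s \<in> Z" using that d(2)[of s] by (auto simp: Z_def intro: ccontr)
    then have "t0 \<le> s" unfolding t0_def by (intro cInf_lower bdd)
    then show False using that by simp
  qed
  \<comment> \<open>The expression is the integral of r \<kappa> over an interval of length h; on
    intervals shorter than e it stays below 1/2.\<close>
  have "((\<lambda>h. r * (h powr \<alpha> / Gamma (\<alpha> + 1))) \<longlongrightarrow> r * (0 powr \<alpha> / Gamma (\<alpha> + 1))) (at_right 0)"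
    using order
    by (intro tendsto_intros tendsto_powr') (auto simp: Gamma_eq_zero_iff intro: eventually_mono[OF eventually_at_right_less] dest: nonpos_Ints_nonpos)
  then have "\<forall>\<^sub>F h in at_right 0. r * (h powr \<alpha> / Gamma (\<alpha> + 1)) < 1 / 2"
    by (rule order_tendstoD) simp
  then obtain e where e: "0 < e" "\<And>h. 0 < h \<Longrightarrow> h < e \<Longrightarrow> r * (h powr \<alpha> / Gamma (\<alpha> + 1)) < 1 / 2"
    unfolding eventually_at_right_field by auto
  \<comment> \<open>The bound \<open>t0 / 2\<close> makes the ratio \<open>C\<close> below at least
    1/2, and \<open>t0 - e / 2\<close> makes the remaining interval short enough for the choice of
    e.\<close>
  define t1 where "t1 = max (t0 / 2) (t0 - e / 2)"
  have t1: "0 < t1" "t1 < t0" "t0 / 2 \<le> t1" "t0 - t1 < e" using t0 e by (auto simp: t1_def)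
  have "\<exists>t\<in>{t1..t0}. \<forall>s\<in>{t1..t0}. ml_kernel \<alpha> r s \<le> ml_kernel \<alpha> r t"
    using t1 order by (intro continuous_attains_sup continuous_at_imp_continuous_on ballI isCont_ml_kernel) auto
  then obtain t where t: "t1 \<le> t" "t \<le> t0"
    "\<And>s. t1 \<le> s \<Longrightarrow> s \<le> t0 \<Longrightarrow> ml_kernel \<alpha> r s \<le> ml_kernel \<alpha> r t" by auto
  have ml_t: "0 < ml_kernel \<alpha> r t" using pos[of t1] t(3)[of t1] t1 by auto
  with t0 t have "t < t0" by (cases "t = t0") auto
  have "0 < t" using t1 t by simp
  define C where "C = frac_kernel \<alpha> t0 / frac_kernel \<alpha> t"
  have kt: "0 < frac_kernel \<alpha> t" by (rule frac_kernel_pos[OF order(1) \<open>0 < t\<close>])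
  have C: "0 \<le> C" unfolding C_def using order by (intro divide_nonneg_nonneg) auto
  \<comment> \<open>Cross-multiplied, this is \<open>t0 * (t - s) \<le> (t0 - s) * t\<close>; the
    negative exponent \<open>\<alpha> - 1\<close> reverses the inequality.\<close>
  have C_le: "frac_kernel \<alpha> (t0 - s) \<le> C * frac_kernel \<alpha> (t - s)" if "0 < s" "s < t" for s
  proof -
    have "t0 * (t - s) \<le> (t0 - s) * t" using that \<open>t < t0\<close> by (simp add: algebra_simps)
    moreover have "0 < t0 * (t - s)" using that t0 by simp
    ultimately have "((t0 - s) * t) powr (\<alpha> - 1) \<le> (t0 * (t - s)) powr (\<alpha> - 1)"
      using order by (intro powr_mono2') auto
    then have "(t0 - s) powr (\<alpha> - 1) * t powr (\<alpha> - 1) \<le> t0 powr (\<alpha> - 1) * (t - s) powr (\<alpha> - 1)"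
      using that t0 \<open>t < t0\<close> by (simp add: powr_mult)
    then have "(t0 - s) powr (\<alpha> - 1) \<le> t0 powr (\<alpha> - 1) * (t - s) powr (\<alpha> - 1) / t powr (\<alpha> - 1)"
      using \<open>0 < t\<close> by (simp add: pos_le_divide_eq)
    from divide_right_mono[OF this, of "Gamma \<alpha>"]
    show ?thesis using that t0 \<open>t < t0\<close> \<open>0 < t\<close> Gamma_real_pos[OF order(1)]
      by (simp add: C_def frac_kernel_def)
  qed
  have "1 / 2 \<le> t / t0" using t t1 t0 by (simp add: field_simps)
  also have "\<dots> \<le> (t / t0) powr (1 - \<alpha>)"
    using powr_mono'[of "1 - \<alpha>" 1 "t / t0"] \<open>0 < t\<close> \<open>t < t0\<close> order t0 by simp
  also have "\<dots> = C"
  proof -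
    have "C = t0 powr (\<alpha> - 1) / t powr (\<alpha> - 1)"
      using \<open>0 < t\<close> t0 Gamma_real_pos[OF order(1)] by (simp add: C_def frac_kernel_def)
    also have "\<dots> = (t / t0) powr (1 - \<alpha>)"
      using \<open>0 < t\<close> t0 powr_minus_divide[of t "1 - \<alpha>"] powr_minus_divide[of t0 "1 - \<alpha>"]
      by (simp add: powr_divide)
    finally show ?thesis by simp
  qed
  finally have C_ge: "1 / 2 \<le> C" .
  \<comment> \<open>The integral up to t0 is split at t: before t the kernels are compared by
    \<open>C_le\<close>, after t the resolvent kernel is replaced by its maximum at t.\<close>
  have conv_le: "conv (ek \<alpha>) (\<lambda>s. ennreal (ml_kernel \<alpha> r s)) t0 \<le>
      ennreal C * conv (ek \<alpha>) (\<lambda>s. ennreal (ml_kernel \<alpha> r s)) t +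
      ennreal (ml_kernel \<alpha> r t) * ek (\<alpha> + 1) (t0 - t)"
  proof -
    have "(\<integral>\<^sup>+s. ek \<alpha> (t0 - s) * ek 1 (s - t) \<partial>lborel) = conv (ek \<alpha>) (ek 1) (t0 - t)"
      unfolding conv_def
      by (subst nn_integral_real_affine[where c=1 and t="t"]) (auto simp: algebra_simps)
    then have shift: "(\<integral>\<^sup>+s. ek \<alpha> (t0 - s) * ek 1 (s - t) \<partial>lborel) = ek (\<alpha> + 1) (t0 - t)"
      using order by (simp add: conv_frac_kernel)
    have "conv (ek \<alpha>) (\<lambda>s. ennreal (ml_kernel \<alpha> r s)) t0 \<le>
      (\<integral>\<^sup>+s. ennreal C * (ek \<alpha> (t - s) * ennreal (ml_kernel \<alpha> r s)) +
        ennreal (ml_kernel \<alpha> r t) * (ek \<alpha> (t0 - s) * ek 1 (s - t)) \<partial>lborel)"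
      unfolding conv_def
    proof (rule nn_integral_mono_AE)
      have "AE s in lborel. s \<noteq> t" by (rule AE_lborel_singleton)
      then show "AE s in lborel. ek \<alpha> (t0 - s) * ennreal (ml_kernel \<alpha> r s) \<le>
        ennreal C * (ek \<alpha> (t - s) * ennreal (ml_kernel \<alpha> r s)) +
        ennreal (ml_kernel \<alpha> r t) * (ek \<alpha> (t0 - s) * ek 1 (s - t))"
      proof (eventually_elim)
        case (elim s)
        consider "s \<le> 0" | "t0 \<le> s" | "0 < s" "s < t" | "t < s" "s < t0" using elim by linarith
        then show ?case
        proof cases
          case 3
          have "ek \<alpha> (t0 - s) \<le> ennreal C * ek \<alpha> (t - s)"
            using C_le[OF 3] C order by (simp add: ennreal_mult'[symmetric] ennreal_leI)
          then have "ek \<alpha> (t0 - s) * ennreal (ml_kernel \<alpha> r s) \<le>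
              ennreal C * ek \<alpha> (t - s) * ennreal (ml_kernel \<alpha> r s)"
            by (rule mult_right_mono) simp
          then show ?thesis using 3 by (simp add: mult.assoc)
        next
          case 4
          then have "ennreal (ml_kernel \<alpha> r s) \<le> ennreal (ml_kernel \<alpha> r t)"
            using t by (intro ennreal_leI) auto
          then have "ek \<alpha> (t0 - s) * ennreal (ml_kernel \<alpha> r s) \<le> ek \<alpha> (t0 - s) * ennreal (ml_kernel \<alpha> r t)"
            by (rule mult_left_mono) simp
          then show ?thesis using 4 by (simp add: mult.commute frac_kernel_1)
        qed simp_all
      qed
    qed
    also have "\<dots> = ennreal C * conv (ek \<alpha>) (\<lambda>s. ennreal (ml_kernel \<alpha> r s)) t +
      ennreal (ml_kernel \<alpha> r t) * ek (\<alpha> + 1) (t0 - t)"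
      unfolding conv_def using order by (simp add: nn_integral_add nn_integral_cmult shift)
    finally show ?thesis .
  qed
  have nn: "0 \<le> ml_kernel \<alpha> r s" if "0 < s" "s < t0" for s
    using pos[OF that] by simp
  note ml_t0 = conv_ml_kernel[OF order(1) order(1) r nn, of t0]
  have ml_t: "0 \<le> ml_kernel (\<alpha> + \<alpha>) r t"
    "conv (ek \<alpha>) (\<lambda>s. ennreal (ml_kernel \<alpha> r s)) t = ennreal (ml_kernel (\<alpha> + \<alpha>) r t)"
    using conv_ml_kernel[OF order(1) order(1) r nn, of t] \<open>t < t0\<close> by auto
  have "ml_kernel (\<alpha> + \<alpha>) r t0 \<le> C * ml_kernel (\<alpha> + \<alpha>) r t + ml_kernel \<alpha> r t * frac_kernel (\<alpha> + 1) (t0 - t)"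
    using conv_le ml_t0 ml_t C order less_imp_le[OF \<open>0 < ml_kernel \<alpha> r t\<close>]
    by (simp add: ennreal_mult'[symmetric] ennreal_plus[symmetric] del: ennreal_plus)
  then have "r * ml_kernel (\<alpha> + \<alpha>) r t0 \<le>
      r * (C * ml_kernel (\<alpha> + \<alpha>) r t + ml_kernel \<alpha> r t * frac_kernel (\<alpha> + 1) (t0 - t))"
    by (rule mult_left_mono[OF _ r])
  also have "\<dots> = C * (r * ml_kernel (\<alpha> + \<alpha>) r t) + r * frac_kernel (\<alpha> + 1) (t0 - t) * ml_kernel \<alpha> r t"
    by (simp add: algebra_simps)
  also have "r * ml_kernel (\<alpha> + \<alpha>) r t = frac_kernel \<alpha> t - ml_kernel \<alpha> r t"
    using ml_kernel_resolvent[OF order(1), of r t] by simp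
  also have "C * (frac_kernel \<alpha> t - ml_kernel \<alpha> r t) = frac_kernel \<alpha> t0 - C * ml_kernel \<alpha> r t"
    using kt by (simp add: C_def right_diff_distrib)
  \<comment> \<open>At t0 the resolvent equation and \<open>ml_kernel \<alpha> r t0 \<le> 0\<close>
    bound the left side of the chain below by \<open>frac_kernel \<alpha> t0\<close>, which cancels.
    Dividing by the positive value at t contradicts \<open>C \<ge> 1 / 2\<close>.\<close>
  finally have "C * ml_kernel \<alpha> r t \<le> (r * frac_kernel (\<alpha> + 1) (t0 - t)) * ml_kernel \<alpha> r t"
    using ml_kernel_resolvent[OF order(1), of r t0] t0 by linarith
  then have "C \<le> r * frac_kernel (\<alpha> + 1) (t0 - t)"
    using \<open>0 < ml_kernel \<alpha> r t\<close> by simp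
  also have "\<dots> = r * ((t0 - t) powr \<alpha> / Gamma (\<alpha> + 1))"
    using \<open>t < t0\<close> by (simp add: frac_kernel_def)
  also have "\<dots> < 1 / 2" using \<open>t < t0\<close> t t1 by (intro e) auto
  finally show False using C_ge by simp
qed

section \<open>The Mittag-Leffler law: survival function, total mass and scaling\<close>

abbreviation psi :: "real \<Rightarrow> real \<Rightarrow> ennreal" where
  "psi r \<equiv> \<lambda>t. ennreal (ml_kernel \<alpha> r t)"

lemma measurable_psi [measurable]: "psi r \<in> borel_measurable borel"
  using order by measurable

lemma conv_psi:
  assumes "0 \<le> r" "0 < c"
  shows "conv (ek c) (psi r) t = ennreal (ml_kernel (\<alpha> + c) r t)" "0 \<le> ml_kernel (\<alpha> + c) r t"
  using conv_ml_kernel[OF order(1) assms(2,1)] ml_kernel_nonneg[OF assms(1)] by auto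

lemma psi_resolvent:
  assumes r: "0 \<le> r"
  shows "psi r t + ennreal r * conv (ek \<alpha>) (psi r) t = ek \<alpha> t"
proof -
  have "psi r t + ennreal r * conv (ek \<alpha>) (psi r) t =
      ennreal (ml_kernel \<alpha> r t + r * ml_kernel (\<alpha> + \<alpha>) r t)"
    using r conv_psi[OF r order(1), of t]
    by (simp add: ml_kernel_nonneg ennreal_mult ennreal_plus)
  then show ?thesis using ml_kernel_resolvent[OF order(1)] by simp
qed

lemma conv_psi_survival:
  assumes "0 \<le> r"
  shows "conv (ek (1 - \<alpha>)) (psi r) t = ennreal (ml_kernel 1 r t)" "0 \<le> ml_kernel 1 r t"
  using conv_psi[of r "1 - \<alpha>" t] assms order by auto

lemma survival_eq:
  assumes "0 < t"
  shows "ml_kernel 1 r t + r * ml_kernel (\<alpha> + 1) r t = 1"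
  using ml_kernel_resolvent[of 1 r t] assms by (simp add: frac_kernel_1 add.commute)

lemma nn_integral_psi_atMost:
  assumes "0 \<le> r"
  shows "(\<integral>\<^sup>+s. psi r s * indicator {..t} s \<partial>lborel) = ennreal (ml_kernel (\<alpha> + 1) r t)"
proof -
  have "(\<integral>\<^sup>+s. psi r s * indicator {..t} s \<partial>lborel) = conv (ek 1) (psi r) t"
    unfolding conv_def
  proof (rule nn_integral_cong_AE)
    have "AE s in lborel. s \<noteq> t" by (rule AE_lborel_singleton)
    then show "AE s in lborel. psi r s * indicator {..t} s = ek 1 (t - s) * psi r s"
      by eventually_elim (auto simp: indicator_def frac_kernel_def)
  qed
  then show ?thesis using assms by (simp add: conv_psi)
qed

lemma survival_antimono:
  assumes r: "0 \<le> r" and st: "0 < s" "s \<le> t"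
  shows "ml_kernel 1 r t \<le> ml_kernel 1 r s"
proof -
  have "ennreal (ml_kernel (\<alpha> + 1) r s) \<le> ennreal (ml_kernel (\<alpha> + 1) r t)"
    unfolding nn_integral_psi_atMost[OF r, symmetric] using st
    by (intro nn_integral_mono mult_left_mono) (auto simp: indicator_def)
  then have "r * ml_kernel (\<alpha> + 1) r s \<le> r * ml_kernel (\<alpha> + 1) r t"
    using r conv_psi(2)[OF r] by (intro mult_left_mono) auto
  then show ?thesis using survival_eq[of s r] survival_eq[of t r] st by linarith
qed

text \<open>As the survival function E decreases, \<open>E t\<close> times the integral of \<kappa>
  up to t is at most the fractional integral of E, and r times the latter is
  \<open>1 - E t \<le> 1\<close>. The resulting decay \<open>t powr - \<alpha>\<close> suffices to
  see that no mass escapes to infinity.\<close>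

lemma survival_le:
  assumes r: "0 < r" and t: "0 < t"
  shows "ml_kernel 1 r t \<le> Gamma (\<alpha> + 1) / r * t powr - \<alpha>"
proof -
  have nn: "0 \<le> r" using r by simp
  have W: "0 \<le> ml_kernel 1 r s" for s by (rule conv_psi_survival(2)[OF nn])
  have "ennreal (ml_kernel 1 r t) * ek (\<alpha> + 1) t = ennreal (ml_kernel 1 r t) * conv (ek \<alpha>) (ek 1) t"
    using order by (simp add: conv_frac_kernel)
  also have "\<dots> = conv (ek \<alpha>) (\<lambda>s. ennreal (ml_kernel 1 r t) * ek 1 s) t"
    by (subst conv_cmult_right) auto
  also have "\<dots> \<le> conv (ek \<alpha>) (\<lambda>s. ennreal (ml_kernel 1 r s)) t"
    unfolding conv_def
  proof (intro nn_integral_mono)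
    fix s
    consider "s \<le> 0" | "t \<le> s" | "0 < s" "s < t" by linarith
    then show "ek \<alpha> (t - s) * (ennreal (ml_kernel 1 r t) * ek 1 s)
        \<le> ek \<alpha> (t - s) * ennreal (ml_kernel 1 r s)"
      by cases (auto simp: frac_kernel_1 intro!: mult_left_mono ennreal_leI survival_antimono nn)
  qed
  also have "\<dots> = ennreal (ml_kernel (1 + \<alpha>) r t)"
    by (rule conv_ml_kernel) (use order nn W in auto)
  finally have "ml_kernel 1 r t * frac_kernel (\<alpha> + 1) t \<le> ml_kernel (\<alpha> + 1) r t"
    using W conv_psi(2)[OF nn] order by (simp add: ennreal_mult[symmetric] add.commute)
  from mult_left_mono[OF this nn] have "r * (ml_kernel 1 r t * frac_kernel (\<alpha> + 1) t) \<le> 1"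
    using survival_eq[OF t, of r] W[of t] by simp
  moreover have "0 < Gamma (\<alpha> + 1)" using order by (intro Gamma_real_pos) auto
  ultimately show ?thesis using r t
    by (simp add: frac_kernel_def powr_minus_divide field_simps)
qed

text \<open>Normalisation: the mass on \<open>{..n}\<close> is \<open>(1 - E n) / r\<close> with E
  the survival function, and \<open>E n\<close> tends to 0. Thus r times \<open>psi r\<close> is a
  probability density.\<close>

lemma nn_integral_psi:
  assumes r: "0 < r"
  shows "(\<integral>\<^sup>+s. psi r s \<partial>lborel) = ennreal (1 / r)"
proof -
  have nn: "0 \<le> r" using r by simp
  have "(\<lambda>n. \<integral>\<^sup>+s. psi r s * indicator {..real n} s \<partial>lborel) \<longlonglongrightarrow>
      (\<integral>\<^sup>+s. (SUP n. psi r s * indicator {..real n} s) \<partial>lborel)"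
  proof (subst nn_integral_monotone_convergence_SUP)
    show "incseq (\<lambda>n s. psi r s * indicator {..real n} s)"
      by (auto simp: incseq_def le_fun_def indicator_def)
    then show "(\<lambda>n. \<integral>\<^sup>+s. psi r s * indicator {..real n} s \<partial>lborel) \<longlonglongrightarrow>
        (SUP n. \<integral>\<^sup>+s. psi r s * indicator {..real n} s \<partial>lborel)"
      by (intro LIMSEQ_SUP) (auto simp: incseq_def le_fun_def intro!: nn_integral_mono)
  qed measurable
  moreover have "(SUP n. psi r s * indicator {..real n} s) = psi r s" for s
  proof (rule antisym)
    show "(SUP n. psi r s * indicator {..real n} s) \<le> psi r s"
      by (intro SUP_least) (auto simp: indicator_def)
    obtain n where "s \<le> real n" using real_arch_simple by auto
    then show "psi r s \<le> (SUP n. psi r s * indicator {..real n} s)"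
      by (intro SUP_upper2[of n]) auto
  qed
  ultimately have lim1: "(\<lambda>n. ennreal (ml_kernel (\<alpha> + 1) r (real n))) \<longlonglongrightarrow> (\<integral>\<^sup>+s. psi r s \<partial>lborel)"
    using nn by (simp add: nn_integral_psi_atMost)
  have "(\<lambda>n. Gamma (\<alpha> + 1) / r * real n powr - \<alpha>) \<longlonglongrightarrow> Gamma (\<alpha> + 1) / r * 0"
    using order by (intro tendsto_intros tendsto_neg_powr filterlim_real_sequentially) auto
  then have "(\<lambda>n. Gamma (\<alpha> + 1) / r * real n powr - \<alpha>) \<longlonglongrightarrow> 0" by simp
  have "(\<lambda>n. ml_kernel 1 r (real n)) \<longlonglongrightarrow> 0"
  proof (rule tendsto_sandwich)
    show "(\<lambda>n. 0 :: real) \<longlonglongrightarrow> 0" by (rule tendsto_const)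
    show "(\<lambda>n. Gamma (\<alpha> + 1) / r * real n powr - \<alpha>) \<longlonglongrightarrow> 0" by fact
    show "\<forall>\<^sub>F n in sequentially. 0 \<le> ml_kernel 1 r (real n)"
      by (intro always_eventually allI conv_psi_survival(2) nn)
    show "\<forall>\<^sub>F n in sequentially. ml_kernel 1 r (real n) \<le> Gamma (\<alpha> + 1) / r * real n powr - \<alpha>"
      using eventually_gt_at_top[of 0] by eventually_elim (rule survival_le[OF r], simp)
  qed
  then have "(\<lambda>n. (1 - ml_kernel 1 r (real n)) / r) \<longlonglongrightarrow> (1 - 0) / r"
    using r by (intro tendsto_intros) auto
  moreover have "\<forall>\<^sub>F n in sequentially. (1 - ml_kernel 1 r (real n)) / r = ml_kernel (\<alpha> + 1) r (real n)"
    using eventually_gt_at_top[of 0]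
  proof eventually_elim
    case (elim n)
    then show ?case using survival_eq[of "real n" r] r by (simp add: field_simps)
  qed
  ultimately have "(\<lambda>n. ml_kernel (\<alpha> + 1) r (real n)) \<longlonglongrightarrow> 1 / r"
    by (simp add: tendsto_cong)
  then have "(\<lambda>n. ennreal (ml_kernel (\<alpha> + 1) r (real n))) \<longlonglongrightarrow> ennreal (1 / r)"
    by (rule tendsto_ennrealI)
  with lim1 show ?thesis by (rule LIMSEQ_unique)
qed

text \<open>Self-similarity: if V has density \<open>psi 1\<close>, then
  \<open>r powr (- 1 / \<alpha>) * V\<close> has density r times \<open>psi r\<close>. One unit
  holding time can therefore be rescaled to every rate.\<close>

lemma nn_integral_psi_scale:
  assumes r: "0 < r" and [measurable]: "h \<in> borel_measurable borel"
  shows "(\<integral>\<^sup>+v. psi 1 v * h (r powr (- 1 / \<alpha>) * v) \<partial>lborel) = ennreal r * (\<integral>\<^sup>+u. psi r u * h u \<partial>lborel)"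
proof -
  define c where "c = r powr (- 1 / \<alpha>)"
  have c: "0 < c" using r by (simp add: c_def)
  have ca: "c powr \<alpha> = 1 / r"
  proof -
    have "c powr \<alpha> = r powr (- 1 / \<alpha> * \<alpha>)" by (simp only: c_def powr_powr)
    also have "- 1 / \<alpha> * \<alpha> = - 1" using order by simp
    finally show ?thesis using r by (simp add: powr_minus_divide)
  qed
  have scale: "ml_kernel \<alpha> r (c * v) * c * r = ml_kernel \<alpha> 1 v" for v
  proof (cases "0 < v")
    case True
    have "c powr (\<alpha> - 1) = (1 / r) / c" using c by (simp add: powr_diff ca)
    then have "c powr (\<alpha> - 1) * c * r = 1" using c r by simp
    moreover have "(c * v) powr (\<alpha> - 1) = c powr (\<alpha> - 1) * v powr (\<alpha> - 1)"
      using True c by (simp add: powr_mult)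
    moreover have "- r * (c * v) powr \<alpha> = - 1 * v powr \<alpha>"
      using True c r by (simp add: powr_mult ca)
    ultimately show ?thesis using True c unfolding ml_kernel_def
      by (simp only: mult_pos_pos if_True) (simp add: mult_ac)
  next
    case False
    then have "c * v \<le> 0" using c by (simp add: mult_nonneg_nonpos)
    with False show ?thesis by simp
  qed
  have "(\<integral>\<^sup>+u. psi r u * h u \<partial>lborel) = ennreal \<bar>c\<bar> * (\<integral>\<^sup>+v. psi r (0 + c * v) * h (0 + c * v) \<partial>lborel)"
    by (rule nn_integral_real_affine) (use c in auto)
  then have "ennreal r * (\<integral>\<^sup>+u. psi r u * h u \<partial>lborel) =
      (\<integral>\<^sup>+v. ennreal r * (ennreal c * (psi r (c * v) * h (c * v))) \<partial>lborel)"
    using c by (simp add: nn_integral_cmult)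
  also have "\<dots> = (\<integral>\<^sup>+v. psi 1 v * h (c * v) \<partial>lborel)"
  proof (rule nn_integral_cong)
    fix v
    have "ennreal r * (ennreal c * psi r (c * v)) = ennreal (r * (c * ml_kernel \<alpha> r (c * v)))"
      using r c by (simp only: ennreal_mult' less_imp_le)
    also have "r * (c * ml_kernel \<alpha> r (c * v)) = ml_kernel \<alpha> 1 v"
      using scale[of v] by (simp only: mult_ac)
    finally show "ennreal r * (ennreal c * (psi r (c * v) * h (c * v))) = psi 1 v * h (c * v)"
      by (simp add: mult.assoc[symmetric])
  qed
  finally show ?thesis by (simp add: c_def)
qed

section \<open>Volterra equations for the fractional kernel\<close>

lemma conv_kernels [simp]: "conv (ek (1 - \<alpha>)) (ek \<alpha>) = ek 1" "conv (ek \<alpha>) (ek (1 - \<alpha>)) = ek 1"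
  using order by (auto simp: conv_frac_kernel fun_eq_iff)

text \<open>The resolvent identity is multiplied by d, convolved with g, and the two results are
  added.\<close>

lemma resolvent_solution:
  fixes d :: ennreal
  assumes r: "0 \<le> r" and [measurable]: "g \<in> borel_measurable borel"
  defines "u \<equiv> \<lambda>t. d * psi r t + conv (psi r) g t"
  shows "u t + ennreal r * conv (ek \<alpha>) u t = d * ek \<alpha> t + conv (ek \<alpha>) g t"
proof -
  have [measurable]: "conv (psi r) g \<in> borel_measurable borel" by measurable
  have "conv (ek \<alpha>) u t = d * conv (ek \<alpha>) (psi r) t + conv (ek \<alpha>) (conv (psi r) g) t"
    unfolding u_def by (subst conv_add_right) (auto simp: conv_cmult_right)
  also have "conv (ek \<alpha>) (conv (psi r) g) = conv (conv (ek \<alpha>) (psi r)) g"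
    by (rule conv_assoc[symmetric]) auto
  finally have "u t + ennreal r * conv (ek \<alpha>) u t =
      d * (psi r t + ennreal r * conv (ek \<alpha>) (psi r) t) +
      (conv (psi r) g t + ennreal r * conv (conv (ek \<alpha>) (psi r)) g t)"
    by (simp add: u_def algebra_simps)
  also have "conv (psi r) g t + ennreal r * conv (conv (ek \<alpha>) (psi r)) g t =
      conv (\<lambda>s. psi r s + ennreal r * conv (ek \<alpha>) (psi r) s) g t"
    by (simp add: conv_add_left conv_cmult_left)
  finally show ?thesis by (simp only: psi_resolvent[OF r])
qed

text \<open>The converse direction, for the source d arising from an initial value instead of
  \<open>d * ek \<alpha>\<close>. The first summand of the result is d times the survival function.
  Finiteness is what permits cancellation in \<open>ennreal\<close>.\<close>

lemma resolvent_inversion: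
  fixes d :: ennreal
  assumes r: "0 \<le> r" and [measurable]: "g \<in> borel_measurable borel" "u \<in> borel_measurable borel"
    and eq: "\<And>t. u t + ennreal r * conv (ek \<alpha>) u t = d * ek 1 t + conv (ek \<alpha>) g t"
    and fin: "u t < \<infinity>" "conv (ek \<alpha>) u t < \<infinity>"
  shows "u t = d * conv (ek (1 - \<alpha>)) (psi r) t + conv (psi r) g t"
proof -
  define h where "h t = d * ek 1 t + conv (ek \<alpha>) g t" for t
  have h_meas [measurable]: "h \<in> borel_measurable borel" unfolding h_def by measurable
  have h: "h = (\<lambda>t. u t + ennreal r * conv (ek \<alpha>) u t)" using eq by (simp add: h_def fun_eq_iff)
  \<comment> \<open>Convolving the equation with \<open>psi r\<close> reassembles the resolvent
    identity in front of u, so \<open>psi r\<close> acts on h as \<kappa> acts on u.\<close>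
  have ku: "conv (psi r) h s = conv (ek \<alpha>) u s" for s
  proof -
    have "conv (psi r) h s = conv (psi r) u s + ennreal r * conv (psi r) (conv (ek \<alpha>) u) s"
      unfolding h by (simp add: conv_add_right conv_cmult_right)
    also have "conv (psi r) (conv (ek \<alpha>) u) = conv (conv (ek \<alpha>) (psi r)) u"
      by (subst conv_assoc[symmetric]) (auto simp: conv_commute[of "psi r" "ek \<alpha>"])
    also have "conv (psi r) u s + ennreal r * conv (conv (ek \<alpha>) (psi r)) u s =
        conv (\<lambda>t. psi r t + ennreal r * conv (ek \<alpha>) (psi r) t) u s"
      by (simp add: conv_add_left conv_cmult_left)
    finally show ?thesis by (simp only: psi_resolvent[OF r])
  qed
  have conv_psi_h: "conv (psi r) h t = d * conv (psi r) (ek 1) t + conv (psi r) (conv (ek \<alpha>) g) t"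
    unfolding h_def by (simp add: conv_add_right conv_cmult_right)
  have one: "ek 1 s = conv (ek (1 - \<alpha>)) (psi r) s + ennreal r * conv (psi r) (ek 1) s" for s
  proof -
    have "ek 1 s = conv (ek (1 - \<alpha>)) (ek \<alpha>) s" by simp
    also have "ek \<alpha> = (\<lambda>t. psi r t + ennreal r * conv (ek \<alpha>) (psi r) t)"
      by (simp only: psi_resolvent[OF r])
    also have "conv (ek (1 - \<alpha>)) \<dots> s = conv (ek (1 - \<alpha>)) (psi r) s +
        ennreal r * conv (ek (1 - \<alpha>)) (conv (ek \<alpha>) (psi r)) s"
      by (simp add: conv_add_right conv_cmult_right)
    also have "conv (ek (1 - \<alpha>)) (conv (ek \<alpha>) (psi r)) = conv (ek 1) (psi r)"
      by (subst conv_assoc[symmetric]) auto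
    finally show ?thesis by (simp add: conv_commute[of "psi r" "ek 1"])
  qed
  have kg: "conv (ek \<alpha>) g t = conv (psi r) g t + ennreal r * conv (psi r) (conv (ek \<alpha>) g) t"
  proof -
    have "conv (ek \<alpha>) g t = conv (\<lambda>t. psi r t + ennreal r * conv (psi r) (ek \<alpha>) t) g t"
      by (subst conv_commute[of "psi r"]) (auto simp: psi_resolvent[OF r])
    then show ?thesis
      by (simp add: conv_add_left conv_cmult_left conv_assoc)
  qed
  \<comment> \<open>By \<open>one\<close> and \<open>kg\<close>, h is the claimed value plus r times
    \<open>conv (psi r) h\<close>; by \<open>ku\<close> this last term also stands on the left and
    cancels.\<close>
  have "u t + ennreal r * conv (ek \<alpha>) u t =
      (d * conv (ek (1 - \<alpha>)) (psi r) t + conv (psi r) g t) + ennreal r * conv (psi r) h t"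
    unfolding eq conv_psi_h by (subst one[of t], subst kg) (simp add: algebra_simps)
  then have "ennreal r * conv (ek \<alpha>) u t + u t = ennreal r * conv (ek \<alpha>) u t +
      (d * conv (ek (1 - \<alpha>)) (psi r) t + conv (psi r) g t)"
    by (simp add: ku add.commute)
  moreover have "ennreal r * conv (ek \<alpha>) u t < \<infinity>"
    using fin by (simp add: ennreal_mult_less_top)
  ultimately show ?thesis by (auto simp: ennreal_add_left_cancel)
qed

section \<open>Continuity of fractional integrals\<close>

lemma isCont_frac_kernel:
  assumes "t \<noteq> 0"
  shows "isCont (frac_kernel a) t"
proof (cases "0 < t")
  case True
  have "isCont (\<lambda>s. s powr (a - 1) * (1 / Gamma a)) t"
    using True by (intro continuous_intros) auto
  moreover have "\<forall>\<^sub>F s in nhds t. s powr (a - 1) * (1 / Gamma a) = frac_kernel a s"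
    using eventually_nhds_in_open[of "{0<..}" t] True
    by (auto simp: frac_kernel_def elim!: eventually_mono)
  ultimately show ?thesis by (simp add: isCont_cong)
next
  case False
  have "\<forall>\<^sub>F s in nhds t. 0 = frac_kernel a s"
    using eventually_nhds_in_open[of "{..<0}" t] False assms
    by (auto elim!: eventually_mono)
  from isCont_cong[OF this] show ?thesis by simp
qed

text \<open>Fatou's lemma along the sequence. The integrands converge except at the single point
  \<open>s = t\<close>, where the kernel may jump or blow up. Finiteness of g is needed because
  multiplication by \<infinity> is not continuous at 0.\<close>

lemma conv_kernel_lsc:
  assumes [measurable]: "g \<in> borel_measurable borel" and fin: "\<And>s. g s < top"
    and X: "X \<longlonglongrightarrow> t"
  shows "conv (ek a) g t \<le> liminf (\<lambda>n. conv (ek a) g (X n))"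
proof -
  have "conv (ek a) g t \<le> (\<integral>\<^sup>+s. liminf (\<lambda>n. ek a (X n - s) * g s) \<partial>lborel)"
    unfolding conv_def
  proof (rule nn_integral_mono_AE)
    have "AE s in lborel. s \<noteq> t" by (rule AE_lborel_singleton)
    then show "AE s in lborel. ek a (t - s) * g s \<le> liminf (\<lambda>n. ek a (X n - s) * g s)"
    proof eventually_elim
      case (elim s)
      have "(\<lambda>n. X n - s) \<longlonglongrightarrow> t - s" by (intro tendsto_intros X)
      then have "(\<lambda>n. frac_kernel a (X n - s)) \<longlonglongrightarrow> frac_kernel a (t - s)"
        using elim by (intro isCont_tendsto_compose[OF isCont_frac_kernel]) auto
      then have "(\<lambda>n. g s * ek a (X n - s)) \<longlonglongrightarrow> g s * ek a (t - s)"
        by (intro ennreal_tendsto_cmult fin tendsto_ennrealI)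
      then have "liminf (\<lambda>n. g s * ek a (X n - s)) = g s * ek a (t - s)"
        by (intro lim_imp_Liminf) auto
      then show ?case by (simp add: mult.commute)
    qed
  qed
  also have "\<dots> \<le> liminf (\<lambda>n. conv (ek a) g (X n))"
    unfolding conv_def by (rule nn_integral_liminf) measurable
  finally show ?thesis .
qed

lemma conv_kernel_dominated:
  assumes "\<And>s. g s \<le> ennreal C * ek \<alpha> s" "0 \<le> C"
  shows "conv (ek \<alpha>) g t \<le> ennreal (C * frac_kernel (\<alpha> + \<alpha>) t)"
proof -
  have "conv (ek \<alpha>) g t \<le> conv (ek \<alpha>) (\<lambda>s. ennreal C * ek \<alpha> s) t"
    by (intro conv_mono assms) auto
  also have "\<dots> = ennreal (C * frac_kernel (\<alpha> + \<alpha>) t)"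
    using order conv_frac_kernel[OF order(1) order(1), of t] assms(2)
    by (simp only: conv_cmult_right measurable_frac_kernel measurable_compose[OF _ measurable_ennreal] ennreal_mult')
  finally show ?thesis .
qed

text \<open>
  Fatou's lemma gives lower semicontinuity of \<open>\<kappa> * g\<close> and of \<open>\<kappa> * (C \<kappa> - g)\<close>; the sum of the
  two is continuous.
\<close>

lemma isCont_conv_kernel:
  assumes [measurable]: "g \<in> borel_measurable borel"
    and g: "\<And>s. g s \<le> ennreal C * ek \<alpha> s" and C: "0 \<le> C" and t: "0 < t"
  shows "isCont (\<lambda>t. enn2real (conv (ek \<alpha>) g t)) t"
proof (rule continuous_at_sequentiallyI)
  fix X assume X: "X \<longlonglongrightarrow> t"
  define g' where "g' s = ennreal C * ek \<alpha> s - g s" for s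
  have g'_meas [measurable]: "g' \<in> borel_measurable borel" unfolding g'_def by measurable
  have Ck: "ennreal C * ek \<alpha> s < top" for s by (simp add: ennreal_mult_less_top)
  have fin: "g s < top" "g' s < top" for s
    using le_less_trans[OF g Ck, of s] le_less_trans[OF diff_le_self_ennreal Ck, of s "g s"]
    by (auto simp: g'_def)
  have sum: "g s + g' s = ennreal C * ek \<alpha> s" for s
    unfolding g'_def using g[of s] by (simp add: add_diff_inverse_ennreal)
  have g'_le: "g' s \<le> ennreal C * ek \<alpha> s" for s
    unfolding g'_def by (rule diff_le_self_ennreal)
  define f h d where "f u = enn2real (conv (ek \<alpha>) g u)" and "h u = enn2real (conv (ek \<alpha>) g' u)"
    and "d u = C * frac_kernel (\<alpha> + \<alpha>) u" for u
  have d: "0 \<le> d u" for u using C order by (simp add: d_def)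
  have f: "conv (ek \<alpha>) g u = ennreal (f u)" "0 \<le> f u" for u
    using ennreal_enn2real_of_le[OF conv_kernel_dominated[OF g C]] by (simp_all add: f_def)
  have h: "conv (ek \<alpha>) g' u = ennreal (h u)" "0 \<le> h u" for u
    using ennreal_enn2real_of_le[OF conv_kernel_dominated[OF g'_le C]] by (simp_all add: h_def)
  have fh: "f u + h u = d u" for u
  proof -
    have "ennreal (f u + h u) = conv (ek \<alpha>) (\<lambda>s. g s + g' s) u"
      using f h by (simp add: conv_add_right)
    also have "\<dots> = ennreal (d u)"
      using order conv_frac_kernel[OF order(1) order(1), of u] C
      by (simp only: sum d_def conv_cmult_right measurable_frac_kernel measurable_compose[OF _ measurable_ennreal] ennreal_mult')
    finally show ?thesis using f h d by (subst (asm) ennreal_inj) auto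
  qed
  have lsc: "\<forall>\<^sub>F n in sequentially. q t - e < q (X n)"
    if q: "\<And>u. conv (ek \<alpha>) k u = ennreal (q u)" "\<And>u. 0 \<le> q u" "\<And>s. k s < top"
      and [measurable]: "k \<in> borel_measurable borel" and e: "0 < e" for q k e
  proof (cases "q t - e < 0")
    case True
    then show ?thesis using q(2) by (intro always_eventually allI) (rule less_le_trans)
  next
    case False
    have "ennreal (q t - e) < ennreal (q t)" using False e by (intro ennreal_lessI) auto
    also have "ennreal (q t) \<le> liminf (\<lambda>n. ennreal (q (X n)))"
      unfolding q(1)[symmetric] by (rule conv_kernel_lsc[OF _ q(3) X]) measurable
    finally have "\<forall>\<^sub>F n in sequentially. ennreal (q t - e) < ennreal (q (X n))"
      by (rule less_LiminfD)
    then show ?thesis by (rule eventually_mono) (use False in \<open>auto simp: ennreal_less_iff\<close>)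
  qed
  have dX: "(\<lambda>n. d (X n)) \<longlonglongrightarrow> d t"
    unfolding d_def using t by (intro tendsto_intros isCont_tendsto_compose[OF isCont_frac_kernel] X) auto
  have "(f \<circ> X) \<longlonglongrightarrow> f t"
  proof (rule tendstoI)
    fix e :: real assume e: "0 < e"
    then have e2: "0 < e / 2" by simp
    show "\<forall>\<^sub>F n in sequentially. dist ((f \<circ> X) n) (f t) < e"
      \<comment> \<open>The lower bound for h becomes an upper bound for f, since
        \<open>f + h = d\<close> and d is continuous at t.\<close>
      using lsc[OF f fin(1) assms(1) e2] lsc[OF h fin(2) g'_meas e2] tendstoD[OF dX e2]
    proof eventually_elim
      case (elim n)
      then show ?case using fh[of t] fh[of "X n"]
        by (auto simp: dist_real_def abs_if split: if_splits)
    qed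
  qed
  then show "(\<lambda>n. enn2real (conv (ek \<alpha>) g (X n))) \<longlonglongrightarrow> enn2real (conv (ek \<alpha>) g t)"
    by (simp add: f_def o_def)
qed

end

section \<open>The minimal solution of the backward system\<close>

locale fractional_birth_death = fractional_order +
  fixes lam mu :: "nat \<Rightarrow> real"
  assumes rates_pos: "\<And>i. 1 \<le> i \<Longrightarrow> 0 < lam i" "\<And>i. 1 \<le> i \<Longrightarrow> 0 < mu i"
    and rates_0 [simp]: "lam 0 = 0" "mu 0 = 0"
begin

lemma rates_nonneg [simp]: "0 \<le> lam i" "0 \<le> mu i"
  using rates_pos[of i] by (cases i; force)+

abbreviation rate :: "nat \<Rightarrow> real" where "rate i \<equiv> lam i + mu i"

lemma rate_nonneg [simp]: "0 \<le> rate i" by simp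

lemma rate_pos: "1 \<le> i \<Longrightarrow> 0 < rate i" using rates_pos by (auto intro: add_pos_pos)

text \<open>Unfolded, this is the sum over all paths of m jumps from i to j of the product of the
  jump rates, times the convolution of the \<open>psi\<close> of the visited states. Rates instead
  of jump probabilities appear because \<open>psi r\<close> has mass \<open>1 / r\<close>. The
  truncated \<open>i - 1\<close> at \<open>i = 0\<close> is multiplied by
  \<open>mu 0 = 0\<close>.\<close>

fun jump_kernel :: "nat \<Rightarrow> nat \<Rightarrow> nat \<Rightarrow> real \<Rightarrow> ennreal" where
  "jump_kernel 0 i j = (\<lambda>t. of_bool (i = j) * psi (rate i) t)"
| "jump_kernel (Suc m) i j = conv (psi (rate i))
     (\<lambda>t. ennreal (lam i) * jump_kernel m (i + 1) j t + ennreal (mu i) * jump_kernel m (i - 1) j t)"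

lemma measurable_jump_kernel [measurable]: "jump_kernel m i j \<in> borel_measurable borel"
  by (induction m arbitrary: i) auto

text \<open>The same sum over paths, decomposed at the last jump instead of the first. This is the
  form that a process constructed step by step satisfies.\<close>

lemma jump_kernel_forward:
  "jump_kernel (Suc m) i j = conv (\<lambda>t. ennreal (lam (j - 1)) * jump_kernel m i (j - 1) t +
     ennreal (mu (j + 1)) * jump_kernel m i (j + 1) t) (psi (rate j))"
proof (induction m arbitrary: i)
  case 0
  have "conv (psi (rate i)) (\<lambda>t. ennreal (lam i) * (of_bool (i + 1 = j) * psi (rate (i + 1)) t) +
      ennreal (mu i) * (of_bool (i - 1 = j) * psi (rate (i - 1)) t)) t =
    conv (\<lambda>t. ennreal (lam (j - 1)) * (of_bool (i = j - 1) * psi (rate i) t) +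
      ennreal (mu (j + 1)) * (of_bool (i = j + 1) * psi (rate i) t)) (psi (rate j)) t" for t
  proof -
    have "ennreal (lam i) * (of_bool (i + 1 = j) * psi (rate (i + 1)) s) +
      ennreal (mu i) * (of_bool (i - 1 = j) * psi (rate (i - 1)) s) =
      (ennreal (lam i) * of_bool (i + 1 = j) + ennreal (mu i) * of_bool (i - 1 = j)) * psi (rate j) s" for s
      by (auto simp: algebra_simps)
    \<comment> \<open>Truncated subtraction at \<open>j = 0\<close> or \<open>i = 0\<close> produces
      spurious matches of indices only with the factor \<open>lam 0\<close> or \<open>mu 0\<close>,
      which is 0.\<close>
    moreover have "ennreal (lam (j - 1)) * (of_bool (i = j - 1) * psi (rate i) s) +
      ennreal (mu (j + 1)) * (of_bool (i = j + 1) * psi (rate i) s) =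
      (ennreal (lam i) * of_bool (i + 1 = j) + ennreal (mu i) * of_bool (i - 1 = j)) * psi (rate i) s" for s
      by (cases j; cases i) (auto simp: algebra_simps intro!: gr0I)
    ultimately show ?thesis
      by (simp only: conv_cmult_left conv_cmult_right measurable_psi)
  qed
  then show ?case by auto
next
  case (Suc m)
  have "conv (psi (rate i)) (\<lambda>t. ennreal (lam i) * jump_kernel (Suc m) (i + 1) j t +
      ennreal (mu i) * jump_kernel (Suc m) (i - 1) j t) =
    conv (psi (rate i)) (conv (\<lambda>t.
      ennreal (lam (j - 1)) * (ennreal (lam i) * jump_kernel m (i + 1) (j - 1) t + ennreal (mu i) * jump_kernel m (i - 1) (j - 1) t) +
      ennreal (mu (j + 1)) * (ennreal (lam i) * jump_kernel m (i + 1) (j + 1) t + ennreal (mu i) * jump_kernel m (i - 1) (j + 1) t))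
      (psi (rate j)))"
    unfolding Suc by (intro arg_cong[where f = "conv _"] ext)
      (simp add: conv_add_left conv_cmult_left algebra_simps)
  also have "\<dots> = conv (conv (psi (rate i)) (\<lambda>t.
      ennreal (lam (j - 1)) * (ennreal (lam i) * jump_kernel m (i + 1) (j - 1) t + ennreal (mu i) * jump_kernel m (i - 1) (j - 1) t) +
      ennreal (mu (j + 1)) * (ennreal (lam i) * jump_kernel m (i + 1) (j + 1) t + ennreal (mu i) * jump_kernel m (i - 1) (j + 1) t)))
      (psi (rate j))"
    by (rule conv_assoc[symmetric]) auto
  also have "conv (psi (rate i)) (\<lambda>t.
      ennreal (lam (j - 1)) * (ennreal (lam i) * jump_kernel m (i + 1) (j - 1) t + ennreal (mu i) * jump_kernel m (i - 1) (j - 1) t) +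
      ennreal (mu (j + 1)) * (ennreal (lam i) * jump_kernel m (i + 1) (j + 1) t + ennreal (mu i) * jump_kernel m (i - 1) (j + 1) t)) =
    (\<lambda>t. ennreal (lam (j - 1)) * jump_kernel (Suc m) i (j - 1) t +
      ennreal (mu (j + 1)) * jump_kernel (Suc m) i (j + 1) t)"
    unfolding jump_kernel.simps(2) by (intro ext) (subst conv_add_right, auto simp: conv_cmult_right)
  finally show ?case by (subst jump_kernel.simps(2))
qed

definition partial_kernel :: "nat \<Rightarrow> nat \<Rightarrow> nat \<Rightarrow> real \<Rightarrow> ennreal" where
  "partial_kernel n i j t = (\<Sum>m<n. jump_kernel m i j t)"

definition bd_kernel :: "nat \<Rightarrow> nat \<Rightarrow> real \<Rightarrow> ennreal" where
  "bd_kernel i j t = (\<Sum>m. jump_kernel m i j t)"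

lemma measurable_partial_kernel [measurable]: "partial_kernel n i j \<in> borel_measurable borel"
  unfolding partial_kernel_def by measurable

lemma measurable_bd_kernel [measurable]: "bd_kernel i j \<in> borel_measurable borel"
  unfolding bd_kernel_def by measurable

lemma partial_kernel_Suc:
  "partial_kernel (Suc n) i j t = of_bool (i = j) * psi (rate i) t +
     conv (psi (rate i)) (\<lambda>s. ennreal (lam i) * partial_kernel n (i + 1) j s +
       ennreal (mu i) * partial_kernel n (i - 1) j s) t"
proof (induction n)
  case 0
  then show ?case by (simp add: partial_kernel_def)
next
  case (Suc n)
  have "partial_kernel (Suc (Suc n)) i j t = partial_kernel (Suc n) i j t + jump_kernel (Suc n) i j t"
    by (simp add: partial_kernel_def)
  also have "\<dots> = of_bool (i = j) * psi (rate i) t +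
     conv (psi (rate i)) (\<lambda>s. (ennreal (lam i) * partial_kernel n (i + 1) j s +
       ennreal (mu i) * partial_kernel n (i - 1) j s) +
       (ennreal (lam i) * jump_kernel n (i + 1) j s + ennreal (mu i) * jump_kernel n (i - 1) j s)) t"
    unfolding Suc by (subst conv_add_right) (auto simp: add.assoc)
  also have "(\<lambda>s. (ennreal (lam i) * partial_kernel n (i + 1) j s +
       ennreal (mu i) * partial_kernel n (i - 1) j s) +
       (ennreal (lam i) * jump_kernel n (i + 1) j s + ennreal (mu i) * jump_kernel n (i - 1) j s)) =
     (\<lambda>s. ennreal (lam i) * partial_kernel (Suc n) (i + 1) j s +
       ennreal (mu i) * partial_kernel (Suc n) (i - 1) j s)"
    by (simp add: partial_kernel_def algebra_simps)
  finally show ?case .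
qed

text \<open>With \<kappa> in place of the iterates the right-hand side is \<kappa> again, by the
  resolvent identity, once the source \<open>of_bool (i = j)\<close> is enlarged to 1. The bound is
  uniform in n, i and the rates, which is why explosion does no harm.\<close>

lemma partial_kernel_le: "partial_kernel n i j t \<le> ek \<alpha> t"
proof (induction n arbitrary: i t)
  case 0
  then show ?case by (simp add: partial_kernel_def)
next
  case (Suc n)
  have "partial_kernel (Suc n) i j t \<le> 1 * psi (rate i) t +
      conv (psi (rate i)) (\<lambda>s. ennreal (lam i) * ek \<alpha> s + ennreal (mu i) * ek \<alpha> s) t"
    unfolding partial_kernel_Suc
    by (intro add_mono mult_mono conv_mono Suc) auto
  also have "(\<lambda>s. ennreal (lam i) * ek \<alpha> s + ennreal (mu i) * ek \<alpha> s) =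
      (\<lambda>s. ennreal (rate i) * ek \<alpha> s)"
    by (simp add: distrib_right)
  also have "conv (psi (rate i)) \<dots> t = ennreal (rate i) * conv (psi (rate i)) (ek \<alpha>) t"
    by (rule conv_cmult_right) auto
  also have "conv (psi (rate i)) (ek \<alpha>) = conv (ek \<alpha>) (psi (rate i))"
    by (rule conv_commute) auto
  also have "1 * psi (rate i) t + ennreal (rate i) * conv (ek \<alpha>) (psi (rate i)) t = ek \<alpha> t"
    using psi_resolvent[of "rate i" t] by simp
  finally show ?case .
qed

lemma bd_kernel_SUP: "bd_kernel i j t = (SUP n. partial_kernel n i j t)"
  unfolding bd_kernel_def partial_kernel_def by (rule suminf_eq_SUP)

lemma bd_kernel_le: "bd_kernel i j t \<le> ek \<alpha> t"
  unfolding bd_kernel_SUP by (intro SUP_least partial_kernel_le)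

lemma bd_kernel_eq:
  "bd_kernel i j t = of_bool (i = j) * psi (rate i) t +
     conv (psi (rate i)) (\<lambda>s. ennreal (lam i) * bd_kernel (i + 1) j s +
       ennreal (mu i) * bd_kernel (i - 1) j s) t"
proof -
  have "bd_kernel i j t = jump_kernel 0 i j t + (\<Sum>m. jump_kernel (Suc m) i j t)"
    unfolding bd_kernel_def using suminf_offset[OF summableI, of "\<lambda>m. jump_kernel m i j t" 1]
    by simp
  also have "(\<Sum>m. jump_kernel (Suc m) i j t) = conv (psi (rate i)) (\<lambda>s. \<Sum>m.
      ennreal (lam i) * jump_kernel m (i + 1) j s + ennreal (mu i) * jump_kernel m (i - 1) j s) t"
    by (simp add: conv_suminf_right)
  also have "(\<lambda>s. \<Sum>m. ennreal (lam i) * jump_kernel m (i + 1) j s +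
      ennreal (mu i) * jump_kernel m (i - 1) j s) =
    (\<lambda>s. ennreal (lam i) * bd_kernel (i + 1) j s + ennreal (mu i) * bd_kernel (i - 1) j s)"
    by (simp add: suminf_add[symmetric] summableI ennreal_suminf_cmult bd_kernel_def)
  finally show ?thesis by simp
qed

lemma bd_kernel_resolvent:
  "bd_kernel i j t + ennreal (rate i) * conv (ek \<alpha>) (bd_kernel i j) t =
    of_bool (i = j) * ek \<alpha> t + conv (ek \<alpha>) (\<lambda>s. ennreal (lam i) * bd_kernel (i + 1) j s +
       ennreal (mu i) * bd_kernel (i - 1) j s) t"
proof -
  have [measurable]: "(\<lambda>s. ennreal (lam i) * bd_kernel (i + 1) j s +
       ennreal (mu i) * bd_kernel (i - 1) j s) \<in> borel_measurable borel"
    by measurable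
  show ?thesis
    using resolvent_solution[of "rate i" "\<lambda>s. ennreal (lam i) * bd_kernel (i + 1) j s +
       ennreal (mu i) * bd_kernel (i - 1) j s" "of_bool (i = j)" t]
    by (simp only: bd_kernel_eq[symmetric] rate_nonneg) measurable
qed

section \<open>State probabilities and their Caputo derivatives\<close>

definition bd_mass :: "nat \<Rightarrow> nat \<Rightarrow> real \<Rightarrow> ennreal" where
  "bd_mass i j = conv (ek (1 - \<alpha>)) (bd_kernel i j)"

lemma measurable_bd_mass [measurable]: "bd_mass i j \<in> borel_measurable borel"
  unfolding bd_mass_def by measurable

lemma bd_mass_le: "bd_mass i j t \<le> ek 1 t"
  using conv_mono[of "ek (1 - \<alpha>)" "ek (1 - \<alpha>)" "bd_kernel i j" "ek \<alpha>" t] bd_kernel_le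
  by (simp add: bd_mass_def)

text \<open>Convolving the resolvent equation with \<beta> turns each \<kappa> into ordinary
  integration. Thus the mass is, up to its initial value, the integral of the generator applied to
  the kernels, and the kernels provide its derivative.\<close>

lemma bd_mass_eq:
  "bd_mass i j t + ennreal (rate i) * conv (ek 1) (bd_kernel i j) t =
    of_bool (i = j) * ek 1 t + conv (ek 1) (\<lambda>s. ennreal (lam i) * bd_kernel (i + 1) j s +
       ennreal (mu i) * bd_kernel (i - 1) j s) t"
proof -
  define G where "G = (\<lambda>s. ennreal (lam i) * bd_kernel (i + 1) j s + ennreal (mu i) * bd_kernel (i - 1) j s)"
  have [measurable]: "G \<in> borel_measurable borel" unfolding G_def by measurable
  have "bd_mass i j t + ennreal (rate i) * conv (ek (1 - \<alpha>)) (conv (ek \<alpha>) (bd_kernel i j)) t =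
    conv (ek (1 - \<alpha>)) (\<lambda>t. bd_kernel i j t + ennreal (rate i) * conv (ek \<alpha>) (bd_kernel i j) t) t"
    unfolding bd_mass_def by (subst conv_add_right) (auto simp: conv_cmult_right)
  also have "\<dots> = conv (ek (1 - \<alpha>)) (\<lambda>t. of_bool (i = j) * ek \<alpha> t + conv (ek \<alpha>) G t) t"
    by (simp only: bd_kernel_resolvent G_def)
  also have "\<dots> = of_bool (i = j) * conv (ek (1 - \<alpha>)) (ek \<alpha>) t + conv (ek (1 - \<alpha>)) (conv (ek \<alpha>) G) t"
    by (subst conv_add_right) (auto simp: conv_cmult_right)
  finally show ?thesis
    unfolding G_def[symmetric] by (simp add: conv_assoc[symmetric])
qed

lemma bd_kernel_0: "1 \<le> j \<Longrightarrow> bd_kernel 0 j t = 0"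
  by (subst bd_kernel_eq) simp

lemma bd_mass_0: "1 \<le> j \<Longrightarrow> bd_mass 0 j t = 0"
  by (simp add: bd_mass_def conv_def bd_kernel_0)

definition kernel_real :: "nat \<Rightarrow> nat \<Rightarrow> real \<Rightarrow> real" where
  "kernel_real i j s = enn2real (bd_kernel i j s)"

definition bd_prob_deriv :: "nat \<Rightarrow> nat \<Rightarrow> real \<Rightarrow> real" where
  "bd_prob_deriv i j s = lam i * kernel_real (i + 1) j s + mu i * kernel_real (i - 1) j s -
     rate i * kernel_real i j s"

text \<open>All kernels vanish on \<open>t \<le> 0\<close>, so \<open>bd_mass\<close> is 0 at 0 and
  the initial value has to be prescribed separately.\<close>

definition bd_prob :: "nat \<Rightarrow> nat \<Rightarrow> real \<Rightarrow> real" where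
  "bd_prob i j t = (if t = 0 then of_bool (i = j) else enn2real (bd_mass i j t))"

lemma bd_kernel_real: "bd_kernel i j s = ennreal (kernel_real i j s)"
  unfolding kernel_real_def by (rule ennreal_enn2real_of_le) (rule bd_kernel_le)

lemma kernel_real_nonneg [simp]: "0 \<le> kernel_real i j s"
  by (simp add: kernel_real_def)

lemma measurable_kernel_real [measurable]: "kernel_real i j \<in> borel_measurable borel"
  unfolding kernel_real_def by measurable

lemma kernel_real_nonpos [simp]: "s \<le> 0 \<Longrightarrow> kernel_real i j s = 0"
  using bd_kernel_le[of i j s] by (simp add: kernel_real_def)

lemma bd_mass_real: "t \<noteq> 0 \<Longrightarrow> bd_mass i j t = ennreal (bd_prob i j t)"
  using ennreal_enn2real_of_le[OF bd_mass_le] by (simp add: bd_prob_def)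

lemma bd_prob_nonneg [simp]: "0 \<le> bd_prob i j t"
  by (simp add: bd_prob_def)

lemma inflow_real: "ennreal (lam i) * bd_kernel (i + 1) j s + ennreal (mu i) * bd_kernel (i - 1) j s =
    ennreal (lam i * kernel_real (i + 1) j s + mu i * kernel_real (i - 1) j s)"
  by (simp add: bd_kernel_real ennreal_mult)

lemma inflow_le: "ennreal (lam i) * bd_kernel (i + 1) j s + ennreal (mu i) * bd_kernel (i - 1) j s
    \<le> ennreal (rate i) * ek \<alpha> s"
proof -
  have "ennreal (lam i) * bd_kernel (i + 1) j s + ennreal (mu i) * bd_kernel (i - 1) j s
    \<le> ennreal (lam i) * ek \<alpha> s + ennreal (mu i) * ek \<alpha> s"
    by (intro add_mono mult_left_mono bd_kernel_le) auto
  then show ?thesis by (simp add: distrib_right)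
qed

text \<open>The resolvent equation writes the kernel as a multiple of \<kappa> plus a difference of
  fractional integrals of functions dominated by multiples of \<kappa>, and all of these are
  continuous on \<open>t > 0\<close>.\<close>

lemma isCont_kernel_real:
  assumes t: "0 < t"
  shows "isCont (kernel_real i j) t"
proof -
  define G where "G = (\<lambda>s. ennreal (lam i) * bd_kernel (i + 1) j s + ennreal (mu i) * bd_kernel (i - 1) j s)"
  have [measurable]: "G \<in> borel_measurable borel" unfolding G_def by measurable
  have G: "G s \<le> ennreal (rate i) * ek \<alpha> s" for s
    unfolding G_def by (rule inflow_le)
  have K: "bd_kernel i j s \<le> ennreal 1 * ek \<alpha> s" for s
    using bd_kernel_le by simp
  have eq: "kernel_real i j s = of_bool (i = j) * frac_kernel \<alpha> s +
      enn2real (conv (ek \<alpha>) G s) - rate i * enn2real (conv (ek \<alpha>) (bd_kernel i j) s)" for s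
  proof -
    obtain x where x: "conv (ek \<alpha>) G s = ennreal x" "0 \<le> x"
      using conv_kernel_dominated[OF G, of s] by (cases "conv (ek \<alpha>) G s") (auto simp: top_unique)
    obtain y where y: "conv (ek \<alpha>) (bd_kernel i j) s = ennreal y" "0 \<le> y"
      using conv_kernel_dominated[OF K, of s] by (cases "conv (ek \<alpha>) (bd_kernel i j) s") (auto simp: top_unique)
    have "ennreal (kernel_real i j s + rate i * y) = ennreal (of_bool (i = j) * frac_kernel \<alpha> s + x)"
      using bd_kernel_resolvent[of i j s, folded G_def] x y order
      by (simp add: bd_kernel_real ennreal_mult algebra_simps)
    then show ?thesis using x y order by (subst (asm) ennreal_inj) auto
  qed
  have "isCont (\<lambda>s. of_bool (i = j) * frac_kernel \<alpha> s +
      enn2real (conv (ek \<alpha>) G s) - rate i * enn2real (conv (ek \<alpha>) (bd_kernel i j) s)) t"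
    using t by (intro continuous_intros isCont_frac_kernel isCont_conv_kernel[OF _ G] isCont_conv_kernel[OF _ K]) auto
  then show ?thesis by (simp add: eq[abs_def])
qed

lemma isCont_bd_prob_deriv: "0 < t \<Longrightarrow> isCont (bd_prob_deriv i j) t"
  unfolding bd_prob_deriv_def by (intro continuous_intros isCont_kernel_real)

lemma has_integral_kernel_real:
  assumes f [measurable]: "f \<in> borel_measurable borel" and nn: "\<And>s. 0 \<le> f s" and z: "\<And>s. s \<le> 0 \<Longrightarrow> f s = 0"
    and fin: "conv (ek 1) (\<lambda>s. ennreal (f s)) t = ennreal x" "0 \<le> x"
  shows "(f has_integral x) {0..t}"
proof -
  have "(\<integral>\<^sup>+s. ennreal (if s \<in> {0..t} then f s else 0) \<partial>lborel) = conv (ek 1) (\<lambda>s. ennreal (f s)) t"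
    unfolding conv_def
  proof (rule nn_integral_cong_AE)
    have "AE s in lborel. s \<noteq> t" by (rule AE_lborel_singleton)
    then show "AE s in lborel. ennreal (if s \<in> {0..t} then f s else 0) = ek 1 (t - s) * ennreal (f s)"
      by eventually_elim (use z in \<open>auto simp: frac_kernel_def\<close>)
  qed
  then have "((\<lambda>s. if s \<in> {0..t} then f s else 0) has_integral x) UNIV"
    using fin nn by (intro nn_integral_has_integral) auto
  then show ?thesis by (simp only: has_integral_restrict_UNIV)
qed

lemma bd_prob_deriv_has_integral:
  assumes t: "0 \<le> t"
  shows "(bd_prob_deriv i j has_integral bd_prob i j t - of_bool (i = j)) {0..t}"
proof (cases "t = 0")
  case True
  then show ?thesis by (simp add: bd_prob_def has_integral_refl)
next
  case False
  define G where "G = (\<lambda>s. lam i * kernel_real (i + 1) j s + mu i * kernel_real (i - 1) j s)"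
  have [measurable]: "G \<in> borel_measurable borel" unfolding G_def by measurable
  have eq: "bd_mass i j t + ennreal (rate i) * conv (ek 1) (\<lambda>s. ennreal (kernel_real i j s)) t =
    of_bool (i = j) * ek 1 t + conv (ek 1) (\<lambda>s. ennreal (G s)) t"
    using bd_mass_eq[of i j t] unfolding inflow_real unfolding G_def bd_kernel_real[abs_def] .
  have G_le: "ennreal (G s) \<le> ennreal (rate i) * ek \<alpha> s" for s
    using inflow_le[of i j s] unfolding inflow_real G_def .
  have "conv (ek 1) (\<lambda>s. ennreal (G s)) t \<le> conv (ek 1) (\<lambda>s. ennreal (rate i) * ek \<alpha> s) t"
    by (intro conv_mono G_le) auto
  also have "\<dots> = ennreal (rate i) * ek (1 + \<alpha>) t"
    using order by (simp add: conv_cmult_right conv_frac_kernel)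
  finally obtain x where x: "conv (ek 1) (\<lambda>s. ennreal (G s)) t = ennreal x" "0 \<le> x"
    by (cases "conv (ek 1) (\<lambda>s. ennreal (G s)) t") (auto simp: top_unique ennreal_mult_eq_top_iff)
  have "conv (ek 1) (\<lambda>s. ennreal (kernel_real i j s)) t \<le> conv (ek 1) (ek \<alpha>) t"
    using bd_kernel_le[of i j] by (intro conv_mono) (auto simp: bd_kernel_real)
  also have "\<dots> = ek (1 + \<alpha>) t" using order by (simp add: conv_frac_kernel)
  finally obtain y where y: "conv (ek 1) (\<lambda>s. ennreal (kernel_real i j s)) t = ennreal y" "0 \<le> y"
    by (cases "conv (ek 1) (\<lambda>s. ennreal (kernel_real i j s)) t") (auto simp: top_unique)
  have "ennreal (bd_prob i j t + rate i * y) = ennreal (of_bool (i = j) + x)"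
    using eq x y False t by (simp add: bd_mass_real frac_kernel_1 ennreal_mult algebra_simps)
  then have "bd_prob i j t - of_bool (i = j) = x - rate i * y"
    using x y by (subst (asm) ennreal_inj) auto
  moreover have "(G has_integral x) {0..t}"
    by (rule has_integral_kernel_real) (use x in \<open>auto simp: G_def\<close>)
  moreover have "(kernel_real i j has_integral y) {0..t}"
    by (rule has_integral_kernel_real) (use y in auto)
  ultimately have "((\<lambda>s. G s - rate i * kernel_real i j s) has_integral bd_prob i j t - of_bool (i = j)) {0..t}"
    by (auto intro!: has_integral_diff has_integral_mult_right)
  then show ?thesis by (simp add: G_def bd_prob_deriv_def[abs_def])
qed

lemma bd_prob_eq_integral: "0 \<le> t \<Longrightarrow> bd_prob i j t = of_bool (i = j) + integral {0..t} (bd_prob_deriv i j)"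
  using bd_prob_deriv_has_integral[of t i j] by (simp add: integral_unique)

lemma bd_prob_has_derivative:
  assumes t: "0 < t"
  shows "(bd_prob i j has_real_derivative bd_prob_deriv i j t) (at t)"
proof -
  \<comment> \<open>The interval ends at \<open>2 * t\<close> so that t is an interior point and the
    derivative is two-sided.\<close>
  have "((\<lambda>u. integral {0..u} (bd_prob_deriv i j)) has_vector_derivative bd_prob_deriv i j t)
      (at t within ({0..2 * t} - {}))"
    using t bd_prob_deriv_has_integral[of "2 * t" i j]
    by (intro integral_has_vector_derivative_continuous_at)
      (auto intro: continuous_at_imp_continuous_at_within isCont_bd_prob_deriv)
  moreover have "at t within {0..2 * t} = at t"
    using t by (intro at_within_Icc_at) auto
  ultimately have "((\<lambda>u. of_bool (i = j) + integral {0..u} (bd_prob_deriv i j)) has_real_derivative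
      0 + bd_prob_deriv i j t) (at t)"
    by (intro DERIV_add DERIV_const) (simp add: has_real_derivative_iff_has_vector_derivative)
  then have "((\<lambda>u. of_bool (i = j) + integral {0..u} (bd_prob_deriv i j)) has_real_derivative
      bd_prob_deriv i j t) (at t)" by simp
  then show ?thesis
    by (rule has_field_derivative_transform_within_open[where S = "{0<..}"])
      (use t in \<open>auto simp: bd_prob_eq_integral\<close>)
qed

text \<open>At 0 the derivative may be unbounded, yet it is integrable there; continuity is that of
  an indefinite integral.\<close>

lemma continuous_on_bd_prob: "continuous_on {0..} (bd_prob i j)"
  unfolding continuous_on_eq_continuous_within
proof
  fix x :: real assume x: "x \<in> {0..}"
  have "continuous_on {0..x + 1} (\<lambda>u. of_bool (i = j) + integral {0..u} (bd_prob_deriv i j))"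
    using x bd_prob_deriv_has_integral[of "x + 1" i j]
    by (intro continuous_intros indefinite_integral_continuous_1) auto
  then have "continuous_on {0..x + 1} (bd_prob i j)"
    by (subst continuous_on_cong[OF refl bd_prob_eq_integral]) auto
  moreover have "at x within {0..} = at x within {0..x + 1}"
    by (rule at_within_nhd[of x "{..<x + 1}"]) auto
  ultimately show "continuous (at x within {0..}) (bd_prob i j)"
    using x by (simp add: continuous_on_eq_continuous_within)
qed

lemma has_bochner_integral_kernel_real:
  assumes t: "0 < t"
  shows "has_bochner_integral lborel (\<lambda>s. frac_kernel (1 - \<alpha>) (t - s) * kernel_real i j s) (bd_prob i j t)"
proof (rule has_bochner_integral_nn_integral)
  show "(\<integral>\<^sup>+s. ennreal (frac_kernel (1 - \<alpha>) (t - s) * kernel_real i j s) \<partial>lborel) = ennreal (bd_prob i j t)"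
    using t order bd_mass_real[of t i j] by (simp add: bd_mass_def conv_def bd_kernel_real ennreal_mult)
qed (use order in auto)

text \<open>The Caputo derivative is \<beta> convolved with the derivative. The latter is a linear
  combination of kernels, and \<beta> maps each kernel to the corresponding state
  probability.\<close>

lemma bd_prob_caputo:
  assumes t: "0 < t"
  shows "set_integrable lborel {0<..<t} (\<lambda>s. deriv (bd_prob i j) s / (t - s) powr \<alpha>)"
    and "caputo_deriv \<alpha> (bd_prob i j) t =
      mu i * bd_prob (i - 1) j t - rate i * bd_prob i j t + lam i * bd_prob (i + 1) j t"
proof -
  have eq: "indicator {0<..<t} s *\<^sub>R (deriv (bd_prob i j) s / (t - s) powr \<alpha>) =
      Gamma (1 - \<alpha>) * (lam i * (frac_kernel (1 - \<alpha>) (t - s) * kernel_real (i + 1) j s) +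
        mu i * (frac_kernel (1 - \<alpha>) (t - s) * kernel_real (i - 1) j s) -
        rate i * (frac_kernel (1 - \<alpha>) (t - s) * kernel_real i j s))" for s
  proof -
    consider "s \<le> 0" | "t \<le> s" | "0 < s" "s < t" by linarith
    then show ?thesis
    proof cases
      case 3
      have "0 < Gamma (1 - \<alpha>)" using order by (intro Gamma_real_pos) simp
      then have "Gamma (1 - \<alpha>) \<noteq> 0" by (rule less_imp_neq[THEN not_sym])
      then have "Gamma (1 - \<alpha>) * frac_kernel (1 - \<alpha>) (t - s) = 1 / (t - s) powr \<alpha>"
        using 3 by (simp add: frac_kernel_def powr_minus_divide)
      moreover have "deriv (bd_prob i j) s = bd_prob_deriv i j s"
        using 3 by (intro DERIV_imp_deriv bd_prob_has_derivative)
      ultimately have "indicator {0<..<t} s *\<^sub>R (deriv (bd_prob i j) s / (t - s) powr \<alpha>) =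
          (Gamma (1 - \<alpha>) * frac_kernel (1 - \<alpha>) (t - s)) * bd_prob_deriv i j s"
        using 3 by simp
      then show ?thesis by (simp add: bd_prob_deriv_def algebra_simps)
    qed auto
  qed
  have "has_bochner_integral lborel (\<lambda>s. indicator {0<..<t} s *\<^sub>R (deriv (bd_prob i j) s / (t - s) powr \<alpha>))
    (Gamma (1 - \<alpha>) * (lam i * bd_prob (i + 1) j t + mu i * bd_prob (i - 1) j t - rate i * bd_prob i j t))"
    unfolding eq using t
    by (intro has_bochner_integral_mult_right has_bochner_integral_diff has_bochner_integral_add
        has_bochner_integral_kernel_real)
  then show "set_integrable lborel {0<..<t} (\<lambda>s. deriv (bd_prob i j) s / (t - s) powr \<alpha>)"
    "caputo_deriv \<alpha> (bd_prob i j) t =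
      mu i * bd_prob (i - 1) j t - rate i * bd_prob i j t + lam i * bd_prob (i + 1) j t"
    using less_imp_neq[OF Gamma_real_pos[of "1 - \<alpha>"]] order
    by (auto simp: set_integrable_def caputo_deriv_def set_lebesgue_integral_def has_bochner_integral_iff)
qed

lemma bd_prob_0: "1 \<le> j \<Longrightarrow> bd_prob 0 j t = 0"
  by (simp add: bd_prob_def bd_mass_0)

lemma caputo_differentiable_bd_prob: "caputo_differentiable \<alpha> (bd_prob i j)"
proof -
  have "bd_prob i j differentiable at t" if "0 < t" for t
    unfolding real_differentiable_def by (rule exI) (rule bd_prob_has_derivative[OF that])
  then show ?thesis
    unfolding caputo_differentiable_def
    using continuous_on_bd_prob bd_prob_caputo(1) by auto
qed

section \<open>Arbitrary solutions, minimality and uniqueness\<close>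

text \<open>Fractional integration of order \<alpha> undoes the Caputo derivative, since \<kappa> *
  \<beta> = 1 on \<open>t > 0\<close>. The derivative of f has no sign, so its positive part a and
  negative part b are treated separately and subtracted only at the end.\<close>

lemma caputo_integral_equation:
  assumes f: "caputo_differentiable \<alpha> f" and f0: "0 \<le> f 0" and nn: "\<And>t. 0 \<le> t \<Longrightarrow> 0 \<le> f t"
    and eq: "\<And>t. 0 < t \<Longrightarrow> caputo_deriv \<alpha> f t = g t - r * f t"
    and g: "\<And>t. 0 < t \<Longrightarrow> 0 \<le> g t" and r: "0 \<le> r"
  defines "u \<equiv> \<lambda>t. ennreal (if 0 < t then f t else 0)" and "v \<equiv> \<lambda>t. ennreal (if 0 < t then g t else 0)"
  assumes [measurable]: "u \<in> borel_measurable borel" "v \<in> borel_measurable borel"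
  shows "u t + ennreal r * conv (ek \<alpha>) u t = ennreal (f 0) * ek 1 t + conv (ek \<alpha>) v t"
proof -
  define f' where "f' s = indicator {0<..} s * deriv f s" for s :: real
  have int: "integrable lborel (\<lambda>s. indicator {0<..<t} s * (deriv f s / (t - s) powr \<alpha>))" if "0 < t" for t
    using f that by (simp add: caputo_differentiable_def set_integrable_def)
  \<comment> \<open>No measurability of \<open>deriv f\<close> is assumed; it is extracted from the
    integrability of the weighted derivative by multiplying the weight back.\<close>
  have meas_t: "(\<lambda>s. indicator {0<..<t} s * deriv f s) \<in> borel_measurable borel" if "0 < t" for t :: real
  proof -
    define h where "h s = indicator {0<..<t} s * (deriv f s / (t - s) powr \<alpha>)" for s
    have "h \<in> borel_measurable borel"
      using borel_measurable_integrable[OF int[OF that]] by (simp add: h_def[abs_def])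
    then have "(\<lambda>s. (t - s) powr \<alpha> * h s) \<in> borel_measurable borel" by simp
    moreover have "(t - s) powr \<alpha> * h s = indicator {0<..<t} s * deriv f s" for s
      by (auto simp: indicator_def h_def)
    ultimately show ?thesis by (simp only:)
  qed
  have f'_meas [measurable]: "f' \<in> borel_measurable borel"
  proof (rule borel_measurable_LIMSEQ_real)
    show "(\<lambda>s. indicator {0<..<real (Suc n)} s * deriv f s) \<in> borel_measurable borel" for n
      by (rule meas_t) simp
    fix s :: real
    have "\<forall>\<^sub>F n in sequentially. s < real (Suc n)"
    proof -
      have "\<forall>\<^sub>F n in sequentially. nat \<lceil>s\<rceil> \<le> n" by (rule eventually_ge_at_top)
      then show ?thesis by eventually_elim linarith
    qed
    then have "\<forall>\<^sub>F n in sequentially. indicator {0<..<real (Suc n)} s * deriv f s = f' s"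
      by eventually_elim (auto simp: f'_def indicator_def)
    then show "(\<lambda>n. indicator {0<..<real (Suc n)} s * deriv f s) \<longlonglongrightarrow> f' s"
      by (rule tendsto_eventually)
  qed
  define a b where "a s = ennreal (f' s)" and "b s = ennreal (- f' s)" for s
  have [measurable]: "a \<in> borel_measurable borel" "b \<in> borel_measurable borel"
    unfolding a_def b_def by measurable
  have nonpos [simp]: "a s = 0" "b s = 0" if "s \<le> 0" for s using that by (auto simp: a_def b_def f'_def)
  have Gpos: "0 < Gamma (1 - \<alpha>)" using order by (intro Gamma_real_pos) simp
  \<comment> \<open>The Caputo equation with every negative term moved to the other side, hence an
    identity in \<open>ennreal\<close>.\<close>
  have bal: "conv (ek (1 - \<alpha>)) a s + ennreal r * u s = conv (ek (1 - \<alpha>)) b s + v s" for s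
  proof (cases "0 < s")
    case False
    then show ?thesis by (simp add: conv_nonpos u_def v_def)
  next
    case s: True
    define w where "w x = frac_kernel (1 - \<alpha>) (s - x) * f' x" for x
    have w: "w x = 1 / Gamma (1 - \<alpha>) * (indicator {0<..<s} x * (deriv f x / (s - x) powr \<alpha>))" for x
      using powr_minus_divide[of "s - x" \<alpha>]
      by (auto simp: w_def f'_def indicator_def frac_kernel_def)
    have w_int: "integrable lborel w"
      unfolding w[abs_def] by (intro integrable_mult_right int s)
    have "integral\<^sup>L lborel w = caputo_deriv \<alpha> f s"
      unfolding w[abs_def] caputo_deriv_def set_lebesgue_integral_def
      by (simp only: integral_mult_right_zero real_scaleR_def)
    moreover have "(\<integral>\<^sup>+x. ennreal (w x) \<partial>lborel) = conv (ek (1 - \<alpha>)) a s"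
      unfolding conv_def w_def a_def using order by (simp add: ennreal_mult')
    moreover have "(\<integral>\<^sup>+x. ennreal (- w x) \<partial>lborel) = conv (ek (1 - \<alpha>)) b s"
      unfolding conv_def w_def b_def using order
      by (simp add: ennreal_mult'[symmetric] del: ennreal_mult')
    ultimately obtain A B where AB: "conv (ek (1 - \<alpha>)) a s = ennreal A" "conv (ek (1 - \<alpha>)) b s = ennreal B"
      "0 \<le> A" "0 \<le> B" "A - B = caputo_deriv \<alpha> f s"
      using real_lebesgue_integral_def[OF w_int] w_int unfolding real_integrable_def
      by (metis enn2real_nonneg ennreal_enn2real infinity_ennreal_def less_top)
    then have "A + r * f s = B + g s" using eq[OF s] by simp
    then show ?thesis using AB s nn[of s] g[OF s] r
      by (simp add: u_def v_def ennreal_mult[symmetric] ennreal_plus[symmetric] del: ennreal_plus)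
  qed
  \<comment> \<open>On \<open>(0, t)\<close> the weight \<open>(t - s) powr - \<alpha>\<close> is at
    least \<open>t powr - \<alpha>\<close>, so \<open>deriv f\<close> is integrable there and the
    fundamental theorem applies. Continuity of f at 0 is what brings in \<open>f 0\<close>.\<close>
  have ftc: "0 < t \<Longrightarrow> ennreal (f t) + conv (ek 1) b t = ennreal (f 0) + conv (ek 1) a t \<and> conv (ek 1) b t < \<infinity>"
  proof -
    assume t: "0 < t"
    define w where "w x = frac_kernel 1 (t - x) * f' x" for x
    have w: "w x = indicator {0<..<t} x * deriv f x" for x
      by (auto simp: w_def f'_def indicator_def frac_kernel_def)
    have w_int: "integrable lborel w"
    proof (rule Bochner_Integration.integrable_bound)
      show "integrable lborel (\<lambda>s. t powr \<alpha> * (indicator {0<..<t} s * (deriv f s / (t - s) powr \<alpha>)))"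
        by (intro integrable_mult_right int t)
      show "w \<in> borel_measurable lborel" unfolding w_def by measurable
      show "AE s in lborel. norm (w s) \<le> norm (t powr \<alpha> * (indicator {0<..<t} s * (deriv f s / (t - s) powr \<alpha>)))"
      proof (rule AE_I2)
        fix s
        have "\<bar>deriv f s\<bar> \<le> t powr \<alpha> * \<bar>deriv f s\<bar> / (t - s) powr \<alpha>" if s: "0 < s" "s < t"
        proof -
          have "(t - s) powr \<alpha> \<le> t powr \<alpha>" using s order by (intro powr_mono2) auto
          then have "\<bar>deriv f s\<bar> * (t - s) powr \<alpha> \<le> \<bar>deriv f s\<bar> * t powr \<alpha>"
            by (rule mult_left_mono) simp
          then show ?thesis using s by (simp add: pos_le_divide_eq mult.commute)
        qed
        then show "norm (w s) \<le> norm (t powr \<alpha> * (indicator {0<..<t} s * (deriv f s / (t - s) powr \<alpha>)))"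
          by (auto simp: w indicator_def abs_mult)
      qed
    qed
    have "(deriv f has_integral f t - f 0) {0..t}"
    proof (rule fundamental_theorem_of_calculus_interior)
      show "continuous_on {0..t} f"
        using f by (auto simp: caputo_differentiable_def elim: continuous_on_subset)
      fix x assume "x \<in> {0<..<t}"
      then have "f differentiable at x" using f by (auto simp: caputo_differentiable_def)
      then show "(f has_vector_derivative deriv f x) (at x)"
        by (simp add: DERIV_deriv_iff_real_differentiable[symmetric] has_real_derivative_iff_has_vector_derivative)
    qed (use t in simp)
    moreover have "(deriv f has_integral integral\<^sup>L lborel w) {0..t}"
    proof -
      have "(w has_integral integral\<^sup>L lborel w) UNIV"
        by (rule has_integral_integral_lborel[OF w_int])
      moreover have "w = (\<lambda>x. if x \<in> {0<..<t} then deriv f x else 0)"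
        by (auto simp: w fun_eq_iff)
      ultimately have "(deriv f has_integral integral\<^sup>L lborel w) {0<..<t}"
        by (simp only: has_integral_restrict_UNIV)
      then show ?thesis by (simp add: has_integral_Icc_iff_Ioo)
    qed
    ultimately have "integral\<^sup>L lborel w = f t - f 0" by (metis has_integral_unique)
    moreover have "(\<integral>\<^sup>+x. ennreal (w x) \<partial>lborel) = conv (ek 1) a t"
      unfolding conv_def w_def a_def by (simp add: ennreal_mult')
    moreover have "(\<integral>\<^sup>+x. ennreal (- w x) \<partial>lborel) = conv (ek 1) b t"
      unfolding conv_def w_def b_def by (simp add: ennreal_mult'[symmetric] del: ennreal_mult')
    ultimately obtain A B where AB: "conv (ek 1) a t = ennreal A" "conv (ek 1) b t = ennreal B"
      "0 \<le> A" "0 \<le> B" "A - B = f t - f 0"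
      using real_lebesgue_integral_def[OF w_int] w_int unfolding real_integrable_def
      by (metis enn2real_nonneg ennreal_enn2real infinity_ennreal_def less_top)
    then have "f t + B = f 0 + A" by simp
    then show "ennreal (f t) + conv (ek 1) b t = ennreal (f 0) + conv (ek 1) a t \<and> conv (ek 1) b t < \<infinity>"
      using AB f0 nn[of t] t
      by (simp add: ennreal_plus[symmetric] del: ennreal_plus)
  qed
  show ?thesis
  proof (cases "0 < t")
    case False
    then show ?thesis by (simp add: conv_nonpos u_def v_def)
  next
    case t: True
    have "conv (ek 1) a t + ennreal r * conv (ek \<alpha>) u t =
        conv (ek \<alpha>) (\<lambda>s. conv (ek (1 - \<alpha>)) a s + ennreal r * u s) t"
      by (simp add: conv_add_right conv_cmult_right conv_assoc[symmetric])
    also have "\<dots> = conv (ek 1) b t + conv (ek \<alpha>) v t"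
      unfolding bal by (simp add: conv_add_right conv_assoc[symmetric])
    finally have "conv (ek 1) b t + (ennreal (f t) + ennreal r * conv (ek \<alpha>) u t) =
        conv (ek 1) b t + (ennreal (f 0) + conv (ek \<alpha>) v t)"
      using ftc[OF t] by (metis (no_types, lifting) add.assoc add.commute)
    then have "ennreal (f t) + ennreal r * conv (ek \<alpha>) u t = ennreal (f 0) + conv (ek \<alpha>) v t"
      using ftc[OF t] by (auto simp: ennreal_add_left_cancel)
    then show ?thesis using t by (simp add: u_def frac_kernel_1)
  qed
qed

text \<open>Every nonnegative solution q is a fixed point of the monotone renewal operator. The
  Picard iterates start at 0, below q, hence stay below it, and so does their supremum.\<close>

lemma bd_prob_minimal:
  assumes q: "solves_backward \<alpha> lam mu q" and nn: "\<And>i j t. 0 \<le> t \<Longrightarrow> 0 \<le> q i j t"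
    and j: "1 \<le> j" and t: "0 \<le> t"
  shows "bd_prob i j t \<le> q i j t"
proof -
  have q0: "q i j 0 = of_bool (i = j)" for i
    using q by (auto simp: solves_backward_def)
  define Q where "Q i s = (if 0 < s then q i j s else 0)" for i s
  define u where "u i s = ennreal (Q i s)" for i s
  have cont: "continuous_on {0..} (q i j)" for i
    using q j by (auto simp: solves_backward_def caputo_differentiable_def)
  have Q_meas [measurable]: "Q i \<in> borel_measurable borel" for i
  proof -
    have "(\<lambda>s. indicator {0<..} s *\<^sub>R q i j s) \<in> borel_measurable borel"
      by (rule borel_measurable_continuous_on_indicator)
        (auto intro: continuous_on_subset[OF cont])
    moreover have "(\<lambda>s. indicator {0<..} s *\<^sub>R q i j s) = Q i"
      by (auto simp: Q_def fun_eq_iff)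
    ultimately show ?thesis by (simp only:)
  qed
  have [measurable]: "u i \<in> borel_measurable borel" for i unfolding u_def by measurable
  have Q_nn: "0 \<le> Q i s" for i s using nn by (simp add: Q_def)
  have inflow: "ennreal (if 0 < s then lam i * q (i + 1) j s + mu i * q (i - 1) j s else 0) =
      ennreal (lam i) * u (i + 1) s + ennreal (mu i) * u (i - 1) s" for i s
    using nn by (auto simp: u_def Q_def ennreal_mult)
  have eq: "u i s + ennreal (rate i) * conv (ek \<alpha>) (u i) s = of_bool (i = j) * ek 1 s +
      conv (ek \<alpha>) (\<lambda>s. ennreal (lam i) * u (i + 1) s + ennreal (mu i) * u (i - 1) s) s" for i s
  proof -
    have "ennreal (if 0 < s then q i j s else 0) +
       ennreal (rate i) * conv (ek \<alpha>) (\<lambda>t. ennreal (if 0 < t then q i j t else 0)) s =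
       ennreal (q i j 0) * ek 1 s +
       conv (ek \<alpha>) (\<lambda>s. ennreal (if 0 < s then lam i * q (i + 1) j s + mu i * q (i - 1) j s else 0)) s"
    proof (rule caputo_integral_equation)
      show "caputo_differentiable \<alpha> (q i j)" using q j by (auto simp: solves_backward_def)
      show "(\<lambda>t. ennreal (if 0 < t then q i j t else 0)) \<in> borel_measurable borel"
        unfolding Q_def[symmetric] by measurable
      show "(\<lambda>s. ennreal (if 0 < s then lam i * q (i + 1) j s + mu i * q (i - 1) j s else 0)) \<in> borel_measurable borel"
        unfolding inflow by measurable
      fix t :: real assume "0 < t"
      then show "caputo_deriv \<alpha> (q i j) t = lam i * q (i + 1) j t + mu i * q (i - 1) j t - rate i * q i j t"
        using q j by (auto simp: solves_backward_def)
    qed (use nn in auto)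
    moreover have "ennreal (q i j 0) = of_bool (i = j)" by (simp add: q0)
    moreover have "(\<lambda>t. ennreal (if 0 < t then q i j t else 0)) = u i" by (simp add: u_def Q_def fun_eq_iff)
    ultimately show ?thesis unfolding inflow by (simp only: u_def Q_def)
  qed
  \<comment> \<open>The function q is bounded on \<open>[0, s]\<close> by continuity, so its
    fractional integral is finite.\<close>
  have fin: "u i s < \<infinity>" "conv (ek \<alpha>) (u i) s < \<infinity>" for i s
  proof -
    show "u i s < \<infinity>" by (simp add: u_def)
    show "conv (ek \<alpha>) (u i) s < \<infinity>"
    proof (cases "0 < s")
      case False
      then show ?thesis by (simp add: conv_nonpos u_def Q_def)
    next
      case True
      have "compact ((q i j) ` {0..s})"
        by (intro compact_continuous_image continuous_on_subset[OF cont]) auto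
      then obtain C where C: "\<And>x. 0 \<le> x \<Longrightarrow> x \<le> s \<Longrightarrow> q i j x \<le> C"
        using compact_imp_bounded bounded_real by (metis abs_le_D1 atLeastAtMost_iff imageI)
      have "conv (ek \<alpha>) (u i) s \<le> conv (ek \<alpha>) (\<lambda>x. ennreal C * ek 1 x) s"
        unfolding conv_def
      proof (rule nn_integral_mono)
        fix x
        consider "x \<le> 0" | "s \<le> x" | "0 < x" "x < s" by linarith
        then show "ek \<alpha> (s - x) * u i x \<le> ek \<alpha> (s - x) * (ennreal C * ek 1 x)"
          by cases (auto simp: u_def Q_def frac_kernel_1 C intro!: mult_left_mono ennreal_leI)
      qed
      also have "\<dots> = ennreal C * ek (\<alpha> + 1) s"
        using order by (simp add: conv_cmult_right conv_frac_kernel)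
      also have "\<dots> < \<infinity>" by (simp add: ennreal_mult_less_top)
      finally show ?thesis .
    qed
  qed
  have sol: "u i s = of_bool (i = j) * conv (ek (1 - \<alpha>)) (psi (rate i)) s +
      conv (psi (rate i)) (\<lambda>s. ennreal (lam i) * u (i + 1) s + ennreal (mu i) * u (i - 1) s) s" for i s
    by (rule resolvent_inversion) (use eq fin in auto)
  have le: "conv (ek (1 - \<alpha>)) (partial_kernel n i j) s \<le> u i s" for n i s
  proof (induction n arbitrary: i s)
    case 0
    then show ?case by (simp add: partial_kernel_def conv_def)
  next
    case (Suc n)
    define G where "G = (\<lambda>s. ennreal (lam i) * partial_kernel n (i + 1) j s + ennreal (mu i) * partial_kernel n (i - 1) j s)"
    have [measurable]: "G \<in> borel_measurable borel" unfolding G_def by measurable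
    have "conv (ek (1 - \<alpha>)) (partial_kernel (Suc n) i j) s =
        conv (ek (1 - \<alpha>)) (\<lambda>t. of_bool (i = j) * psi (rate i) t + conv (psi (rate i)) G t) s"
      by (simp only: partial_kernel_Suc[abs_def] G_def)
    also have "\<dots> = of_bool (i = j) * conv (ek (1 - \<alpha>)) (psi (rate i)) s +
        conv (ek (1 - \<alpha>)) (conv (psi (rate i)) G) s"
      by (subst conv_add_right) (auto simp: conv_cmult_right)
    also have "conv (ek (1 - \<alpha>)) (conv (psi (rate i)) G) = conv (conv (ek (1 - \<alpha>)) (psi (rate i))) G"
      by (rule conv_assoc[symmetric]) auto
    also have "conv (ek (1 - \<alpha>)) (psi (rate i)) = conv (psi (rate i)) (ek (1 - \<alpha>))"
      by (rule conv_commute) auto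
    also have "conv (conv (psi (rate i)) (ek (1 - \<alpha>))) G = conv (psi (rate i)) (conv (ek (1 - \<alpha>)) G)"
      by (rule conv_assoc) auto
    also have "conv (ek (1 - \<alpha>)) G = (\<lambda>s. ennreal (lam i) * conv (ek (1 - \<alpha>)) (partial_kernel n (i + 1) j) s +
        ennreal (mu i) * conv (ek (1 - \<alpha>)) (partial_kernel n (i - 1) j) s)"
      unfolding G_def by (rule ext) (subst conv_add_right, auto simp: conv_cmult_right)
    also have "conv (psi (rate i)) (ek (1 - \<alpha>)) = conv (ek (1 - \<alpha>)) (psi (rate i))"
      by (rule conv_commute) auto
    finally show ?case
      by (subst sol) (auto intro!: add_mono conv_mono mult_left_mono Suc)
  qed
  have "bd_mass i j s = (SUP n. conv (ek (1 - \<alpha>)) (partial_kernel n i j) s)" for s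
  proof -
    have "bd_mass i j s = (\<integral>\<^sup>+x. (SUP n. ek (1 - \<alpha>) (s - x) * partial_kernel n i j x) \<partial>lborel)"
      unfolding bd_mass_def conv_def bd_kernel_SUP by (simp add: SUP_mult_left_ennreal)
    also have "\<dots> = (SUP n. conv (ek (1 - \<alpha>)) (partial_kernel n i j) s)"
      unfolding conv_def
      by (rule nn_integral_monotone_convergence_SUP)
        (auto simp: incseq_def le_fun_def partial_kernel_def intro!: mult_left_mono sum_mono2)
    finally show ?thesis .
  qed
  then have mass_le: "bd_mass i j s \<le> u i s" for s by (auto intro!: SUP_least le)
  show ?thesis
  proof (cases "t = 0")
    case True
    then show ?thesis by (simp add: bd_prob_def q0)
  next
    case False
    then have "ennreal (bd_prob i j t) \<le> ennreal (q i j t)"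
      using mass_le[of t] t by (simp add: bd_mass_real u_def Q_def)
    then show ?thesis using nn[OF t, of i j] by (simp add: ennreal_le_iff)
  qed
qed

text \<open>The column \<open>j = 0\<close> is left free apart from sign and initial value: the
  system does not constrain it otherwise, and a concrete process will later fill it with its own
  probabilities.\<close>

lemma minimal_backward_solution_bd_prob:
  assumes p: "\<And>i j. 1 \<le> j \<Longrightarrow> p i j = bd_prob i j"
    and p0: "\<And>i. p i 0 0 = of_bool (i = 0)" "\<And>i t. 0 \<le> t \<Longrightarrow> 0 \<le> p i 0 t"
  shows "minimal_backward_solution \<alpha> lam mu p"
proof -
  have "p i j 0 = (if i = j then 1 else 0)" for i j
    by (cases "j = 0") (auto simp: p0 p bd_prob_def)
  moreover have "0 \<le> p i j t" if "0 \<le> t" for i j t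
    using that by (cases "j = 0") (auto simp: p0 p)
  ultimately show ?thesis
    unfolding minimal_backward_solution_def solves_backward_def
    by (auto simp: p bd_prob_0 caputo_differentiable_bd_prob bd_prob_caputo(2)
        intro!: bd_prob_minimal simp: solves_backward_def)
qed

lemma fractional_bd_process_cond_prob:
  assumes N: "fractional_bd_process \<alpha> lam mu M N" and i: "0 < \<P>(\<omega> in M. N 0 \<omega> = i)"
    and j: "1 \<le> j" and t: "0 \<le> t"
  shows "\<P>(\<omega> in M. N t \<omega> = j \<bar> N 0 \<omega> = i) = bd_prob i j t"
proof -
  have "\<exists>p. minimal_backward_solution \<alpha> lam mu p \<and>
      (\<forall>i. \<P>(\<omega> in M. N 0 \<omega> = i) > 0 \<longrightarrow>
        (\<forall>j. \<forall>t\<ge>0. \<P>(\<omega> in M. N t \<omega> = j \<bar> N 0 \<omega> = i) = p i j t))"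
    using N by (simp only: fractional_bd_process_def)
  then obtain p where p: "minimal_backward_solution \<alpha> lam mu p"
    and "\<forall>i. \<P>(\<omega> in M. N 0 \<omega> = i) > 0 \<longrightarrow>
        (\<forall>j. \<forall>t\<ge>0. \<P>(\<omega> in M. N t \<omega> = j \<bar> N 0 \<omega> = i) = p i j t)"
    by (elim exE conjE)
  then have p_eq: "\<P>(\<omega> in M. N t \<omega> = j \<bar> N 0 \<omega> = i) = p i j t"
    using i t by simp
  \<comment> \<open>Any nonnegative filler with the right initial value will do for the column
    \<open>j = 0\<close>. Two minimal solutions lie below each other, so they agree on all columns
    \<open>j \<ge> 1\<close>.\<close>
  define q where "q i j = (if j = 0 then (\<lambda>t. of_bool (i = 0 \<and> t = 0)) else bd_prob i j)" for i j :: nat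
  have q: "minimal_backward_solution \<alpha> lam mu q"
    by (rule minimal_backward_solution_bd_prob) (auto simp: q_def)
  have le: "f i j t \<le> g i j t"
    if "minimal_backward_solution \<alpha> lam mu f" "minimal_backward_solution \<alpha> lam mu g" for f g
    using that j t by (simp add: minimal_backward_solution_def)
  have "p i j t = q i j t" by (intro antisym le p q)
  then show ?thesis using p_eq j by (simp add: q_def)
qed

lemma fractional_bd_process_cond_prob_0:
  assumes N: "fractional_bd_process \<alpha> lam mu M N" and i: "0 < \<P>(\<omega> in M. N 0 \<omega> = i)"
    and t: "0 \<le> t"
  shows "\<P>(\<omega> in M. N t \<omega> = 0 \<bar> N 0 \<omega> = i) = 1 - (\<Sum>j. bd_prob i (Suc j) t)"
proof -
  have "prob_space M" "\<And>t. 0 \<le> t \<Longrightarrow> N t \<in> measurable M (count_space UNIV)"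
    using N by (simp_all only: fractional_bd_process_def)
  then have "\<P>(\<omega> in M. N t \<omega> = 0 \<bar> N 0 \<omega> = i) = 1 - (\<Sum>j. \<P>(\<omega> in M. N t \<omega> = Suc j \<bar> N 0 \<omega> = i))"
    by (rule cond_prob_0_eq) (use i t in auto)
  also have "\<P>(\<omega> in M. N t \<omega> = Suc j \<bar> N 0 \<omega> = i) = bd_prob i (Suc j) t" for j
    by (rule fractional_bd_process_cond_prob[OF N i _ t]) simp
  then have "(\<Sum>j. \<P>(\<omega> in M. N t \<omega> = Suc j \<bar> N 0 \<omega> = i)) = (\<Sum>j. bd_prob i (Suc j) t)"
    by (simp only:)
  finally show ?thesis .
qed

lemma fractional_bd_process_cond_prob_unique:
  assumes N: "fractional_bd_process \<alpha> lam mu M N" "0 < \<P>(\<omega> in M. N 0 \<omega> = i)"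
    and N': "fractional_bd_process \<alpha> lam mu M' N'" "0 < \<P>(\<omega> in M'. N' 0 \<omega> = i)"
    and t: "0 \<le> t"
  shows "\<P>(\<omega> in M. N t \<omega> = j \<bar> N 0 \<omega> = i) = \<P>(\<omega> in M'. N' t \<omega> = j \<bar> N' 0 \<omega> = i)"
proof (cases "j = 0")
  case True
  then show ?thesis
    using fractional_bd_process_cond_prob_0[OF N t] fractional_bd_process_cond_prob_0[OF N' t]
    by (simp only:)
next
  case False
  then have "1 \<le> j" by simp
  from fractional_bd_process_cond_prob[OF N this t] fractional_bd_process_cond_prob[OF N' this t]
  show ?thesis by (simp only:)
qed

end

section \<open>Construction of the renewal process\<close>

locale fractional_bd_construction = fractional_birth_death +
  fixes \<nu> :: "nat pmf"
begin

text \<open>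
  One coordinate of the noise drives one step: its first component, read off against a set \<open>up_set i\<close>
  of geometric measure \<open>lam i / (lam i + mu i)\<close>, decides the direction, and its second component, scaled
  by the state, is the holding time. The first component of coordinate \<open>0\<close> is the initial state.
\<close>

definition up_set :: "nat \<Rightarrow> nat set" where
  "up_set i = (SOME A. measure (measure_pmf (geometric_pmf (1 / 2))) A = lam i / rate i)"

definition holding_law :: "real measure" where
  "holding_law = density lborel (psi 1)"

definition noise :: "nat \<Rightarrow> (nat \<times> real) measure" where
  "noise n = measure_pmf (if n = 0 then \<nu> else geometric_pmf (1 / 2)) \<Otimes>\<^sub>M holding_law"

definition bd_measure :: "(nat \<Rightarrow> nat \<times> real) measure" where
  "bd_measure = PiM UNIV noise"

definition step :: "nat \<Rightarrow> nat \<Rightarrow> nat" where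
  "step i b = (if i = 0 then 0 else if b \<in> up_set i then i + 1 else i - 1)"

text \<open>A Markov renewal process needs strictly increasing times for every \<omega>, so the null
  set \<open>v \<le> 0\<close> is sent to a positive value. In state 0 the rate vanishes and the
  scale 1 is a free choice.\<close>

definition hold :: "nat \<Rightarrow> real \<Rightarrow> real" where
  "hold i v = (if i = 0 then 1 else rate i powr (- 1 / \<alpha>)) * (if 0 < v then v else 1)"

fun chain :: "nat \<Rightarrow> (nat \<Rightarrow> nat \<times> real) \<Rightarrow> nat" where
  "chain 0 \<omega> = fst (\<omega> 0)"
| "chain (Suc n) \<omega> = step (chain n \<omega>) (fst (\<omega> (Suc n)))"

definition interarrival :: "nat \<Rightarrow> (nat \<Rightarrow> nat \<times> real) \<Rightarrow> real" where
  "interarrival n \<omega> = hold (chain n \<omega>) (snd (\<omega> (Suc n)))"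

definition jump_time :: "nat \<Rightarrow> (nat \<Rightarrow> nat \<times> real) \<Rightarrow> real" where
  "jump_time n \<omega> = (\<Sum>k<n. interarrival k \<omega>)"

lemma jump_time_Suc: "jump_time (Suc n) \<omega> = jump_time n \<omega> + interarrival n \<omega>"
  by (simp add: jump_time_def)

lemma jump_time_0 [simp]: "jump_time 0 \<omega> = 0"
  by (simp add: jump_time_def)

lemma hold_pos: "0 < hold i v"
  using rate_pos[of i] by (auto simp: hold_def)

lemma jump_time_strict_mono: "jump_time n \<omega> < jump_time (Suc n) \<omega>"
  by (simp add: jump_time_Suc interarrival_def hold_pos)

text \<open>The state at step n depends only on the coordinates up to n. Invariance under
  overwriting a later coordinate is the form in which independence of the past is used
  below.\<close>

lemma chain_upd [simp]: "n < k \<Longrightarrow> chain n (fun_upd \<omega> k w) = chain n \<omega>"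
  by (induction n) auto

lemma interarrival_upd [simp]: "Suc n < k \<Longrightarrow> interarrival n (fun_upd \<omega> k w) = interarrival n \<omega>"
  by (simp add: interarrival_def)

lemma jump_time_upd [simp]: "n < k \<Longrightarrow> jump_time n (fun_upd \<omega> k w) = jump_time n \<omega>"
  by (simp add: jump_time_def)

lemma prob_space_holding_law: "prob_space holding_law"
  by (rule prob_spaceI) (simp add: holding_law_def emeasure_density nn_integral_psi)

lemma sets_holding_law [simp, measurable_cong]: "sets holding_law = sets borel"
  by (simp add: holding_law_def)

lemma space_holding_law [simp]: "space holding_law = UNIV"
  by (simp add: holding_law_def)

lemma prob_space_noise: "prob_space (noise n)"
  unfolding noise_def
  by (intro prob_space_pair prob_space_measure_pmf prob_space_holding_law)

lemma sets_noise [measurable_cong]: "sets (noise n) = sets (count_space UNIV \<Otimes>\<^sub>M borel)"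
  unfolding noise_def by (intro sets_pair_measure_cong) auto

lemma space_noise [simp]: "space (noise n) = UNIV"
  by (simp add: noise_def space_pair_measure)

lemma space_bd_measure [simp]: "space bd_measure = UNIV"
  by (simp add: bd_measure_def space_PiM)

lemma prob_space_bd_measure: "prob_space bd_measure"
  unfolding bd_measure_def by (intro prob_space_PiM prob_space_noise)

sublocale bd: prob_space bd_measure
  by (rule prob_space_bd_measure)

lemma measurable_coordinate [measurable]: "(\<lambda>\<omega>. \<omega> n) \<in> measurable bd_measure (count_space UNIV \<Otimes>\<^sub>M borel)"
proof -
  have "(\<lambda>\<omega>. \<omega> n) \<in> measurable bd_measure (noise n)"
    unfolding bd_measure_def by (rule measurable_component_singleton) simp
  then show ?thesis by (simp add: measurable_cong_sets[OF refl sets_noise])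
qed

lemma measurable_hold [measurable]: "hold i \<in> borel_measurable borel"
  unfolding hold_def by measurable

lemma measurable_chain [measurable]: "chain n \<in> measurable bd_measure (count_space UNIV)"
proof (induction n)
  case 0
  then show ?case by simp
next
  case (Suc n)
  have "(\<lambda>\<omega>. step i (fst (\<omega> (Suc n)))) \<in> measurable bd_measure (count_space UNIV)" for i
    by (rule measurable_compose[of "\<lambda>\<omega>. fst (\<omega> (Suc n))" _ "count_space UNIV"]) auto
  from measurable_compose_countable[OF this Suc] show ?case by simp
qed

lemma measurable_interarrival [measurable]: "interarrival n \<in> borel_measurable bd_measure"
proof -
  have "(\<lambda>\<omega>. hold i (snd (\<omega> (Suc n)))) \<in> borel_measurable bd_measure" for i by measurable
  from measurable_compose_countable[OF this measurable_chain] show ?thesis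
    by (simp add: interarrival_def[abs_def])
qed

lemma measurable_jump_time [measurable]: "jump_time n \<in> borel_measurable bd_measure"
  unfolding jump_time_def by measurable

lemma measurable_step_pair [measurable]:
  "(\<lambda>p. step (chain n (fst p)) (fst (snd p))) \<in> measurable (bd_measure \<Otimes>\<^sub>M noise k) (count_space UNIV)"
proof -
  have "(\<lambda>p. step i (fst (snd p))) \<in> measurable (bd_measure \<Otimes>\<^sub>M noise k) (count_space UNIV)" for i
    by (rule measurable_compose[of "\<lambda>p. fst (snd p)" _ "count_space UNIV"]) auto
  moreover have "(\<lambda>p. chain n (fst p)) \<in> measurable (bd_measure \<Otimes>\<^sub>M noise k) (count_space UNIV)"
    by measurable
  ultimately show ?thesis by (rule measurable_compose_countable)
qed

lemma measurable_hold_pair [measurable]: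
  "(\<lambda>p. hold (chain n (fst p)) (snd (snd p))) \<in> borel_measurable (bd_measure \<Otimes>\<^sub>M noise k)"
proof -
  have "(\<lambda>p. hold i (snd (snd p))) \<in> borel_measurable (bd_measure \<Otimes>\<^sub>M noise k)" for i by measurable
  moreover have "(\<lambda>p. chain n (fst p)) \<in> measurable (bd_measure \<Otimes>\<^sub>M noise k) (count_space UNIV)"
    by measurable
  ultimately show ?thesis by (rule measurable_compose_countable)
qed

lemma measurable_step_noise [measurable]:
  "(\<lambda>w. step i (fst w)) \<in> measurable (noise k) (count_space UNIV)"
proof -
  have "fst \<in> measurable (noise k) (count_space UNIV)"
    by (simp add: measurable_cong_sets[OF sets_noise refl])
  then show ?thesis by (rule measurable_compose) simp
qed

lemma measurable_hold_noise [measurable]: "(\<lambda>w. hold i (snd w)) \<in> borel_measurable (noise k)"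
proof -
  have "snd \<in> measurable (noise k) borel"
    by (simp add: measurable_cong_sets[OF sets_noise refl])
  then show ?thesis by (rule measurable_compose) simp
qed

lemma measurable_step_pair_const [measurable]:
  "(\<lambda>p. step i (fst (snd p))) \<in> measurable (bd_measure \<Otimes>\<^sub>M noise k) (count_space UNIV)"
  by (rule measurable_compose[of "\<lambda>p. fst (snd p)" _ "count_space UNIV"]) auto

text \<open>Independence of coordinate k from the others, in integral form: if F ignores coordinate
  k of its first argument, that coordinate may be replaced by a fresh draw.\<close>

lemma nn_integral_resample:
  assumes F [measurable]: "(\<lambda>p. F (fst p) (snd p)) \<in> borel_measurable (bd_measure \<Otimes>\<^sub>M noise k)"
    and inv: "\<And>\<omega> w w'. F (fun_upd \<omega> k w') w = F \<omega> w"
  shows "(\<integral>\<^sup>+\<omega>. F \<omega> (\<omega> k) \<partial>bd_measure) = (\<integral>\<^sup>+\<omega>. (\<integral>\<^sup>+w. F \<omega> w \<partial>noise k) \<partial>bd_measure)"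
proof -
  interpret noise: prob_space "noise k" by (rule prob_space_noise)
  interpret pair_sigma_finite "noise k" bd_measure ..
  have ok: "(\<lambda>\<omega>. \<omega> k) \<in> measurable bd_measure (noise k)"
    unfolding bd_measure_def by (rule measurable_component_singleton) simp
  have F1: "(\<lambda>\<omega>. F \<omega> (\<omega> k)) \<in> borel_measurable bd_measure"
    using measurable_compose[OF measurable_Pair[OF measurable_ident_sets[OF refl] ok] F] by simp
  \<comment> \<open>Overwriting one coordinate by an independent draw preserves the product
    measure.\<close>
  have "distr (noise k \<Otimes>\<^sub>M PiM UNIV noise) (PiM (insert k UNIV) noise) (\<lambda>(x, X). fun_upd X k x) =
      PiM (insert k UNIV) noise"
    by (rule distr_pair_PiM_eq_PiM) (auto intro: prob_space_noise)
  then have distr: "bd_measure = distr (noise k \<Otimes>\<^sub>M bd_measure) bd_measure (\<lambda>(x, X). fun_upd X k x)"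
    by (simp add: bd_measure_def)
  have upd: "(\<lambda>(x, X). fun_upd X k x) \<in> measurable (noise k \<Otimes>\<^sub>M bd_measure) bd_measure"
    unfolding bd_measure_def using measurable_fun_upd[of UNIV UNIV k snd "noise k \<Otimes>\<^sub>M PiM UNIV noise" noise fst]
    by (auto simp: case_prod_beta)
  have "(\<integral>\<^sup>+\<omega>. F \<omega> (\<omega> k) \<partial>bd_measure) =
      (\<integral>\<^sup>+\<omega>. F \<omega> (\<omega> k) \<partial>distr (noise k \<Otimes>\<^sub>M bd_measure) bd_measure (\<lambda>(x, X). fun_upd X k x))"
    by (subst distr) rule
  also have "\<dots> = (\<integral>\<^sup>+(x, X). F X x \<partial>(noise k \<Otimes>\<^sub>M bd_measure))"
    by (subst nn_integral_distr[OF upd]) (auto simp: case_prod_beta' inv F1)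
  also have "\<dots> = (\<integral>\<^sup>+p. F (snd p) (fst p) \<partial>(noise k \<Otimes>\<^sub>M bd_measure))"
    by (intro nn_integral_cong) auto
  also have "\<dots> = (\<integral>\<^sup>+\<omega>. (\<integral>\<^sup>+w. F \<omega> w \<partial>noise k) \<partial>bd_measure)"
  proof -
    have "(\<lambda>p. F (snd p) (fst p)) \<in> borel_measurable (noise k \<Otimes>\<^sub>M bd_measure)"
      using measurable_compose[OF measurable_Pair[OF measurable_snd measurable_fst] F] by simp
    from nn_integral_snd[OF this] show ?thesis by simp
  qed
  finally show ?thesis .
qed

section \<open>One-step laws and the Markov renewal property\<close>

definition step_prob :: "nat \<Rightarrow> nat \<Rightarrow> real" where
  "step_prob i j = measure (measure_pmf (geometric_pmf (1 / 2))) {b. step i b = j}"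

definition hold_prob :: "nat \<Rightarrow> real set \<Rightarrow> real" where
  "hold_prob i B = measure holding_law {v. hold i v \<in> B}"

lemma step_prob_nonneg [simp]: "0 \<le> step_prob i j" and hold_prob_nonneg [simp]: "0 \<le> hold_prob i B"
  by (simp_all add: step_prob_def hold_prob_def)

lemma hold_prob_UNIV [simp]: "hold_prob i UNIV = 1"
  using prob_space.prob_space[OF prob_space_holding_law] by (simp add: hold_prob_def)

lemma step_prob_0: "step_prob 0 j = of_bool (j = 0)"
  using prob_space.prob_space[OF prob_space_measure_pmf, of "geometric_pmf (1 / 2)"]
  by (auto simp: step_prob_def step_def)

lemma measure_up_set:
  assumes "1 \<le> i"
  shows "measure (measure_pmf (geometric_pmf (1 / 2))) (up_set i) = lam i / rate i"
  unfolding up_set_def using rate_pos[OF assms] rates_pos[OF assms]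
  by (intro someI_ex[OF ex_subset_geometric_pmf]) auto

lemma step_prob_pos:
  assumes i: "1 \<le> i"
  shows "step_prob i j = (of_bool (j = i + 1) * lam i + of_bool (i = j + 1) * mu i) / rate i"
proof -
  have c: "measure (measure_pmf (geometric_pmf (1 / 2))) (- up_set i) = mu i / rate i"
    using measure_pmf.prob_compl[where M = "geometric_pmf (1 / 2)" and A = "up_set i"] measure_up_set[OF i] rate_pos[OF i]
    by (simp add: Compl_eq_Diff_UNIV field_simps)
  consider "j = i + 1" | "i = j + 1" | "j \<noteq> i + 1" "i \<noteq> j + 1" by blast
  then show ?thesis
  proof cases
    case 1
    then have "{b. step i b = j} = up_set i" using i by (auto simp: step_def)
    then show ?thesis using 1 measure_up_set[OF i] by (simp add: step_prob_def)
  next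
    case 2
    then have "{b. step i b = j} = - up_set i" using i by (auto simp: step_def)
    then show ?thesis using 2 c by (simp add: step_prob_def)
  next
    case 3
    then have "{b. step i b = j} = {}" using i by (auto simp: step_def)
    then show ?thesis using 3 by (simp add: step_prob_def)
  qed
qed

lemma nn_integral_noise:
  assumes [measurable]: "h \<in> borel_measurable borel"
  shows "(\<integral>\<^sup>+w. of_bool (fst w \<in> B) * h (snd w) \<partial>noise (Suc n)) =
    emeasure (measure_pmf (geometric_pmf (1 / 2))) B * (\<integral>\<^sup>+v. h v \<partial>holding_law)"
proof -
  interpret H: prob_space holding_law by (rule prob_space_holding_law)
  have "(\<integral>\<^sup>+w. of_bool (fst w \<in> B) * h (snd w) \<partial>noise (Suc n)) =
      (\<integral>\<^sup>+b. (\<integral>\<^sup>+v. of_bool (b \<in> B) * h v \<partial>holding_law) \<partial>measure_pmf (geometric_pmf (1 / 2)))"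
  proof -
    have "(\<lambda>w. of_bool (fst w \<in> B) * h (snd w)) \<in> borel_measurable (measure_pmf (geometric_pmf (1 / 2)) \<Otimes>\<^sub>M holding_law)"
    proof (intro borel_measurable_times_ennreal)
      show "(\<lambda>w. of_bool (fst w \<in> B)) \<in> borel_measurable (measure_pmf (geometric_pmf (1 / 2)) \<Otimes>\<^sub>M holding_law)"
        by (rule measurable_compose[OF measurable_fst]) simp
      show "(\<lambda>w. h (snd w)) \<in> borel_measurable (measure_pmf (geometric_pmf (1 / 2)) \<Otimes>\<^sub>M holding_law)"
        by (rule measurable_compose[OF measurable_snd])
          (simp add: measurable_cong_sets[OF sets_holding_law refl] assms)
    qed
    from H.nn_integral_fst[OF this] show ?thesis by (simp add: noise_def)
  qed
  also have "\<dots> = (\<integral>\<^sup>+b. indicator B b * (\<integral>\<^sup>+v. h v \<partial>holding_law) \<partial>measure_pmf (geometric_pmf (1 / 2)))"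
    by (intro nn_integral_cong) (auto simp: indicator_def)
  also have "\<dots> = emeasure (measure_pmf (geometric_pmf (1 / 2))) B * (\<integral>\<^sup>+v. h v \<partial>holding_law)"
    by (subst nn_integral_multc) auto
  finally show ?thesis .
qed

lemma nn_integral_step_hold:
  assumes [measurable]: "h \<in> borel_measurable borel"
  shows "(\<integral>\<^sup>+w. of_bool (step i (fst w) = j) * h (hold i (snd w)) \<partial>noise (Suc n)) =
    ennreal (step_prob i j) * (\<integral>\<^sup>+v. h (hold i v) \<partial>holding_law)"
  using nn_integral_noise[where h = "\<lambda>v. h (hold i v)" and B = "{b. step i b = j}" and n = n]
  by (simp add: step_prob_def measure_pmf.emeasure_eq_measure)

lemma emeasure_hold:
  assumes [measurable]: "B \<in> sets borel"
  shows "(\<integral>\<^sup>+v. indicator B (hold i v) \<partial>holding_law) = ennreal (hold_prob i B)"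
proof -
  interpret H: prob_space holding_law by (rule prob_space_holding_law)
  have "(\<integral>\<^sup>+v. indicator B (hold i v) \<partial>holding_law) = (\<integral>\<^sup>+v. indicator {v. hold i v \<in> B} v \<partial>holding_law)"
    by (intro nn_integral_cong) (auto simp: indicator_def)
  also have "\<dots> = emeasure holding_law {v. hold i v \<in> B}"
    by (rule nn_integral_indicator) (simp add: pred_def[symmetric])
  finally show ?thesis by (simp add: hold_prob_def H.emeasure_eq_measure)
qed

text \<open>The substitute value for \<open>v \<le> 0\<close> is invisible, because
  \<open>psi 1\<close> vanishes there; what remains is the scaling of the unit law.\<close>

lemma nn_integral_hold:
  assumes i: "1 \<le> i" and [measurable]: "h \<in> borel_measurable borel"
  shows "(\<integral>\<^sup>+v. h (hold i v) \<partial>holding_law) = ennreal (rate i) * (\<integral>\<^sup>+u. psi (rate i) u * h u \<partial>lborel)"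
proof -
  have "(\<integral>\<^sup>+v. h (hold i v) \<partial>holding_law) = (\<integral>\<^sup>+v. psi 1 v * h (hold i v) \<partial>lborel)"
    unfolding holding_law_def by (subst nn_integral_density) auto
  also have "\<dots> = (\<integral>\<^sup>+v. psi 1 v * h (rate i powr (- 1 / \<alpha>) * v) \<partial>lborel)"
  proof (rule nn_integral_cong)
    fix v :: real
    show "psi 1 v * h (hold i v) = psi 1 v * h (rate i powr (- 1 / \<alpha>) * v)"
      using i by (cases "0 < v") (auto simp: hold_def)
  qed
  also have "\<dots> = ennreal (rate i) * (\<integral>\<^sup>+u. psi (rate i) u * h u \<partial>lborel)"
    by (rule nn_integral_psi_scale) (use rate_pos[OF i] in auto)
  finally show ?thesis .
qed

lemma hold_prob_atMost:
  assumes i: "1 \<le> i" and t: "0 \<le> t"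
  shows "hold_prob i {..t} = 1 - mittag_leffler \<alpha> (- rate i * t powr \<alpha>)"
proof (cases "t = 0")
  case True
  have "{v. hold i v \<le> 0} = {}" using hold_pos[of i] by (auto simp: not_le)
  moreover have "mittag_leffler \<alpha> 0 = 1"
    using powser_zero[of "\<lambda>k. 1 / Gamma (\<alpha> * real k + 1)"] by (simp add: mittag_leffler_def)
  ultimately show ?thesis using True order by (simp add: hold_prob_def)
next
  case False
  with t have t: "0 < t" by simp
  have "ennreal (hold_prob i {..t}) = ennreal (rate i) * (\<integral>\<^sup>+u. psi (rate i) u * indicator {..t} u \<partial>lborel)"
    by (subst emeasure_hold[symmetric]) (auto simp: nn_integral_hold[OF i])
  also have "\<dots> = ennreal (rate i * ml_kernel (\<alpha> + 1) (rate i) t)"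
    by (simp only: nn_integral_psi_atMost[OF rate_nonneg] ennreal_mult'[OF rate_nonneg])
  finally have "hold_prob i {..t} = rate i * ml_kernel (\<alpha> + 1) (rate i) t"
    using conv_psi(2)[OF rate_nonneg, of 1 i t] by (subst (asm) ennreal_inj) auto
  then show ?thesis using survival_eq[OF t, of "rate i"] ml_kernel_1[OF t, of "rate i"] by simp
qed

lemma nn_integral_hold_noise:
  assumes [measurable]: "B \<in> sets borel"
  shows "(\<integral>\<^sup>+w. indicator B (hold i (snd w)) \<partial>noise (Suc n)) = ennreal (hold_prob i B)"
  using nn_integral_noise[where h = "\<lambda>v. indicator B (hold i v)" and B = UNIV and n = n]
  by (simp add: emeasure_hold)

text \<open>Here G is any event of the past, expressed as invariance under overwriting coordinate
  \<open>Suc n\<close>. Resampling that coordinate gives the product form: given the present state,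
  direction and holding time are independent of G and of each other.\<close>

lemma step_event_prob:
  assumes G [measurable]: "Measurable.pred bd_measure G"
    and inv: "\<And>\<omega> w. G (fun_upd \<omega> (Suc n) w) = G \<omega>" and B [measurable]: "B \<in> sets borel"
  shows "measure bd_measure {\<omega>. G \<omega> \<and> chain n \<omega> = i \<and> chain (Suc n) \<omega> = j \<and> interarrival n \<omega> \<in> B} =
      measure bd_measure {\<omega>. G \<omega> \<and> chain n \<omega> = i} * (step_prob i j * hold_prob i B)"
    and "measure bd_measure {\<omega>. G \<omega> \<and> chain n \<omega> = i \<and> interarrival n \<omega> \<in> B} =
      measure bd_measure {\<omega>. G \<omega> \<and> chain n \<omega> = i} * hold_prob i B"
proof -
  have P: "(\<integral>\<^sup>+\<omega>. of_bool (G \<omega> \<and> chain n \<omega> = i) \<partial>bd_measure) =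
      ennreal (measure bd_measure {\<omega>. G \<omega> \<and> chain n \<omega> = i})"
    by (subst nn_integral_of_bool) (auto simp: bd.emeasure_eq_measure)
  have "ennreal (measure bd_measure {\<omega>. G \<omega> \<and> chain n \<omega> = i \<and> chain (Suc n) \<omega> = j \<and> interarrival n \<omega> \<in> B}) =
      (\<integral>\<^sup>+\<omega>. of_bool (G \<omega> \<and> chain n \<omega> = i \<and> chain (Suc n) \<omega> = j \<and> interarrival n \<omega> \<in> B) \<partial>bd_measure)"
    by (subst nn_integral_of_bool) (auto simp: bd.emeasure_eq_measure simp del: chain.simps)
  also have "\<dots> = (\<integral>\<^sup>+\<omega>. (\<lambda>\<omega> w. of_bool (G \<omega> \<and> chain n \<omega> = i) *
      (of_bool (step i (fst w) = j) * indicator B (hold i (snd w)))) \<omega> (\<omega> (Suc n)) \<partial>bd_measure)"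
    by (intro nn_integral_cong) (auto simp: interarrival_def indicator_def)
  also have "\<dots> = (\<integral>\<^sup>+\<omega>. (\<integral>\<^sup>+w. of_bool (G \<omega> \<and> chain n \<omega> = i) *
      (of_bool (step i (fst w) = j) * indicator B (hold i (snd w))) \<partial>noise (Suc n)) \<partial>bd_measure)"
    by (rule nn_integral_resample) (auto simp: inv)
  also have "\<dots> = (\<integral>\<^sup>+\<omega>. of_bool (G \<omega> \<and> chain n \<omega> = i) * ennreal (step_prob i j * hold_prob i B) \<partial>bd_measure)"
    by (subst nn_integral_cmult)
      (auto simp: nn_integral_step_hold[where h = "indicator B"] emeasure_hold ennreal_mult)
  also have "\<dots> = ennreal (measure bd_measure {\<omega>. G \<omega> \<and> chain n \<omega> = i} * (step_prob i j * hold_prob i B))"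
    by (subst nn_integral_multc) (auto simp: P ennreal_mult)
  finally show "measure bd_measure {\<omega>. G \<omega> \<and> chain n \<omega> = i \<and> chain (Suc n) \<omega> = j \<and> interarrival n \<omega> \<in> B} =
      measure bd_measure {\<omega>. G \<omega> \<and> chain n \<omega> = i} * (step_prob i j * hold_prob i B)"
    by (subst (asm) ennreal_inj) auto
  have "ennreal (measure bd_measure {\<omega>. G \<omega> \<and> chain n \<omega> = i \<and> interarrival n \<omega> \<in> B}) =
      (\<integral>\<^sup>+\<omega>. of_bool (G \<omega> \<and> chain n \<omega> = i \<and> interarrival n \<omega> \<in> B) \<partial>bd_measure)"
    by (subst nn_integral_of_bool) (auto simp: bd.emeasure_eq_measure)
  also have "\<dots> = (\<integral>\<^sup>+\<omega>. (\<lambda>\<omega> w. of_bool (G \<omega> \<and> chain n \<omega> = i) *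
      indicator B (hold i (snd w))) \<omega> (\<omega> (Suc n)) \<partial>bd_measure)"
    by (intro nn_integral_cong) (auto simp: interarrival_def indicator_def)
  also have "\<dots> = (\<integral>\<^sup>+\<omega>. (\<integral>\<^sup>+w. of_bool (G \<omega> \<and> chain n \<omega> = i) *
      indicator B (hold i (snd w)) \<partial>noise (Suc n)) \<partial>bd_measure)"
    by (rule nn_integral_resample) (auto simp: inv)
  also have "\<dots> = (\<integral>\<^sup>+\<omega>. of_bool (G \<omega> \<and> chain n \<omega> = i) * ennreal (hold_prob i B) \<partial>bd_measure)"
    by (subst nn_integral_cmult) (auto simp: nn_integral_hold_noise)
  also have "\<dots> = ennreal (measure bd_measure {\<omega>. G \<omega> \<and> chain n \<omega> = i} * hold_prob i B)"
    by (subst nn_integral_multc) (auto simp: P ennreal_mult)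
  finally show "measure bd_measure {\<omega>. G \<omega> \<and> chain n \<omega> = i \<and> interarrival n \<omega> \<in> B} =
      measure bd_measure {\<omega>. G \<omega> \<and> chain n \<omega> = i} * hold_prob i B"
    by (subst (asm) ennreal_inj) auto
qed

lemma jump_prob_chain:
  assumes "0 < measure bd_measure {\<omega>. chain n \<omega> = i}"
  shows "jump_prob bd_measure chain n i j = step_prob i j"
  using step_event_prob(1)[of "\<lambda>_. True" n UNIV i j] assms
  by (simp add: jump_prob_def cond_prob_def conj_commute del: chain.simps)

lemma renewal_kernel_chain:
  assumes "0 < measure bd_measure {\<omega>. chain n \<omega> = i}"
  shows "renewal_kernel bd_measure chain jump_time n i j t = step_prob i j * hold_prob i {..t}"
proof -
  have "{\<omega>. (chain (Suc n) \<omega> = j \<and> jump_time (Suc n) \<omega> - jump_time n \<omega> \<le> t) \<and> chain n \<omega> = i} =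
      {\<omega>. True \<and> chain n \<omega> = i \<and> chain (Suc n) \<omega> = j \<and> interarrival n \<omega> \<in> {..t}}"
    by (auto simp: jump_time_Suc simp del: chain.simps)
  then show ?thesis
    using step_event_prob(1)[of "\<lambda>_. True" n "{..t}" i j] assms
    by (simp add: renewal_kernel_def cond_prob_def del: chain.simps)
qed

text \<open>Kept general in F so that it applies both to the full history and to the
  \<sigma>-algebra of the present state. Both conditional expectations then equal the same function
  of \<open>chain n\<close>, which is the Markov renewal property.\<close>

lemma real_cond_exp_step:
  assumes sub: "subalgebra bd_measure F"
    and inv: "\<And>A \<omega> w. A \<in> sets F \<Longrightarrow> fun_upd \<omega> (Suc n) w \<in> A \<longleftrightarrow> \<omega> \<in> A"
    and chain_F: "chain n \<in> measurable F (count_space UNIV)"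
  shows "AE \<omega> in bd_measure. real_cond_exp bd_measure F
      (indicator {\<omega> \<in> space bd_measure. chain (Suc n) \<omega> = j \<and> jump_time (Suc n) \<omega> - jump_time n \<omega> \<le> t}) \<omega> =
    step_prob (chain n \<omega>) j * hold_prob (chain n \<omega>) {..t}"
proof -
  interpret finite_measure_subalgebra bd_measure F
    by unfold_locales (rule sub)
  define E where "E = {\<omega> \<in> space bd_measure. chain (Suc n) \<omega> = j \<and> jump_time (Suc n) \<omega> - jump_time n \<omega> \<le> t}"
  define g where "g i = step_prob i j * hold_prob i {..t}" for i
  have E_meas [measurable]: "E \<in> sets bd_measure" unfolding E_def by measurable
  have g_meas [measurable]: "(\<lambda>\<omega>. g (chain n \<omega>)) \<in> borel_measurable bd_measure"
    by (rule measurable_compose[OF measurable_chain]) simp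
  have g_nn: "0 \<le> g i" for i by (simp add: g_def)
  have g_le: "g i \<le> 1" for i
  proof -
    interpret H: prob_space holding_law by (rule prob_space_holding_law)
    have "step_prob i j * hold_prob i {..t} \<le> 1 * 1"
      unfolding step_prob_def hold_prob_def by (intro mult_mono measure_pmf.prob_le_1 H.prob_le_1) auto
    then show ?thesis by (simp add: g_def)
  qed
  have "AE \<omega> in bd_measure. real_cond_exp bd_measure F (indicator E) \<omega> = g (chain n \<omega>)"
  proof (rule real_cond_exp_charact)
    show "integrable bd_measure (indicator E :: _ \<Rightarrow> real)"
      by (simp add: bd.emeasure_eq_measure)
    show "integrable bd_measure (\<lambda>\<omega>. g (chain n \<omega>))"
      by (rule bd.integrable_const_bound[of _ 1]) (auto simp: g_nn g_le)
    show "(\<lambda>\<omega>. g (chain n \<omega>)) \<in> borel_measurable F"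
      by (rule measurable_compose[OF chain_F]) simp
    fix A assume A: "A \<in> sets F"
    then have A_meas [measurable]: "A \<in> sets bd_measure" using sub by (auto simp: subalgebra_def)
    have "(\<integral>\<^sup>+\<omega>. ennreal (indicator A \<omega> *\<^sub>R indicator E \<omega>) \<partial>bd_measure) =
        (\<integral>\<^sup>+\<omega>. (\<lambda>\<omega> w. indicator A \<omega> * (of_bool (step (chain n \<omega>) (fst w) = j) *
          indicator {..t} (hold (chain n \<omega>) (snd w)))) \<omega> (\<omega> (Suc n)) \<partial>bd_measure)"
      by (intro nn_integral_cong) (auto simp: indicator_def E_def jump_time_Suc interarrival_def)
    also have "\<dots> = (\<integral>\<^sup>+\<omega>. (\<integral>\<^sup>+w. indicator A \<omega> * (of_bool (step (chain n \<omega>) (fst w) = j) *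
          indicator {..t} (hold (chain n \<omega>) (snd w))) \<partial>noise (Suc n)) \<partial>bd_measure)"
      by (rule nn_integral_resample) (auto simp: inv[OF A] indicator_def)
    also have "\<dots> = (\<integral>\<^sup>+\<omega>. ennreal (indicator A \<omega> *\<^sub>R g (chain n \<omega>)) \<partial>bd_measure)"
    proof (rule nn_integral_cong)
      fix \<omega>
      have "(\<integral>\<^sup>+w. of_bool (step (chain n \<omega>) (fst w) = j) *
          indicator {..t} (hold (chain n \<omega>) (snd w)) \<partial>noise (Suc n)) = ennreal (g (chain n \<omega>))"
        by (simp add: nn_integral_step_hold[where h = "indicator {..t}"] emeasure_hold ennreal_mult g_def)
      then show "(\<integral>\<^sup>+w. indicator A \<omega> * (of_bool (step (chain n \<omega>) (fst w) = j) *
          indicator {..t} (hold (chain n \<omega>) (snd w))) \<partial>noise (Suc n)) = ennreal (indicator A \<omega> *\<^sub>R g (chain n \<omega>))"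
        by (subst nn_integral_cmult) (simp_all split: split_indicator)
    qed
    finally show "(\<integral>\<omega>\<in>A. indicator E \<omega> \<partial>bd_measure) = (\<integral>\<omega>\<in>A. g (chain n \<omega>) \<partial>bd_measure)"
      unfolding set_lebesgue_integral_def by (simp add: integral_eq_nn_integral g_nn)
  qed
  then show ?thesis by (simp add: E_def g_def)
qed

lemma markov_renewal_process_chain: "markov_renewal_process bd_measure chain jump_time"
proof -
  have "AE \<omega> in bd_measure. real_cond_exp bd_measure (history bd_measure chain jump_time n)
      (indicator {\<omega> \<in> space bd_measure. chain (Suc n) \<omega> = j \<and> jump_time (Suc n) \<omega> - jump_time n \<omega> \<le> t}) \<omega> =
    real_cond_exp bd_measure (vimage_algebra (space bd_measure) (chain n) (count_space UNIV))
      (indicator {\<omega> \<in> space bd_measure. chain (Suc n) \<omega> = j \<and> jump_time (Suc n) \<omega> - jump_time n \<omega> \<le> t}) \<omega>"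
    for n j t
  proof -
    define \<phi> where "\<phi> \<omega> = (\<lambda>l\<in>{..n}. (chain l \<omega>, jump_time l \<omega>))" for \<omega>
    define N where "N = (\<Pi>\<^sub>M l\<in>{..n}. (count_space UNIV \<Otimes>\<^sub>M borel :: (nat \<times> real) measure))"
    have hist: "history bd_measure chain jump_time n = vimage_algebra (space bd_measure) \<phi> N"
      by (simp add: history_def \<phi>_def[abs_def] N_def)
    have \<phi>: "\<phi> \<in> measurable bd_measure N"
      unfolding \<phi>_def N_def by (intro measurable_restrict) measurable
    have \<phi>_upd: "\<phi> (fun_upd \<omega> (Suc n) w) = \<phi> \<omega>" for \<omega> w
      by (auto simp: \<phi>_def fun_eq_iff)
    have "AE \<omega> in bd_measure. real_cond_exp bd_measure (vimage_algebra (space bd_measure) \<phi> N)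
        (indicator {\<omega> \<in> space bd_measure. chain (Suc n) \<omega> = j \<and> jump_time (Suc n) \<omega> - jump_time n \<omega> \<le> t}) \<omega> =
      step_prob (chain n \<omega>) j * hold_prob (chain n \<omega>) {..t}"
    proof (rule real_cond_exp_step)
      show "subalgebra bd_measure (vimage_algebra (space bd_measure) \<phi> N)"
        by (rule subalgebra_vimage_algebra[OF \<phi>])
      \<comment> \<open>Sets of the history are preimages under \<phi>, and \<phi> ignores
        coordinate \<open>Suc n\<close>.\<close>
      show "fun_upd \<omega> (Suc n) w \<in> A \<longleftrightarrow> \<omega> \<in> A" if "A \<in> sets (vimage_algebra (space bd_measure) \<phi> N)" for A \<omega> w
      proof -
        have "\<phi> \<in> space bd_measure \<rightarrow> space N" using measurable_space[OF \<phi>] by auto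
        from that[unfolded sets_vimage_algebra2[OF this]] show ?thesis by (auto simp: \<phi>_upd)
      qed
      have "\<phi> \<in> measurable (vimage_algebra (space bd_measure) \<phi> N) N"
        using measurable_space[OF \<phi>] by (intro measurable_vimage_algebra1) auto
      moreover have "(\<lambda>f. fst (f n)) \<in> measurable N (count_space UNIV)"
        unfolding N_def by measurable
      ultimately have "(\<lambda>\<omega>. fst (\<phi> \<omega> n)) \<in> measurable (vimage_algebra (space bd_measure) \<phi> N) (count_space UNIV)"
        by (rule measurable_compose)
      then show "chain n \<in> measurable (vimage_algebra (space bd_measure) \<phi> N) (count_space UNIV)"
        by (simp add: \<phi>_def[abs_def])
    qed
    moreover have "AE \<omega> in bd_measure. real_cond_exp bd_measure
        (vimage_algebra (space bd_measure) (chain n) (count_space UNIV))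
        (indicator {\<omega> \<in> space bd_measure. chain (Suc n) \<omega> = j \<and> jump_time (Suc n) \<omega> - jump_time n \<omega> \<le> t}) \<omega> =
      step_prob (chain n \<omega>) j * hold_prob (chain n \<omega>) {..t}"
    proof (rule real_cond_exp_step)
      show "subalgebra bd_measure (vimage_algebra (space bd_measure) (chain n) (count_space UNIV))"
        by (rule subalgebra_vimage_algebra[OF measurable_chain])
      show "fun_upd \<omega> (Suc n) w \<in> A \<longleftrightarrow> \<omega> \<in> A"
        if "A \<in> sets (vimage_algebra (space bd_measure) (chain n) (count_space UNIV))" for A \<omega> w
        using that by (auto simp: sets_vimage_algebra2)
      show "chain n \<in> measurable (vimage_algebra (space bd_measure) (chain n) (count_space UNIV)) (count_space UNIV)"
        by (rule measurable_vimage_algebra1) auto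
    qed
    ultimately show ?thesis unfolding hist by eventually_elim simp
  qed
  then show ?thesis
    unfolding markov_renewal_process_def
    using prob_space_bd_measure jump_time_strict_mono
    by (auto simp: renewal_kernel_chain simp del: chain.simps)
qed

section \<open>Conditional laws of the inter-arrival times\<close>

lemma path_prob:
  assumes [measurable]: "\<And>k. A k \<in> sets borel"
  shows "measure bd_measure {\<omega>. (\<forall>l\<le>n. chain l \<omega> = x l) \<and> (\<forall>k<n. interarrival k \<omega> \<in> A k)} =
    measure bd_measure {\<omega>. chain 0 \<omega> = x 0} * (\<Prod>k<n. step_prob (x k) (x (Suc k))) * (\<Prod>k<n. hold_prob (x k) (A k))"
proof (induction n)
  case 0
  then show ?case by simp
next
  case (Suc n)
  define G where "G \<omega> \<longleftrightarrow> (\<forall>l\<le>n. chain l \<omega> = x l) \<and> (\<forall>k<n. interarrival k \<omega> \<in> A k)" for \<omega>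
  have [measurable]: "Measurable.pred bd_measure G" unfolding G_def by measurable
  have "{\<omega>. (\<forall>l\<le>Suc n. chain l \<omega> = x l) \<and> (\<forall>k<Suc n. interarrival k \<omega> \<in> A k)} =
      {\<omega>. G \<omega> \<and> chain n \<omega> = x n \<and> chain (Suc n) \<omega> = x (Suc n) \<and> interarrival n \<omega> \<in> A n}"
    by (auto simp: G_def le_Suc_eq less_Suc_eq simp del: chain.simps)
  moreover have "{\<omega>. G \<omega> \<and> chain n \<omega> = x n} =
      {\<omega>. (\<forall>l\<le>n. chain l \<omega> = x l) \<and> (\<forall>k<n. interarrival k \<omega> \<in> A k)}"
    by (auto simp: G_def)
  ultimately show ?case
    using step_event_prob(1)[of G n "A n" "x n" "x (Suc n)"] Suc
    by (simp add: G_def del: chain.simps)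
qed

text \<open>The path has n jumps but n + 1 holding times. The last one starts in \<open>x n\<close>
  with its destination left open, hence the second part of \<open>step_event_prob\<close>; the step
  probabilities are absorbed into the probability of the path.\<close>

lemma path_prob_interarrivals:
  assumes A [measurable]: "\<And>k. A k \<in> sets borel"
  shows "measure bd_measure {\<omega>. (\<forall>l\<le>n. chain l \<omega> = x l) \<and> (\<forall>k\<le>n. interarrival k \<omega> \<in> A k)} =
    measure bd_measure {\<omega>. \<forall>l\<le>n. chain l \<omega> = x l} * (\<Prod>k\<le>n. hold_prob (x k) (A k))"
proof -
  define G where "G \<omega> \<longleftrightarrow> (\<forall>l\<le>n. chain l \<omega> = x l) \<and> (\<forall>k<n. interarrival k \<omega> \<in> A k)" for \<omega>
  have [measurable]: "Measurable.pred bd_measure G" unfolding G_def by measurable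
  have "{\<omega>. (\<forall>l\<le>n. chain l \<omega> = x l) \<and> (\<forall>k\<le>n. interarrival k \<omega> \<in> A k)} =
      {\<omega>. G \<omega> \<and> chain n \<omega> = x n \<and> interarrival n \<omega> \<in> A n}"
    by (auto simp: G_def le_less)
  moreover have "{\<omega>. G \<omega> \<and> chain n \<omega> = x n} =
      {\<omega>. (\<forall>l\<le>n. chain l \<omega> = x l) \<and> (\<forall>k<n. interarrival k \<omega> \<in> A k)}"
    by (auto simp: G_def)
  moreover have "measure bd_measure {\<omega>. \<forall>l\<le>n. chain l \<omega> = x l} =
      measure bd_measure {\<omega>. chain 0 \<omega> = x 0} * (\<Prod>k<n. step_prob (x k) (x (Suc k)))"
    using path_prob[of "\<lambda>_. UNIV" n x] by simp
  ultimately show ?thesis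
    using step_event_prob(2)[of G n "A n" "x n"] path_prob[of A n x, OF A]
    by (simp add: G_def lessThan_Suc_atMost[symmetric] del: chain.simps)
qed

lemma cond_independent_interarrivals_chain:
  "cond_independent_interarrivals bd_measure chain jump_time
    (\<lambda>i t. 1 - mittag_leffler \<alpha> (- (lam i + mu i) * t powr \<alpha>))"
  unfolding cond_independent_interarrivals_def
proof (intro allI impI conjI)
  fix n x
  define E where "E = {\<omega>. \<forall>l\<le>n. chain l \<omega> = x l}"
  assume "0 < \<P>(\<omega> in bd_measure. \<forall>l\<le>n. chain l \<omega> = x l)"
  then have E: "0 < measure bd_measure E" by (simp add: E_def)
  have E_meas [measurable]: "E \<in> sets bd_measure"
  proof -
    have "{\<omega> \<in> space bd_measure. \<forall>l\<le>n. chain l \<omega> = x l} \<in> sets bd_measure" by measurable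
    then show ?thesis by (simp add: E_def)
  qed
  have eE: "emeasure bd_measure E \<noteq> 0" "emeasure bd_measure E \<noteq> \<infinity>"
    using E by (auto simp: bd.emeasure_eq_measure)
  define U where "U = uniform_measure bd_measure E"
  interpret U: prob_space U unfolding U_def by (rule prob_space_uniform_measure[OF eE])
  have sets_U [measurable_cong]: "sets U = sets bd_measure" by (simp add: U_def)
  have space_U [simp]: "space U = UNIV" by (simp add: U_def)
  have joint: "measure U {\<omega>. \<forall>k\<le>n. interarrival k \<omega> \<in> A k} = (\<Prod>k\<le>n. hold_prob (x k) (A k))"
    if A [measurable]: "\<And>k. A k \<in> sets borel" for A
  proof -
    have "{\<omega> \<in> space bd_measure. \<forall>k\<le>n. interarrival k \<omega> \<in> A k} \<in> sets bd_measure" by measurable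
    then have "measure U {\<omega>. \<forall>k\<le>n. interarrival k \<omega> \<in> A k} =
        measure bd_measure (E \<inter> {\<omega>. \<forall>k\<le>n. interarrival k \<omega> \<in> A k}) / measure bd_measure E"
      unfolding U_def by (intro measure_uniform_measure eE) simp
    also have "E \<inter> {\<omega>. \<forall>k\<le>n. interarrival k \<omega> \<in> A k} =
        {\<omega>. (\<forall>l\<le>n. chain l \<omega> = x l) \<and> (\<forall>k\<le>n. interarrival k \<omega> \<in> A k)}"
      by (auto simp: E_def)
    finally show ?thesis
      using path_prob_interarrivals[of A n x, OF A] E by (simp add: E_def)
  qed
  have single: "measure U {\<omega>. interarrival k \<omega> \<in> B} = hold_prob (x k) B"
    if "k \<le> n" and [measurable]: "B \<in> sets borel" for k B
  proof -
    \<comment> \<open>The marginal law is the joint one with no restriction on the other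
      steps.\<close>
    have "{\<omega>. interarrival k \<omega> \<in> B} = {\<omega>. \<forall>l\<le>n. interarrival l \<omega> \<in> (if l = k then B else UNIV)}"
      using that by auto
    also have "measure U \<dots> = (\<Prod>l\<le>n. hold_prob (x l) (if l = k then B else UNIV))"
      by (rule joint) auto
    also have "\<dots> = (\<Prod>l\<le>n. if l = k then hold_prob (x l) B else 1)"
      by (intro prod.cong) auto
    also have "\<dots> = hold_prob (x k) B" using that by (simp add: prod.delta)
    finally show ?thesis .
  qed
  have diff: "jump_time (Suc k) \<omega> - jump_time k \<omega> = interarrival k \<omega>" for k \<omega>
    by (simp add: jump_time_Suc)
  have "U.indep_vars (\<lambda>_. borel) (\<lambda>k. interarrival k) {..n}"
  proof (subst U.indep_vars_finite[where E = "\<lambda>_. sets borel"])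
    show "\<forall>A\<in>{..n} \<rightarrow> sets borel. U.prob (\<Inter>j\<le>n. interarrival j -` A j \<inter> space U) =
        (\<Prod>j\<le>n. U.prob (interarrival j -` A j \<inter> space U))"
    proof
      fix A :: "nat \<Rightarrow> real set" assume A: "A \<in> {..n} \<rightarrow> sets borel"
      \<comment> \<open>The joint formula wants measurable sets for all indices, so the family is
        extended by \<open>UNIV\<close> beyond n.\<close>
      define A' where "A' k = (if k \<le> n then A k else UNIV)" for k
      have A' [measurable]: "A' k \<in> sets borel" for k using A by (auto simp: A'_def)
      have "(\<Inter>j\<le>n. interarrival j -` A j \<inter> space U) = {\<omega>. \<forall>k\<le>n. interarrival k \<omega> \<in> A' k}"
        by (auto simp: A'_def)
      then have "U.prob (\<Inter>j\<le>n. interarrival j -` A j \<inter> space U) = (\<Prod>k\<le>n. hold_prob (x k) (A' k))"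
        using joint[of A'] by simp
      also have "\<dots> = (\<Prod>j\<le>n. U.prob (interarrival j -` A j \<inter> space U))"
      proof (rule prod.cong)
        fix k assume k: "k \<in> {..n}"
        then have "A k \<in> sets borel" using A by auto
        with k show "hold_prob (x k) (A' k) = U.prob (interarrival k -` A k \<inter> space U)"
          using single[of k "A k"] by (auto simp: A'_def vimage_def)
      qed simp
      finally show "U.prob (\<Inter>j\<le>n. interarrival j -` A j \<inter> space U) =
        (\<Prod>j\<le>n. U.prob (interarrival j -` A j \<inter> space U))" .
    qed
    show "sets borel = sigma_sets (space borel) (sets borel :: real set set)"
      by (rule sets.sigma_sets_eq[symmetric])
    show "interarrival k \<in> measurable U borel" for k
      by (simp add: measurable_cong_sets[OF sets_U refl])
  qed (auto simp: sets.Int_stable)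
  then show "prob_space.indep_vars (uniform_measure bd_measure {\<omega> \<in> space bd_measure. \<forall>l\<le>n. chain l \<omega> = x l})
      (\<lambda>_. borel) (\<lambda>k \<omega>. jump_time (Suc k) \<omega> - jump_time k \<omega>) {..n}"
    by (simp add: diff U_def E_def)
  fix k t assume k: "k \<le> n" and t: "0 \<le> (t :: real)" and xk: "1 \<le> x k"
  have "\<P>(\<omega> in bd_measure. jump_time (Suc k) \<omega> - jump_time k \<omega> \<le> t \<bar> \<forall>l\<le>n. chain l \<omega> = x l) =
      measure U {\<omega>. interarrival k \<omega> \<in> {..t}}"
    unfolding U_def E_def using bd.measure_uniform_measure_eq_cond_prob[of "\<lambda>\<omega>. interarrival k \<omega> \<le> t" "\<lambda>\<omega>. \<forall>l\<le>n. chain l \<omega> = x l"]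
    by (simp add: diff)
  also have "\<dots> = 1 - mittag_leffler \<alpha> (- (lam (x k) + mu (x k)) * t powr \<alpha>)"
    using single[OF k, of "{..t}"] hold_prob_atMost[OF xk t] by simp
  finally show "\<P>(\<omega> in bd_measure. jump_time (Suc k) \<omega> - jump_time k \<omega> \<le> t \<bar> \<forall>l\<le>n. chain l \<omega> = x l) =
      1 - mittag_leffler \<alpha> (- (lam (x k) + mu (x k)) * t powr \<alpha>)" .
qed

section \<open>Path sums as probabilities of the renewal process\<close>

lemma chain_0_prob: "measure bd_measure {\<omega>. chain 0 \<omega> = i} = pmf \<nu> i"
proof -
  interpret H: prob_space holding_law by (rule prob_space_holding_law)
  have "distr bd_measure (noise 0) (\<lambda>\<omega>. \<omega> 0) = noise 0"
    unfolding bd_measure_def by (rule distr_PiM_component) (auto intro: prob_space_noise)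
  then have "emeasure (noise 0) ({i} \<times> UNIV) = emeasure (distr bd_measure (noise 0) (\<lambda>\<omega>. \<omega> 0)) ({i} \<times> UNIV)"
    by simp
  also have "\<dots> = emeasure bd_measure ((\<lambda>\<omega>. \<omega> 0) -` ({i} \<times> UNIV) \<inter> space bd_measure)"
  proof (rule emeasure_distr)
    show "(\<lambda>\<omega>. \<omega> 0) \<in> measurable bd_measure (noise 0)"
      unfolding bd_measure_def by (rule measurable_component_singleton) simp
    show "{i} \<times> UNIV \<in> sets (noise 0)" unfolding noise_def by (intro pair_measureI) auto
  qed
  also have "(\<lambda>\<omega>. \<omega> 0) -` ({i} \<times> UNIV) \<inter> space bd_measure = {\<omega>. chain 0 \<omega> = i}"
    by (auto simp: prod_eq_iff mem_Times_iff)
  also have "emeasure (noise 0) ({i} \<times> UNIV) = emeasure (measure_pmf \<nu>) {i} * emeasure holding_law UNIV"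
    unfolding noise_def by (subst H.emeasure_pair_measure_Times) auto
  also have "emeasure holding_law UNIV = 1" using H.emeasure_space_1 by simp
  finally have "ennreal (measure bd_measure {\<omega>. chain 0 \<omega> = i}) = ennreal (pmf \<nu> i)"
    by (simp add: bd.emeasure_eq_measure emeasure_pmf_single)
  then show ?thesis by (subst (asm) ennreal_inj) auto
qed

lemma measurable_psi_jump_time [measurable]:
  "(\<lambda>\<omega>. psi r (t - jump_time m \<omega>)) \<in> borel_measurable bd_measure"
  by (rule measurable_compose[OF _ measurable_psi]) measurable

text \<open>By Tonelli, a further convolution factor k can be attached behind the last
  \<open>psi\<close>. It is applied with k the \<open>psi\<close> of the next state, for one more
  jump, and with k = \<beta>, which turns the last \<open>psi\<close> into a survival
  function.\<close>

lemma nn_integral_kernel_conv: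
  assumes IH: "\<And>t. (\<integral>\<^sup>+\<omega>. of_bool (chain 0 \<omega> = i \<and> chain m \<omega> = l) * psi (rate l) (t - jump_time m \<omega>) \<partial>bd_measure)
      = ennreal (pmf \<nu> i) * jump_kernel m i l t"
    and [measurable]: "k \<in> borel_measurable borel"
  shows "(\<integral>\<^sup>+\<omega>. of_bool (chain 0 \<omega> = i \<and> chain m \<omega> = l) * conv (psi (rate l)) k (t - jump_time m \<omega>) \<partial>bd_measure)
      = ennreal (pmf \<nu> i) * conv (jump_kernel m i l) k t"
proof -
  interpret pair_sigma_finite lborel bd_measure ..
  have meas: "case_prod (\<lambda>u \<omega>. of_bool (chain 0 \<omega> = i \<and> chain m \<omega> = l) * (psi (rate l) (t - jump_time m \<omega> - u) * k u))
      \<in> borel_measurable (lborel \<Otimes>\<^sub>M bd_measure)"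
    unfolding case_prod_beta'
    by (intro borel_measurable_times_ennreal measurable_compose[OF _ measurable_psi]) (measurable; simp)+
  have "(\<integral>\<^sup>+\<omega>. of_bool (chain 0 \<omega> = i \<and> chain m \<omega> = l) * conv (psi (rate l)) k (t - jump_time m \<omega>) \<partial>bd_measure) =
      (\<integral>\<^sup>+\<omega>. (\<integral>\<^sup>+u. of_bool (chain 0 \<omega> = i \<and> chain m \<omega> = l) *
        (psi (rate l) (t - jump_time m \<omega> - u) * k u) \<partial>lborel) \<partial>bd_measure)"
    unfolding conv_def by (intro nn_integral_cong nn_integral_cmult[symmetric]) measurable
  also have "\<dots> = (\<integral>\<^sup>+u. (\<integral>\<^sup>+\<omega>. of_bool (chain 0 \<omega> = i \<and> chain m \<omega> = l) *
        (psi (rate l) (t - jump_time m \<omega> - u) * k u) \<partial>bd_measure) \<partial>lborel)"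
    by (rule Fubini'[OF meas])
  also have "\<dots> = (\<integral>\<^sup>+u. ennreal (pmf \<nu> i) * (jump_kernel m i l (t - u) * k u) \<partial>lborel)"
  proof (rule nn_integral_cong)
    fix u
    have "(\<integral>\<^sup>+\<omega>. of_bool (chain 0 \<omega> = i \<and> chain m \<omega> = l) *
        (psi (rate l) (t - jump_time m \<omega> - u) * k u) \<partial>bd_measure) =
      (\<integral>\<^sup>+\<omega>. (of_bool (chain 0 \<omega> = i \<and> chain m \<omega> = l) *
        psi (rate l) (t - u - jump_time m \<omega>)) * k u \<partial>bd_measure)"
      by (simp add: algebra_simps)
    also have "\<dots> = ennreal (pmf \<nu> i) * jump_kernel m i l (t - u) * k u"
      by (subst nn_integral_multc) (auto simp: IH simp del: chain.simps)
    finally show "(\<integral>\<^sup>+\<omega>. of_bool (chain 0 \<omega> = i \<and> chain m \<omega> = l) *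
        (psi (rate l) (t - jump_time m \<omega> - u) * k u) \<partial>bd_measure) =
      ennreal (pmf \<nu> i) * (jump_kernel m i l (t - u) * k u)"
      by (simp add: mult.assoc)
  qed
  also have "\<dots> = ennreal (pmf \<nu> i) * conv (jump_kernel m i l) k t"
    unfolding conv_def by (subst nn_integral_cmult) auto
  finally show ?thesis .
qed

text \<open>The rate factor of the holding density cancels the denominator of the jump probability,
  leaving the bare jump rate. The restriction \<open>j \<ge> 1\<close> excludes the steps from 0 to
  itself.\<close>

lemma nn_integral_step_psi:
  assumes j: "1 \<le> j"
  shows "(\<integral>\<^sup>+w. of_bool (step l (fst w) = j) * psi (rate j) (s - hold l (snd w)) \<partial>noise (Suc n)) =
    (of_bool (l = j - 1) * ennreal (lam (j - 1)) + of_bool (l = j + 1) * ennreal (mu (j + 1))) *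
      conv (psi (rate l)) (psi (rate j)) s"
proof -
  have [measurable]: "(\<lambda>x. psi (rate j) (s - x)) \<in> borel_measurable borel"
    by (rule measurable_compose[OF _ measurable_psi]) measurable
  have "(\<integral>\<^sup>+w. of_bool (step l (fst w) = j) * psi (rate j) (s - hold l (snd w)) \<partial>noise (Suc n)) =
      ennreal (step_prob l j) * (\<integral>\<^sup>+v. psi (rate j) (s - hold l v) \<partial>holding_law)"
    by (rule nn_integral_step_hold[where h = "\<lambda>x. psi (rate j) (s - x)"]) measurable
  also have "\<dots> = (of_bool (l = j - 1) * ennreal (lam (j - 1)) + of_bool (l = j + 1) * ennreal (mu (j + 1))) *
      conv (psi (rate l)) (psi (rate j)) s"
  proof (cases "l = 0")
    case True
    then show ?thesis using j by (auto simp: step_prob_0)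
  next
    case False
    then have l: "1 \<le> l" by simp
    have "(\<integral>\<^sup>+v. psi (rate j) (s - hold l v) \<partial>holding_law) =
        ennreal (rate l) * (\<integral>\<^sup>+u. psi (rate l) u * psi (rate j) (s - u) \<partial>lborel)"
      by (rule nn_integral_hold[OF l, where h = "\<lambda>x. psi (rate j) (s - x)"]) measurable
    also have "(\<integral>\<^sup>+u. psi (rate l) u * psi (rate j) (s - u) \<partial>lborel) = conv (psi (rate j)) (psi (rate l)) s"
      unfolding conv_def by (simp add: mult.commute)
    also have "conv (psi (rate j)) (psi (rate l)) = conv (psi (rate l)) (psi (rate j))"
      by (rule conv_commute) auto
    finally have "ennreal (step_prob l j) * (\<integral>\<^sup>+v. psi (rate j) (s - hold l v) \<partial>holding_law) =
        ennreal (step_prob l j * rate l) * conv (psi (rate l)) (psi (rate j)) s"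
      by (simp only: ennreal_mult[OF step_prob_nonneg rate_nonneg] mult.assoc)
    also have "step_prob l j * rate l = of_bool (j = l + 1) * lam l + of_bool (l = j + 1) * mu l"
      using rate_pos[OF l] by (simp add: step_prob_pos[OF l])
    also have "ennreal \<dots> = of_bool (l = j - 1) * ennreal (lam (j - 1)) + of_bool (l = j + 1) * ennreal (mu (j + 1))"
      using j by auto
    finally show ?thesis .
  qed
  finally show ?thesis .
qed

text \<open>Induction along the last jump: coordinate \<open>Suc m\<close> is resampled, and the
  outcome is matched with the forward recursion of the path sums.\<close>

lemma nn_integral_kernel:
  "1 \<le> j \<Longrightarrow> (\<integral>\<^sup>+\<omega>. of_bool (chain 0 \<omega> = i \<and> chain m \<omega> = j) * psi (rate j) (t - jump_time m \<omega>) \<partial>bd_measure)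
      = ennreal (pmf \<nu> i) * jump_kernel m i j t"
proof (induction m arbitrary: j t)
  case 0
  have "(\<integral>\<^sup>+\<omega>. of_bool (chain 0 \<omega> = i) \<partial>bd_measure) = ennreal (pmf \<nu> i)"
    by (subst nn_integral_of_bool) (auto simp: bd.emeasure_eq_measure chain_0_prob simp del: chain.simps)
  moreover have "(\<integral>\<^sup>+\<omega>. of_bool (chain 0 \<omega> = i \<and> chain 0 \<omega> = j) * psi (rate j) (t - jump_time 0 \<omega>) \<partial>bd_measure) =
      (\<integral>\<^sup>+\<omega>. of_bool (chain 0 \<omega> = i) * (of_bool (i = j) * psi (rate j) t) \<partial>bd_measure)"
    by (intro nn_integral_cong) auto
  ultimately show ?case
    by (simp only: nn_integral_multc[OF measurable_compose[OF measurable_chain]] jump_kernel.simps)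
      (subst nn_integral_multc, auto simp del: chain.simps)
next
  case (Suc m)
  define c where "c l = of_bool (l = j - 1) * ennreal (lam (j - 1)) + of_bool (l = j + 1) * ennreal (mu (j + 1))" for l
  \<comment> \<open>The induction hypothesis covers only \<open>l \<ge> 1\<close>; the predecessor
    \<open>j - 1 = 0\<close> enters with the factor \<open>lam 0 = 0\<close>.\<close>
  have IH: "ennreal a * (\<integral>\<^sup>+\<omega>. of_bool (chain 0 \<omega> = i \<and> chain m \<omega> = l) *
      conv (psi (rate l)) (psi (rate j)) (t - jump_time m \<omega>) \<partial>bd_measure) =
    ennreal a * (ennreal (pmf \<nu> i) * conv (jump_kernel m i l) (psi (rate j)) t)"
    if "l = 0 \<longrightarrow> a = 0" for a l
    using that by (cases "l = 0") (auto simp: nn_integral_kernel_conv[OF Suc.IH] simp del: chain.simps)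
  have meas_conv [measurable]: "(\<lambda>\<omega>. conv (psi (rate l)) (psi (rate j)) (t - jump_time m \<omega>)) \<in> borel_measurable bd_measure" for l
    by (rule measurable_compose[of _ _ borel]) measurable
  have "(\<integral>\<^sup>+\<omega>. of_bool (chain 0 \<omega> = i \<and> chain (Suc m) \<omega> = j) * psi (rate j) (t - jump_time (Suc m) \<omega>) \<partial>bd_measure) =
    (\<integral>\<^sup>+\<omega>. (\<lambda>\<omega> w. of_bool (chain 0 \<omega> = i) * (of_bool (step (chain m \<omega>) (fst w) = j) *
      psi (rate j) (t - jump_time m \<omega> - hold (chain m \<omega>) (snd w)))) \<omega> (\<omega> (Suc m)) \<partial>bd_measure)"
    by (intro nn_integral_cong) (auto simp: jump_time_Suc interarrival_def algebra_simps)
  also have "\<dots> = (\<integral>\<^sup>+\<omega>. (\<integral>\<^sup>+w. of_bool (chain 0 \<omega> = i) * (of_bool (step (chain m \<omega>) (fst w) = j) *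
      psi (rate j) (t - jump_time m \<omega> - hold (chain m \<omega>) (snd w))) \<partial>noise (Suc m)) \<partial>bd_measure)"
  proof (rule nn_integral_resample)
    show "(\<lambda>p. of_bool (chain 0 (fst p) = i) * (of_bool (step (chain m (fst p)) (fst (snd p)) = j) *
      psi (rate j) (t - jump_time m (fst p) - hold (chain m (fst p)) (snd (snd p)))))
      \<in> borel_measurable (bd_measure \<Otimes>\<^sub>M noise (Suc m))"
      by (intro borel_measurable_times_ennreal measurable_compose[OF _ measurable_psi]) measurable
  qed auto
  also have "\<dots> = (\<integral>\<^sup>+\<omega>. of_bool (chain 0 \<omega> = i) * (c (chain m \<omega>) *
      conv (psi (rate (chain m \<omega>))) (psi (rate j)) (t - jump_time m \<omega>)) \<partial>bd_measure)"
  proof (rule nn_integral_cong)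
    fix \<omega>
    have "(\<lambda>w. of_bool (step (chain m \<omega>) (fst w) = j) *
      psi (rate j) (t - jump_time m \<omega> - hold (chain m \<omega>) (snd w))) \<in> borel_measurable (noise (Suc m))"
      by (intro borel_measurable_times_ennreal measurable_compose[OF _ measurable_psi]) measurable
    then show "(\<integral>\<^sup>+w. of_bool (chain 0 \<omega> = i) * (of_bool (step (chain m \<omega>) (fst w) = j) *
      psi (rate j) (t - jump_time m \<omega> - hold (chain m \<omega>) (snd w))) \<partial>noise (Suc m)) =
      of_bool (chain 0 \<omega> = i) * (c (chain m \<omega>) *
        conv (psi (rate (chain m \<omega>))) (psi (rate j)) (t - jump_time m \<omega>))"
      by (subst nn_integral_cmult) (auto simp: nn_integral_step_psi[OF Suc.prems] c_def simp del: chain.simps)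
  qed
  also have "\<dots> = (\<integral>\<^sup>+\<omega>.
      ennreal (lam (j - 1)) * (of_bool (chain 0 \<omega> = i \<and> chain m \<omega> = j - 1) *
        conv (psi (rate (j - 1))) (psi (rate j)) (t - jump_time m \<omega>)) +
      ennreal (mu (j + 1)) * (of_bool (chain 0 \<omega> = i \<and> chain m \<omega> = j + 1) *
        conv (psi (rate (j + 1))) (psi (rate j)) (t - jump_time m \<omega>)) \<partial>bd_measure)"
    by (intro nn_integral_cong) (auto simp: c_def simp del: chain.simps)
  also have "\<dots> = ennreal (lam (j - 1)) * (ennreal (pmf \<nu> i) * conv (jump_kernel m i (j - 1)) (psi (rate j)) t) +
      ennreal (mu (j + 1)) * (ennreal (pmf \<nu> i) * conv (jump_kernel m i (j + 1)) (psi (rate j)) t)"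
    by (subst nn_integral_add, measurable, subst (1 2) nn_integral_cmult, measurable, subst (1 2) IH) auto
  also have "\<dots> = ennreal (pmf \<nu> i) * jump_kernel (Suc m) i j t"
    unfolding jump_kernel_forward
    by (simp add: conv_add_left conv_cmult_left algebra_simps del: jump_kernel.simps)
  finally show ?case .
qed

text \<open>The last holding time has no atoms. The fact is needed because at time 0 the survival
  kernel has value 0 while the true survival probability is 1, so the event of a jump exactly at t
  must be null.\<close>

lemma AE_jump_time_neq:
  assumes t: "0 < t"
  shows "AE \<omega> in bd_measure. jump_time m \<omega> \<noteq> t"
proof (cases m)
  case 0
  then show ?thesis using t by simp
next
  case (Suc n)
  have hold_null: "hold_prob i {s} = 0" for i s
  proof -
    define c where "c = (if i = 0 then 1 else rate i powr (- 1 / \<alpha>))"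
    have c: "0 < c" using rate_pos[of i] by (auto simp: c_def)
    have "ennreal (hold_prob i {s}) = (\<integral>\<^sup>+v. psi 1 v * indicator {s} (hold i v) \<partial>lborel)"
      unfolding emeasure_hold[symmetric, of "{s}", simplified] holding_law_def
      by (subst nn_integral_density) auto
    also have "\<dots> = (\<integral>\<^sup>+v. 0 \<partial>(lborel :: real measure))"
    proof (rule nn_integral_cong_AE)
      \<comment> \<open>For \<open>v > 0\<close> the map \<open>hold i\<close> is multiplication by
        c, so only \<open>v = s / c\<close> can produce s; elsewhere the density vanishes.\<close>
      have "AE v in lborel. v \<noteq> s / c" by (rule AE_lborel_singleton)
      then show "AE v in lborel. psi 1 v * indicator {s} (hold i v) = 0"
      proof eventually_elim
        case (elim v)
        then show ?case using c by (cases "0 < v") (auto simp: hold_def c_def[symmetric] indicator_def)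
      qed
    qed
    finally show ?thesis by simp
  qed
  have "emeasure bd_measure {\<omega> \<in> space bd_measure. jump_time (Suc n) \<omega> = t} =
      (\<integral>\<^sup>+\<omega>. of_bool (jump_time (Suc n) \<omega> = t) \<partial>bd_measure)"
    by (rule nn_integral_of_bool[symmetric]) measurable
  also have "\<dots> = (\<integral>\<^sup>+\<omega>. (\<lambda>\<omega> w. indicator {t - jump_time n \<omega>} (hold (chain n \<omega>) (snd w))) \<omega> (\<omega> (Suc n)) \<partial>bd_measure)"
    by (intro nn_integral_cong) (auto simp: jump_time_Suc interarrival_def indicator_def)
  also have "\<dots> = (\<integral>\<^sup>+\<omega>. (\<integral>\<^sup>+w. indicator {t - jump_time n \<omega>} (hold (chain n \<omega>) (snd w)) \<partial>noise (Suc n)) \<partial>bd_measure)"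
  proof (rule nn_integral_resample)
    have "(\<lambda>p. of_bool (hold (chain n (fst p)) (snd (snd p)) = t - jump_time n (fst p)) :: ennreal)
        \<in> borel_measurable (bd_measure \<Otimes>\<^sub>M noise (Suc n))" by measurable
    then show "(\<lambda>p. indicator {t - jump_time n (fst p)} (hold (chain n (fst p)) (snd (snd p))) :: ennreal)
        \<in> borel_measurable (bd_measure \<Otimes>\<^sub>M noise (Suc n))"
      by (simp add: indicator_def of_bool_def cong: if_cong)
  qed auto
  also have "\<dots> = 0" by (simp add: nn_integral_hold_noise hold_null)
  finally have null: "emeasure bd_measure {\<omega> \<in> space bd_measure. jump_time (Suc n) \<omega> = t} = 0" .
  have N: "{\<omega> \<in> space bd_measure. jump_time (Suc n) \<omega> = t} \<in> sets bd_measure" by measurable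
  show ?thesis
    using null AE_iff_measurable[OF N, of "\<lambda>\<omega>. jump_time (Suc n) \<omega> \<noteq> t"] Suc by simp
qed

text \<open>Given the m-th jump time, the next holding time must exceed the remaining time; its
  survival function is \<beta> convolved with \<open>psi (rate j)\<close>, so \<beta> takes the role
  of the additional convolution factor.\<close>

lemma interval_prob:
  assumes j: "1 \<le> j" and t: "0 < t"
  shows "emeasure bd_measure {\<omega>. chain 0 \<omega> = i \<and> chain m \<omega> = j \<and> jump_time m \<omega> \<le> t \<and> t < jump_time (Suc m) \<omega>} =
    ennreal (pmf \<nu> i) * conv (ek (1 - \<alpha>)) (jump_kernel m i j) t"
proof -
  interpret H: prob_space holding_law by (rule prob_space_holding_law)
  have tail: "hold_prob j {s<..} = ml_kernel 1 (rate j) s" if s: "0 < s" for s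
  proof -
    have "{v. hold j v \<in> {s<..}} = space holding_law - {v. hold j v \<in> {..s}}" by auto
    moreover have "{v. hold j v \<in> {..s}} \<in> sets holding_law"
      using measurable_sets[OF measurable_hold[of j], of "{..s}"] by (simp add: vimage_def)
    ultimately have "hold_prob j {s<..} = 1 - hold_prob j {..s}"
      unfolding hold_prob_def by (simp only: H.prob_compl)
    then show ?thesis using hold_prob_atMost[OF j less_imp_le[OF s]] ml_kernel_1[OF s, of "rate j"] by simp
  qed
  have tail': "hold_prob j {s<..} = 1" if "s < 0" for s
  proof -
    have "{v. hold j v \<in> {s<..}} = UNIV" using hold_pos[of j] that by (auto intro: less_trans)
    then show ?thesis using hold_prob_UNIV[of j] by (simp add: hold_prob_def)
  qed
  have "emeasure bd_measure {\<omega>. chain 0 \<omega> = i \<and> chain m \<omega> = j \<and> jump_time m \<omega> \<le> t \<and> t < jump_time (Suc m) \<omega>} =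
    (\<integral>\<^sup>+\<omega>. of_bool (chain 0 \<omega> = i \<and> chain m \<omega> = j \<and> jump_time m \<omega> \<le> t \<and> t < jump_time (Suc m) \<omega>) \<partial>bd_measure)"
    by (subst nn_integral_of_bool) auto
  also have "\<dots> = (\<integral>\<^sup>+\<omega>. (\<lambda>\<omega> w. of_bool (chain 0 \<omega> = i \<and> chain m \<omega> = j \<and> jump_time m \<omega> \<le> t) *
      indicator {t - jump_time m \<omega><..} (hold j (snd w))) \<omega> (\<omega> (Suc m)) \<partial>bd_measure)"
    by (intro nn_integral_cong) (auto simp: jump_time_Suc interarrival_def indicator_def simp del: chain.simps)
  also have "\<dots> = (\<integral>\<^sup>+\<omega>. (\<integral>\<^sup>+w. of_bool (chain 0 \<omega> = i \<and> chain m \<omega> = j \<and> jump_time m \<omega> \<le> t) *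
      indicator {t - jump_time m \<omega><..} (hold j (snd w)) \<partial>noise (Suc m)) \<partial>bd_measure)"
  proof (rule nn_integral_resample)
    have "(\<lambda>p. of_bool (chain 0 (fst p) = i \<and> chain m (fst p) = j \<and> jump_time m (fst p) \<le> t \<and>
        t - jump_time m (fst p) < hold j (snd (snd p))) :: ennreal)
        \<in> borel_measurable (bd_measure \<Otimes>\<^sub>M noise (Suc m))" by measurable
    moreover have "(of_bool (chain 0 (fst p) = i \<and> chain m (fst p) = j \<and> jump_time m (fst p) \<le> t) *
        indicator {t - jump_time m (fst p)<..} (hold j (snd (snd p))) :: ennreal) =
      of_bool (chain 0 (fst p) = i \<and> chain m (fst p) = j \<and> jump_time m (fst p) \<le> t \<and>
        t - jump_time m (fst p) < hold j (snd (snd p)))" for p :: "(nat \<Rightarrow> nat \<times> real) \<times> nat \<times> real"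
      by (auto simp: indicator_def simp del: chain.simps)
    ultimately show "(\<lambda>p. of_bool (chain 0 (fst p) = i \<and> chain m (fst p) = j \<and> jump_time m (fst p) \<le> t) *
        indicator {t - jump_time m (fst p)<..} (hold j (snd (snd p))) :: ennreal)
        \<in> borel_measurable (bd_measure \<Otimes>\<^sub>M noise (Suc m))"
      by (simp only:)
  qed auto
  also have "\<dots> = (\<integral>\<^sup>+\<omega>. of_bool (chain 0 \<omega> = i \<and> chain m \<omega> = j) *
      conv (psi (rate j)) (ek (1 - \<alpha>)) (t - jump_time m \<omega>) \<partial>bd_measure)"
  proof (rule nn_integral_cong_AE)
    show "AE \<omega> in bd_measure. (\<integral>\<^sup>+w. of_bool (chain 0 \<omega> = i \<and> chain m \<omega> = j \<and> jump_time m \<omega> \<le> t) *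
        indicator {t - jump_time m \<omega><..} (hold j (snd w)) \<partial>noise (Suc m)) =
      of_bool (chain 0 \<omega> = i \<and> chain m \<omega> = j) * conv (psi (rate j)) (ek (1 - \<alpha>)) (t - jump_time m \<omega>)"
      using AE_jump_time_neq[OF t, of m]
    proof eventually_elim
      case (elim \<omega>)
      have "conv (psi (rate j)) (ek (1 - \<alpha>)) (t - jump_time m \<omega>) = ennreal (ml_kernel 1 (rate j) (t - jump_time m \<omega>))"
        using conv_psi_survival(1)[OF rate_nonneg, of j] by (subst conv_commute) auto
      moreover have "(\<integral>\<^sup>+w. of_bool (chain 0 \<omega> = i \<and> chain m \<omega> = j \<and> jump_time m \<omega> \<le> t) *
        indicator {t - jump_time m \<omega><..} (hold j (snd w)) \<partial>noise (Suc m)) =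
        of_bool (chain 0 \<omega> = i \<and> chain m \<omega> = j \<and> jump_time m \<omega> \<le> t) * ennreal (hold_prob j {t - jump_time m \<omega><..})"
        by (subst nn_integral_cmult) (auto simp: nn_integral_hold_noise)
      ultimately show ?case using elim
        by (cases "jump_time m \<omega> < t") (auto simp: tail simp del: chain.simps)
    qed
  qed
  also have "\<dots> = ennreal (pmf \<nu> i) * conv (jump_kernel m i j) (ek (1 - \<alpha>)) t"
    by (rule nn_integral_kernel_conv) (use nn_integral_kernel[OF j] in auto)
  also have "conv (jump_kernel m i j) (ek (1 - \<alpha>)) = conv (ek (1 - \<alpha>)) (jump_kernel m i j)"
    by (rule conv_commute) auto
  finally show ?thesis .
qed

section \<open>The law of the path process\<close>

lemma jump_time_mono: "a \<le> b \<Longrightarrow> jump_time a \<omega> \<le> jump_time b \<omega>"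
  unfolding jump_time_def
  by (intro sum_mono2) (auto simp: interarrival_def intro: less_imp_le[OF hold_pos])

lemma renewal_path_eq:
  assumes "jump_time m \<omega> \<le> t" "t < jump_time (Suc m) \<omega>"
  shows "renewal_path chain jump_time t \<omega> = chain m \<omega>"
proof -
  have "chain n \<omega> * indicator {jump_time n \<omega>..<jump_time (Suc n) \<omega>} t = (0 :: nat)" if "n \<noteq> m" for n
  proof (cases "n < m")
    case True
    then have "jump_time (Suc n) \<omega> \<le> jump_time m \<omega>" by (intro jump_time_mono) simp
    then show ?thesis using assms by simp
  next
    case False
    then have "jump_time (Suc m) \<omega> \<le> jump_time n \<omega>" using that by (intro jump_time_mono) simp
    then show ?thesis using assms by simp
  qed
  then have "renewal_path chain jump_time t \<omega> =
      (\<Sum>n\<in>{m}. chain n \<omega> * indicator {jump_time n \<omega>..<jump_time (Suc n) \<omega>} t)"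
    unfolding renewal_path_def by (intro suminf_finite) auto
  then show ?thesis using assms by simp
qed

lemma renewal_path_0: "renewal_path chain jump_time 0 \<omega> = chain 0 \<omega>"
  using jump_time_strict_mono[of 0 \<omega>] by (intro renewal_path_eq) auto

text \<open>Only for \<open>j \<ge> 1\<close>: the value 0 is also taken beyond the supremum of the
  jump times, where no index m exists.\<close>

lemma renewal_path_iff:
  assumes "1 \<le> j"
  shows "renewal_path chain jump_time t \<omega> = j \<longleftrightarrow>
    (\<exists>m. chain m \<omega> = j \<and> jump_time m \<omega> \<le> t \<and> t < jump_time (Suc m) \<omega>)"
proof (cases "\<exists>m. jump_time m \<omega> \<le> t \<and> t < jump_time (Suc m) \<omega>")
  case True
  then obtain m where m: "jump_time m \<omega> \<le> t" "t < jump_time (Suc m) \<omega>" by blast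
  show ?thesis
  proof
    assume "renewal_path chain jump_time t \<omega> = j"
    then show "\<exists>m. chain m \<omega> = j \<and> jump_time m \<omega> \<le> t \<and> t < jump_time (Suc m) \<omega>"
      using m renewal_path_eq[OF m] by (intro exI[of _ m]) simp
  next
    assume "\<exists>m. chain m \<omega> = j \<and> jump_time m \<omega> \<le> t \<and> t < jump_time (Suc m) \<omega>"
    then obtain k where k: "chain k \<omega> = j" "jump_time k \<omega> \<le> t" "t < jump_time (Suc k) \<omega>" by blast
    then show "renewal_path chain jump_time t \<omega> = j" using renewal_path_eq[OF k(2,3)] by simp
  qed
next
  case False
  then have zero: "chain n \<omega> * indicator {jump_time n \<omega>..<jump_time (Suc n) \<omega>} t = 0" for n
    by (auto simp: indicator_def)
  have "renewal_path chain jump_time t \<omega> = 0"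
    unfolding renewal_path_def by (simp only: zero suminf_zero)
  then show ?thesis using False assms by auto
qed

lemma measurable_renewal_path [measurable]:
  "renewal_path chain jump_time t \<in> measurable bd_measure (count_space UNIV)"
proof -
  have pos: "{\<omega>. renewal_path chain jump_time t \<omega> = j} \<in> sets bd_measure" if "1 \<le> j" for j
  proof -
    have "{\<omega> \<in> space bd_measure. \<exists>m. chain m \<omega> = j \<and> jump_time m \<omega> \<le> t \<and> t < jump_time (Suc m) \<omega>} \<in> sets bd_measure"
      by measurable
    then show ?thesis by (simp add: renewal_path_iff[OF that])
  qed
  have "{\<omega>. renewal_path chain jump_time t \<omega> = 0} =
      space bd_measure - (\<Union>j\<in>{1..}. {\<omega>. renewal_path chain jump_time t \<omega> = j})"
    by auto
  also have "\<dots> \<in> sets bd_measure"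
    by (rule sets.Diff[OF sets.top], rule sets.countable_UN') (auto intro: pos)
  finally have "{\<omega>. renewal_path chain jump_time t \<omega> = j} \<in> sets bd_measure" for j
    using pos[of j] by (cases "j = 0") auto
  then show ?thesis
    by (subst measurable_count_space_eq2_countable) (auto simp: vimage_def)
qed

text \<open>The number m of jumps up to time t is unique, so the events with fixed m are disjoint
  and their probabilities sum to \<beta> convolved with the full kernel.\<close>

lemma renewal_path_prob:
  assumes j: "1 \<le> j" and t: "0 < t"
  shows "measure bd_measure {\<omega>. renewal_path chain jump_time t \<omega> = j \<and> renewal_path chain jump_time 0 \<omega> = i} =
    pmf \<nu> i * bd_prob i j t"
proof -
  define A where "A m = {\<omega>. chain 0 \<omega> = i \<and> chain m \<omega> = j \<and> jump_time m \<omega> \<le> t \<and> t < jump_time (Suc m) \<omega>}" for m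
  have A [measurable]: "A m \<in> sets bd_measure" for m
  proof -
    have "{\<omega> \<in> space bd_measure. chain 0 \<omega> = i \<and> chain m \<omega> = j \<and> jump_time m \<omega> \<le> t \<and> t < jump_time (Suc m) \<omega>} \<in> sets bd_measure"
      by measurable
    then show ?thesis by (simp add: A_def)
  qed
  have "disjoint_family A"
    unfolding disjoint_family_on_def
  proof safe
    fix m n \<omega> assume mn: "\<omega> \<in> A m" "\<omega> \<in> A n" "m \<noteq> n"
    have "jump_time (Suc m) \<omega> \<le> jump_time n \<omega> \<or> jump_time (Suc n) \<omega> \<le> jump_time m \<omega>"
      using mn(3) jump_time_mono[of "Suc m" n \<omega>] jump_time_mono[of "Suc n" m \<omega>] by linarith
    then show "\<omega> \<in> {}" using mn(1,2) unfolding A_def by auto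
  qed
  have "{\<omega>. renewal_path chain jump_time t \<omega> = j \<and> renewal_path chain jump_time 0 \<omega> = i} = (\<Union>m. A m)"
    by (auto simp: A_def renewal_path_iff[OF j] renewal_path_0 simp del: chain.simps)
  then have "emeasure bd_measure {\<omega>. renewal_path chain jump_time t \<omega> = j \<and> renewal_path chain jump_time 0 \<omega> = i} =
      (\<Sum>m. emeasure bd_measure (A m))"
    using \<open>disjoint_family A\<close> by (subst suminf_emeasure) auto
  also have "\<dots> = (\<Sum>m. ennreal (pmf \<nu> i) * conv (ek (1 - \<alpha>)) (jump_kernel m i j) t)"
    unfolding A_def by (simp only: interval_prob[OF j t])
  also have "\<dots> = ennreal (pmf \<nu> i) * bd_mass i j t"
    unfolding bd_mass_def bd_kernel_def[abs_def]
    by (simp only: ennreal_suminf_cmult conv_suminf_right measurable_jump_kernel measurable_frac_kernel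
        measurable_compose[OF _ measurable_ennreal])
  also have "\<dots> = ennreal (pmf \<nu> i * bd_prob i j t)"
    using t by (simp add: bd_mass_real ennreal_mult)
  finally show ?thesis
    by (simp add: bd.emeasure_eq_measure)
qed

lemma initial_prob: "measure bd_measure {\<omega>. renewal_path chain jump_time 0 \<omega> = i} = pmf \<nu> i"
  by (simp only: renewal_path_0 chain_0_prob)

lemma initial_prob_Int:
  "measure bd_measure {\<omega>. renewal_path chain jump_time 0 \<omega> = j \<and> renewal_path chain jump_time 0 \<omega> = i} =
    of_bool (i = j) * pmf \<nu> i"
proof (cases "i = j")
  case True
  then show ?thesis by (simp add: initial_prob)
next
  case False
  then have "measure bd_measure {\<omega>. renewal_path chain jump_time 0 \<omega> = j \<and> renewal_path chain jump_time 0 \<omega> = i} =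
      measure bd_measure {}"
    by (intro arg_cong[where f = "measure bd_measure"]) auto
  then show ?thesis using False by simp
qed

lemma renewal_path_cond_prob:
  assumes i: "0 < pmf \<nu> i" and j: "1 \<le> j" and t: "0 \<le> t"
  shows "\<P>(\<omega> in bd_measure. renewal_path chain jump_time t \<omega> = j \<bar> renewal_path chain jump_time 0 \<omega> = i) =
    bd_prob i j t"
proof (cases "t = 0")
  case True
  then show ?thesis using i by (simp add: cond_prob_def initial_prob initial_prob_Int bd_prob_def)
next
  case False
  then show ?thesis using i t renewal_path_prob[OF j, of t i]
    by (simp add: cond_prob_def initial_prob)
qed

lemma fractional_bd_process_renewal_path:
  "fractional_bd_process \<alpha> lam mu bd_measure (renewal_path chain jump_time)"
proof -
  \<comment> \<open>For initial states without mass the conditional probability is 0 by convention,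
    also at \<open>t = 0\<close>, while a solution must start at 1 for \<open>i = j = 0\<close>;
    hence the separate value at time 0.\<close>
  define p where "p i j t = (if j \<noteq> 0 then bd_prob i j t else if t = 0 then of_bool (i = 0)
    else \<P>(\<omega> in bd_measure. renewal_path chain jump_time t \<omega> = 0 \<bar> renewal_path chain jump_time 0 \<omega> = i))"
    for i j t
  have "minimal_backward_solution \<alpha> lam mu p"
    by (rule minimal_backward_solution_bd_prob) (auto simp: p_def cond_prob_def)
  moreover have "\<P>(\<omega> in bd_measure. renewal_path chain jump_time t \<omega> = j \<bar> renewal_path chain jump_time 0 \<omega> = i) =
      p i j t" if i: "0 < pmf \<nu> i" and t: "0 \<le> t" for i j t
  proof -
    consider "1 \<le> j" | "j = 0" "t = 0" | "j = 0" "t \<noteq> 0" by (cases j) auto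
    then show ?thesis
    proof cases
      case 1
      then show ?thesis using renewal_path_cond_prob[OF i 1 t] by (simp add: p_def)
    next
      case 2
      then show ?thesis using i by (simp add: cond_prob_def initial_prob initial_prob_Int p_def)
    next
      case 3
      then show ?thesis by (simp add: p_def)
    qed
  qed
  ultimately show ?thesis
    unfolding fractional_bd_process_def
    using prob_space_bd_measure measurable_renewal_path
    by (auto simp: initial_prob)
qed

lemma interarrival_cdf_chain:
  assumes i: "1 \<le> i" and t: "0 \<le> t" and pos: "0 < measure bd_measure {\<omega>. chain k \<omega> = i}"
    "0 < jump_prob bd_measure chain k i j"
  shows "interarrival_cdf bd_measure chain jump_time k i j t =
    1 - mittag_leffler \<alpha> (- (lam i + mu i) * t powr \<alpha>)"
proof -
  have "interarrival_cdf bd_measure chain jump_time k i j t = hold_prob i {..t}"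
    using pos by (simp add: interarrival_cdf_def renewal_kernel_chain jump_prob_chain)
  also have "\<dots> = 1 - mittag_leffler \<alpha> (- (lam i + mu i) * t powr \<alpha>)"
    by (rule hold_prob_atMost[OF i t])
  finally show ?thesis .
qed

end

text \<open>The backward system prescribes the conditional laws at single times given the initial
  state; in this sense an arbitrary process N is represented. The agreement rests on uniqueness of
  the minimal solution for \<open>j \<ge> 1\<close> and on the remaining mass for
  \<open>j = 0\<close>.\<close>

theorem theorem2:
  fixes \<alpha> :: real and lam mu :: "nat \<Rightarrow> real" and \<nu> :: "nat pmf"
  assumes \<alpha>: "0 < \<alpha>" "\<alpha> < 1"
    and rates: "\<And>i. i \<ge> 1 \<Longrightarrow> lam i > 0" "\<And>i. i \<ge> 1 \<Longrightarrow> mu i > 0"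
    and rates_0: "lam 0 = 0" "mu 0 = 0"
  shows "\<exists>(M :: (nat \<Rightarrow> nat \<times> real) measure) X S.
    markov_renewal_process M X S \<and>
    (\<forall>i. \<P>(\<omega> in M. X 0 \<omega> = i) = pmf \<nu> i) \<and>
    fractional_bd_process \<alpha> lam mu M (renewal_path X S) \<and>
    (\<forall>(\<Omega> :: 'a measure) N. fractional_bd_process \<alpha> lam mu \<Omega> N \<longrightarrow>
       (\<forall>i. \<P>(\<omega> in \<Omega>. N 0 \<omega> = i) > 0 \<and> pmf \<nu> i > 0 \<longrightarrow>
          (\<forall>j. \<forall>t\<ge>0. \<P>(\<omega> in \<Omega>. N t \<omega> = j \<bar> N 0 \<omega> = i) =
             \<P>(\<omega> in M. renewal_path X S t \<omega> = j \<bar> renewal_path X S 0 \<omega> = i)))) \<and>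
    (\<forall>k i. i \<ge> 1 \<and> \<P>(\<omega> in M. X k \<omega> = i) > 0 \<longrightarrow>
       jump_prob M X k i (i + 1) = lam i / (lam i + mu i) \<and>
       jump_prob M X k i (i - 1) = mu i / (lam i + mu i)) \<and>
    (\<forall>k. \<P>(\<omega> in M. X k \<omega> = 0) > 0 \<longrightarrow> jump_prob M X k 0 0 = 1) \<and>
    cond_independent_interarrivals M X S
      (\<lambda>i t. 1 - mittag_leffler \<alpha> (- (lam i + mu i) * t powr \<alpha>)) \<and>
    (\<forall>k i j. i \<ge> 1 \<and> \<P>(\<omega> in M. X k \<omega> = i) > 0 \<and> jump_prob M X k i j > 0 \<longrightarrow>
       (\<forall>t\<ge>0. interarrival_cdf M X S k i j t =
          1 - mittag_leffler \<alpha> (- (lam i + mu i) * t powr \<alpha>)))"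
proof -
  interpret fractional_bd_construction \<alpha> lam mu \<nu>
    using assms by unfold_locales auto
  show ?thesis
  proof (rule exI[of _ bd_measure], rule exI[of _ chain], rule exI[of _ jump_time],
      intro conjI allI impI)
    show "markov_renewal_process bd_measure chain jump_time"
      by (rule markov_renewal_process_chain)
    show "\<P>(\<omega> in bd_measure. chain 0 \<omega> = i) = pmf \<nu> i" for i
      using chain_0_prob[of i] by simp
    show "fractional_bd_process \<alpha> lam mu bd_measure (renewal_path chain jump_time)"
      by (rule fractional_bd_process_renewal_path)
    show "\<P>(\<omega> in \<Omega>. N t \<omega> = j \<bar> N 0 \<omega> = i) =
        \<P>(\<omega> in bd_measure. renewal_path chain jump_time t \<omega> = j \<bar> renewal_path chain jump_time 0 \<omega> = i)"
      if "fractional_bd_process \<alpha> lam mu \<Omega> N" "\<P>(\<omega> in \<Omega>. N 0 \<omega> = i) > 0 \<and> pmf \<nu> i > 0" "0 \<le> t"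
      for \<Omega> :: "'a measure" and N i j t
      using that fractional_bd_process_renewal_path
      by (intro fractional_bd_process_cond_prob_unique) (auto simp: initial_prob)
    show "jump_prob bd_measure chain k i (i + 1) = lam i / (lam i + mu i)"
      "jump_prob bd_measure chain k i (i - 1) = mu i / (lam i + mu i)"
      if "i \<ge> 1 \<and> \<P>(\<omega> in bd_measure. chain k \<omega> = i) > 0" for k i
      using that by (auto simp: jump_prob_chain step_prob_pos)
    show "jump_prob bd_measure chain k 0 0 = 1" if "\<P>(\<omega> in bd_measure. chain k \<omega> = 0) > 0" for k
      using that by (simp add: jump_prob_chain step_prob_0)
    show "cond_independent_interarrivals bd_measure chain jump_time
        (\<lambda>i t. 1 - mittag_leffler \<alpha> (- (lam i + mu i) * t powr \<alpha>))"
      by (rule cond_independent_interarrivals_chain)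
    show "interarrival_cdf bd_measure chain jump_time k i j t =
        1 - mittag_leffler \<alpha> (- (lam i + mu i) * t powr \<alpha>)"
      if "i \<ge> 1 \<and> \<P>(\<omega> in bd_measure. chain k \<omega> = i) > 0 \<and> jump_prob bd_measure chain k i j > 0" "0 \<le> t"
      for k i j t
      using that by (intro interarrival_cdf_chain) auto
  qed
qed

end
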